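(* Let $T$ be a Calderón–Zygmund operator in $\mathbb{R}^d$ with parameters $C_{\mathrm{cz}}$ and $\alpha$, and let $w$ be an $A_2$ weight on $\mathbb{R}^d$. Then for all $f\in L^2(w)$ \[ \|Tf\|_{L^2(w)}\le C\,[w]_{A_2}\,\|f\|_{L^2(w)}, \] where the constant $C$ depends only on the dimension $d$, the parameters $C_{\mathrm{cz}},\alpha$ of the operator $T$, and the norm $\|T\|_{L^2\to L^2}$ of $T$ in the non-weighted space $L^2(\mathbb{R}^d)$ (in particular $C$ does not depend on $w$ or $f$).
   Context: A Calderón–Zygmund operator in $\mathbb{R}^d$ (with parameters $C_{\mathrm{cz}}<\infty$, $\alpha>0$) is an integral operator $T$, bounded in $L^2(\mathbb{R}^d,dx)$, with kernel $K$ (so $Tf(x)=\int K(x,y)f(y)\,dy$ for $x\notin \operatorname{supp} f$, $f$ bounded with compact support) satisfying (i) $|K(x,y)|\le C_{\mathrm{cz}}|x-y|^{-d}$ for all $x\ne y$; (ii) $|K(x,y)-K(x',y)|+|K(y,x)-K(y,x')|\le C_{\mathrm{cz}}\dfrac{|x-x'|^{\alpha}}{|x-y|^{d+\alpha}}$ for all $x,x',y$ with $|x-x'|<|x-y|/2$. A weight $w$ is an a.e. positive locally integrable function with $w^{-1}$ locally integrable; $\|f\|_{L^2(w)}^2=\int|f|^2w\,dx$. The weight is an $A_2$ weight if \[ [w]_{A_2}:=\sup_Q\Big(|Q|^{-1}\int_Q w\,dx\Big)\Big(|Q|^{-1}\int_Q w^{-1}\,dx\Big)<\infty, \] the supremum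 being over all cubes $Q\subset\mathbb{R}^d$. The operator $T$ is understood on $L^2(w)$ by density, i.e. the estimate is for $f\in L^2(dx)\cap L^2(w)$ and $T$ is extended to $L^2(w)$ by continuity. *)

theory Defs
  imports "HOL-Analysis.Analysis"
begin

text \<open>
  Functions are complex valued and stand for their almost-everywhere classes; operators act on
  representatives, and all identities between their values are required almost everywhere only.
\<close>

definition L2_space :: "'a measure \<Rightarrow> ('a \<Rightarrow> complex) set" where
  "L2_space M = {f \<in> borel_measurable M. integrable M (\<lambda>x. (cmod (f x))\<^sup>2)}"

definition L2_nrm :: "'a measure \<Rightarrow> ('a \<Rightarrow> complex) \<Rightarrow> real" where
  "L2_nrm M f = sqrt (LINT x|M. (cmod (f x))\<^sup>2)"

text \<open>
  Linearity and boundedness together imply that \<open>T f = T g\<close> a.e. whenever \<open>f = g\<close> a.e., so such a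
  \<open>T\<close> does induce a bounded linear operator on classes.
\<close>

definition L2_bounded_operator :: "'a measure \<Rightarrow> (('a \<Rightarrow> complex) \<Rightarrow> ('a \<Rightarrow> complex)) \<Rightarrow> bool" where
  "L2_bounded_operator M T \<longleftrightarrow>
     (\<forall>f\<in>L2_space M. T f \<in> L2_space M) \<and>
     (\<forall>f\<in>L2_space M. \<forall>g\<in>L2_space M. \<forall>a b.
        AE x in M. T (\<lambda>y. a * f y + b * g y) x = a * T f x + b * T g x) \<and>
     (\<exists>B. \<forall>f\<in>L2_space M. L2_nrm M (T f) \<le> B * L2_nrm M f)"

definition L2_opnorm :: "'a measure \<Rightarrow> (('a \<Rightarrow> complex) \<Rightarrow> ('a \<Rightarrow> complex)) \<Rightarrow> real" where
  "L2_opnorm M T = (SUP f\<in>{f \<in> L2_space M. L2_nrm M f \<le> 1}. L2_nrm M (T f))"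

definition CZ_kernel :: "real \<Rightarrow> real \<Rightarrow> (real^'n \<Rightarrow> real^'n \<Rightarrow> complex) \<Rightarrow> bool" where
  "CZ_kernel Ccz \<alpha> K \<longleftrightarrow>
     (\<forall>x y. x \<noteq> y \<longrightarrow> cmod (K x y) \<le> Ccz / norm (x - y) ^ CARD('n)) \<and>
     (\<forall>x x' y. norm (x - x') < norm (x - y) / 2 \<longrightarrow>
        cmod (K x y - K x' y) + cmod (K y x - K y x')
          \<le> Ccz * (norm (x - x') powr \<alpha> / norm (x - y) powr (real CARD('n) + \<alpha>)))"

definition closed_support :: "('a::topological_space \<Rightarrow> complex) \<Rightarrow> 'a set" where
  "closed_support f = closure {x. f x \<noteq> 0}"

text \<open>
  For \<open>x\<close> outside the compact support of a bounded \<open>f\<close>, the size bound on \<open>K\<close> makes the integrand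
  below bounded with bounded support, and the smoothness bound makes \<open>K x\<close> continuous away
  from \<open>x\<close>; hence the integral converges absolutely.
\<close>

definition has_kernel ::
    "((real^'n \<Rightarrow> complex) \<Rightarrow> (real^'n \<Rightarrow> complex)) \<Rightarrow> (real^'n \<Rightarrow> real^'n \<Rightarrow> complex) \<Rightarrow> bool" where
  "has_kernel T K \<longleftrightarrow>
     (\<forall>f \<in> borel_measurable lebesgue. bounded (range f) \<and> compact (closed_support f) \<longrightarrow>
        (AE x in lebesgue. x \<notin> closed_support f \<longrightarrow> T f x = (LINT y|lebesgue. K x y * f y)))"

definition CZ_operator ::
    "real \<Rightarrow> real \<Rightarrow> ((real^'n \<Rightarrow> complex) \<Rightarrow> (real^'n \<Rightarrow> complex)) \<Rightarrow> bool" where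
  "CZ_operator Ccz \<alpha> T \<longleftrightarrow>
     L2_bounded_operator lebesgue T \<and> (\<exists>K. CZ_kernel Ccz \<alpha> K \<and> has_kernel T K)"

definition locally_integrable :: "('a::euclidean_space \<Rightarrow> real) \<Rightarrow> bool" where
  "locally_integrable u \<longleftrightarrow>
     u \<in> borel_measurable lebesgue \<and> (\<forall>S. compact S \<longrightarrow> set_integrable lebesgue S u)"

definition is_weight :: "('a::euclidean_space \<Rightarrow> real) \<Rightarrow> bool" where
  "is_weight w \<longleftrightarrow>
     (AE x in lebesgue. 0 < w x) \<and> locally_integrable w \<and> locally_integrable (\<lambda>x. inverse (w x))"

definition weighted :: "('a::euclidean_space \<Rightarrow> real) \<Rightarrow> 'a measure" where
  "weighted w = density lebesgue (\<lambda>x. ennreal (w x))"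

text \<open>Cubes have sides parallel to the coordinate axes.\<close>

definition cubes :: "(real^'n) set set" where
  "cubes = {cbox a (\<chi> i. a $ i + l) | a l. 0 < l}"

definition cube_average :: "'a::euclidean_space set \<Rightarrow> ('a \<Rightarrow> real) \<Rightarrow> real" where
  "cube_average Q u = (LINT x:Q|lebesgue. u x) / measure lebesgue Q"

definition A2_characteristic :: "(real^'n \<Rightarrow> real) \<Rightarrow> ennreal" where
  "A2_characteristic w =
     (SUP Q\<in>cubes. ennreal (cube_average Q w * cube_average Q (\<lambda>x. inverse (w x))))"

definition A2_weight :: "(real^'n \<Rightarrow> real) \<Rightarrow> bool" where
  "A2_weight w \<longleftrightarrow> is_weight w \<and> A2_characteristic w < \<infinity>"

text \<open>
  \<open>S\<close> is a realization on \<open>L2_space (weighted w)\<close> of \<open>T\<close>, extended by continuity from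
  \<open>L2_space lebesgue \<inter> L2_space (weighted w)\<close>. This intersection is dense in
  \<open>L2_space (weighted w)\<close>, so for each \<open>f\<close> the value \<open>S f\<close> is determined almost everywhere.
\<close>

definition weighted_extension ::
    "((real^'n \<Rightarrow> complex) \<Rightarrow> (real^'n \<Rightarrow> complex)) \<Rightarrow> (real^'n \<Rightarrow> real) \<Rightarrow>
     ((real^'n \<Rightarrow> complex) \<Rightarrow> (real^'n \<Rightarrow> complex)) \<Rightarrow> bool" where
  "weighted_extension T w S \<longleftrightarrow>
     L2_bounded_operator (weighted w) S \<and>
     (\<forall>f \<in> L2_space lebesgue \<inter> L2_space (weighted w). AE x in lebesgue. S f x = T f x)"

end

theory Submission
  imports Defs
begin

text \<open>
  The proof follows Lerner and Ombrosi. The weak type (1,1) bound shows that on a cube \<open>Q\<close>, outside a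
  family of dyadic subcubes \<open>P\<close> filling at most half of \<open>Q\<close>, the function \<open>T (f 1\<^bsub>NQ\<^esub>)\<close> is bounded by the
  average of \<open>|f|\<close> over the dilate \<open>NQ\<close>, while on each \<open>P\<close> it differs from \<open>T (f 1\<^bsub>NP\<^esub>)\<close> by at most a
  multiple of that average. Iteration dominates \<open>|T f|\<close> by a sparse sum of averages over cubes \<open>NQ\<close>. The
  one-third trick replaces each \<open>NQ\<close> by a cube \<open>R\<close> of one of \<open>2 ^ d\<close> shifted dyadic grids. With \<open>\<sigma> = 1 / w\<close>,
  writing the averages of \<open>|f|\<close> and \<open>g w\<close> over \<open>R\<close> in terms of averages with respect to \<open>\<sigma>\<close> and \<open>w\<close>
  produces the factor \<open>\<sigma>(R) w(R) / |R|\<^sup>2\<close>, which costs one power of the characteristic, and what remains is bounded by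
  the integral of the product of the dyadic maximal functions with respect to \<open>\<sigma>\<close> and \<open>w\<close>, whose
  norms on \<open>L\<^sup>2(\<sigma>)\<close> and \<open>L\<^sup>2(w)\<close> do not depend on the weight.
\<close>

section \<open>Dyadic cubes\<close>

text \<open>The operator is given through its action on classes and, off the support of a function,
  through its kernel. Hence on a stopping cube \<open>P\<close> the values of \<open>T\<close> at an
  arbitrary point are compared with those at one good point of \<open>P\<close>, and only the part
  of \<open>f\<close> outside the dilate of \<open>P\<close> goes through the kernel. The dilation
  factor \<open>N = 4 d + 1\<close> comes from here: outside the dilate the distance to a point of
  \<open>P\<close> is at least \<open>2 d\<close> sides, twice a bound for the diameter, and this is
  what the smoothness condition asks for. The maximal inequality used at the end holds with the same
  constant for every measure, but for families in which any two sets are nested or disjoint. The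
  dilates of dyadic cubes are not of this kind; the cubes of one shifted grid are. Passing to them
  keeps the disjoint sets that witness sparseness, since these lie in the original cubes. Infinite
  sums and limits are kept away from \<open>T\<close>: it is estimated on bounded functions of
  bounded support, split into finite sums, the maximal functions belong to finite families, and
  Fatou's lemma gives the general case.\<close>

definition half_open_box :: "real^'n \<Rightarrow> real^'n \<Rightarrow> (real^'n) set" where
  "half_open_box a b = {x. \<forall>i. a $ i \<le> x $ i \<and> x $ i < b $ i}"

lemma half_open_box_borel [measurable]: "half_open_box a b \<in> sets borel"
  unfolding half_open_box_def by measurable

lemma half_open_box_lebesgue [measurable]: "half_open_box a b \<in> sets lebesgue"
  using half_open_box_borel by (metis sets_completionI_sets sets_lborel)

text \<open>As a simp rule it would replace the measure of a set by that of its
  \<open>main_part\<close>.\<close>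

declare emeasure_completion [simp del]

text \<open>Squeezed between the open and the closed box, whose volumes agree.\<close>

lemma emeasure_half_open_box:
  fixes a b :: "real^'n"
  assumes "\<And>i. a $ i \<le> b $ i"
  shows "emeasure lebesgue (half_open_box a b) = ennreal (\<Prod>i\<in>UNIV. b $ i - a $ i)"
proof -
  have Basis_cart: "(Basis :: (real^'n) set) = range (\<lambda>i. axis i 1)"
    by (auto simp: Basis_vec_def)
  have inj: "inj (\<lambda>i::'n. axis i (1::real))"
    by (auto simp: inj_on_def axis_eq_axis)
  have pr: "(\<Prod>k\<in>(Basis :: (real^'n) set). (b - a) \<bullet> k) = (\<Prod>i\<in>UNIV. b $ i - a $ i)"
    unfolding Basis_cart by (subst prod.reindex[OF inj]) (simp add: inner_axis)
  have le: "\<forall>k\<in>(Basis :: (real^'n) set). a \<bullet> k \<le> b \<bullet> k"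
    unfolding Basis_cart using assms by (auto simp: inner_axis)
  have e1: "emeasure lebesgue (box a b) = ennreal (\<Prod>i\<in>UNIV. b $ i - a $ i)"
    using le pr emeasure_lborel_box[of a b] by (simp add: emeasure_completion)
  have e2: "emeasure lebesgue (cbox a b) = ennreal (\<Prod>i\<in>UNIV. b $ i - a $ i)"
    using le pr emeasure_lborel_cbox[of a b] by (simp add: emeasure_completion)
  have s1: "box a b \<subseteq> half_open_box a b" and s2: "half_open_box a b \<subseteq> cbox a b"
    by (auto simp: half_open_box_def mem_box_cart le_less)
  show ?thesis
    using emeasure_mono[OF s1, of lebesgue] emeasure_mono[OF s2, of lebesgue] e1 e2
    by (simp add: antisym)
qed

type_synonym 'n dyadic_index = "nat \<times> ('n \<Rightarrow> int)"

text \<open>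
  The index \<open>(k, m)\<close> stands for the half-open cube of side \<open>L / 2 ^ k\<close> at the point \<open>m\<close> of the grid of
  that mesh with origin \<open>v\<close>: larger levels are smaller cubes, and no cube is larger than \<open>L\<close>. The
  parameter \<open>a\<close> enlarges the cube concentrically by the factor \<open>2 * a + 1\<close>.
\<close>

definition dilate :: "real^'n \<Rightarrow> real \<Rightarrow> nat \<Rightarrow> 'n dyadic_index \<Rightarrow> (real^'n) set" where
  "dilate v L a p = half_open_box (\<chi> i. v $ i + (of_int (snd p i) - real a) * (L / 2 ^ fst p))
                     (\<chi> i. v $ i + (of_int (snd p i) + 1 + real a) * (L / 2 ^ fst p))"

abbreviation dcube :: "real^'n \<Rightarrow> real \<Rightarrow> 'n dyadic_index \<Rightarrow> (real^'n) set" where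
  "dcube v L p \<equiv> dilate v L 0 p"

text \<open>\<open>div\<close> rounds down, so negative grid positions are treated correctly as
  well. Subtraction of levels stops at 0: the pair is the true ancestor when
  \<open>j \<le> fst p\<close>, and every use respects this.\<close>

definition ancestor :: "nat \<Rightarrow> 'n dyadic_index \<Rightarrow> 'n dyadic_index" where
  "ancestor j p = (fst p - j, \<lambda>i. snd p i div 2 ^ j)"

lemma mem_dilate:
  "x \<in> dilate v L a p \<longleftrightarrow> (\<forall>i. (of_int (snd p i) - real a) * (L / 2 ^ fst p) \<le> x $ i - v $ i \<and>
      x $ i - v $ i < (of_int (snd p i) + 1 + real a) * (L / 2 ^ fst p))"
  by (auto simp: dilate_def half_open_box_def algebra_simps)

lemma dilate_lebesgue [measurable]: "dilate v L a p \<in> sets lebesgue"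
  unfolding dilate_def by measurable

lemma emeasure_dilate:
  fixes v :: "real^'n"
  assumes "0 < L"
  shows "emeasure lebesgue (dilate v L a p) = ennreal ((real (2 * a + 1) * (L / 2 ^ fst p)) ^ CARD('n))"
proof -
  have "emeasure lebesgue (dilate v L a p) =
    ennreal (\<Prod>i\<in>(UNIV::'n set). (v $ i + (of_int (snd p i) + 1 + real a) * (L / 2 ^ fst p)) -
       (v $ i + (of_int (snd p i) - real a) * (L / 2 ^ fst p)))"
    unfolding dilate_def using assms
    by (subst emeasure_half_open_box) (auto intro!: mult_right_mono simp del: times_divide_eq_right)
  also have "\<dots> = ennreal (\<Prod>i\<in>(UNIV::'n set). real (2 * a + 1) * (L / 2 ^ fst p))"
    by (simp add: algebra_simps diff_divide_distrib add_divide_distrib)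
  finally show ?thesis by simp
qed

lemma emeasure_dilate_dcube:
  fixes v :: "real^'n"
  assumes "0 < L"
  shows "emeasure lebesgue (dilate v L a p) =
    ennreal (real (2 * a + 1) ^ CARD('n)) * emeasure lebesgue (dcube v L p)"
  using assms by (simp add: emeasure_dilate ennreal_mult[symmetric] power_mult_distrib power_divide)

lemma emeasure_dilate_pos: "0 < L \<Longrightarrow> 0 < emeasure lebesgue (dilate v L a p)"
  and emeasure_dilate_finite: "0 < L \<Longrightarrow> emeasure lebesgue (dilate v L a p) < \<infinity>"
  by (simp_all add: emeasure_dilate)

text \<open>The index of the cell at a given level is read off from a point by a floor. Nesting then
  becomes the arithmetic fact \<open>floor_div_pow2\<close>.\<close>

lemma mem_dcube_iff:
  assumes "0 < L"
  shows "x \<in> dcube v L p \<longleftrightarrow> (\<forall>i. snd p i = \<lfloor>(x $ i - v $ i) / (L / 2 ^ fst p)\<rfloor>)"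
proof -
  have s: "0 < L / 2 ^ fst p" using assms by simp
  have "((of_int m) * (L / 2 ^ fst p) \<le> u \<and> u < (of_int m + 1) * (L / 2 ^ fst p)) \<longleftrightarrow>
      m = \<lfloor>u / (L / 2 ^ fst p)\<rfloor>" for m u
    by (metis floor_eq_iff pos_divide_less_eq pos_le_divide_eq s)
  then show ?thesis by (auto simp: mem_dilate)
qed

lemma floor_div_pow2: "\<lfloor>x / 2 ^ j\<rfloor> = \<lfloor>x::real\<rfloor> div 2 ^ j"
  using floor_divide_real_eq_div[of "2 ^ j" x] by simp

lemma mem_dcube_ancestor:
  assumes "0 < L" "x \<in> dcube v L p" "j \<le> fst p"
  shows "x \<in> dcube v L (ancestor j p)"
proof -
  have "(x $ i - v $ i) / (L / 2 ^ (fst p - j)) = (x $ i - v $ i) / (L / 2 ^ fst p) / 2 ^ j" for i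
    using assms by (simp add: power_diff)
  then show ?thesis
    using assms by (simp add: mem_dcube_iff ancestor_def floor_div_pow2 del: divide_divide_eq_right divide_divide_eq_left)
qed

lemma dcube_ancestor_subset: "0 < L \<Longrightarrow> j \<le> fst p \<Longrightarrow> dcube v L p \<subseteq> dcube v L (ancestor j p)"
  using mem_dcube_ancestor by blast

lemma dcube_nonempty:
  assumes "0 < L" shows "dcube v L p \<noteq> {}"
  using emeasure_dilate_pos[OF assms, of v 0 p] by force

lemma dcube_same_level:
  assumes "0 < L" "x \<in> dcube v L p" "x \<in> dcube v L q" "fst p = fst q"
  shows "p = q"
proof -
  have "snd p = snd q" using assms by (auto simp: mem_dcube_iff)
  then show ?thesis using assms(4) by (simp add: prod_eq_iff)
qed

lemma dcube_ancestor_eq: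
  assumes "0 < L" "x \<in> dcube v L p" "x \<in> dcube v L q" "fst p \<le> fst q"
  shows "p = ancestor (fst q - fst p) q"
  using assms mem_dcube_ancestor[OF assms(1,3), of "fst q - fst p"]
  by (intro dcube_same_level[OF assms(1,2)]) (auto simp: ancestor_def)

lemma dcube_nested:
  assumes "0 < L" "x \<in> dcube v L p" "x \<in> dcube v L q" "fst p \<le> fst q"
  shows "dcube v L q \<subseteq> dcube v L p"
  using dcube_ancestor_eq[OF assms] dcube_ancestor_subset[OF assms(1), of "fst q - fst p" q v] by simp

lemma dcube_laminar:
  assumes "0 < L"
  shows "dcube v L p \<inter> dcube v L q = {} \<or> dcube v L p \<subseteq> dcube v L q \<or> dcube v L q \<subseteq> dcube v L p"
  using dcube_nested[OF assms] by (metis disjoint_iff nat_le_linear)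

lemma dcube_subset_level:
  fixes v :: "real^'n"
  assumes "0 < L" "dcube v L q \<subseteq> dcube v L p"
  shows "fst p \<le> fst q"
proof (rule ccontr)
  assume "\<not> fst p \<le> fst q"
  then have lt: "fst q < fst p" by simp
  have "emeasure lebesgue (dcube v L q) \<le> emeasure lebesgue (dcube v L p)"
    by (intro emeasure_mono assms) auto
  then have "(L / 2 ^ fst q) ^ CARD('n) \<le> (L / 2 ^ fst p) ^ CARD('n)"
    using assms by (simp add: emeasure_dilate)
  then have "L / 2 ^ fst q \<le> L / 2 ^ fst p"
    using assms by (simp add: power_mono_iff)
  moreover have "L / 2 ^ fst p < L / 2 ^ fst q"
    using assms lt by (intro divide_strict_left_mono) auto
  ultimately show False by simp
qed

lemma ancestor_0 [simp]: "ancestor 0 p = p" by (simp add: ancestor_def)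
lemma fst_ancestor [simp]: "fst (ancestor j p) = fst p - j" by (simp add: ancestor_def)

lemma emeasure_dilate_parent:
  fixes v :: "real^'n"
  assumes "0 < L" "0 < fst p"
  shows "emeasure lebesgue (dilate v L a (ancestor 1 p)) = 2 ^ CARD('n) * emeasure lebesgue (dilate v L a p)"
proof -
  obtain k where k: "fst p = Suc k" using assms(2) gr0_implies_Suc by blast
  have "real (2 * a + 1) * (L / 2 ^ k) = 2 * (real (2 * a + 1) * (L / 2 ^ fst p))"
    by (simp add: k)
  then have "(real (2 * a + 1) * (L / 2 ^ k)) ^ CARD('n) = 2 ^ CARD('n) * (real (2 * a + 1) * (L / 2 ^ fst p)) ^ CARD('n)"
    by (simp only: power_mult_distrib)
  moreover have "fst (ancestor 1 p) = k" by (simp add: k)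
  ultimately have "emeasure lebesgue (dilate v L a (ancestor 1 p)) =
      ennreal (2 ^ CARD('n) * (real (2 * a + 1) * (L / 2 ^ fst p)) ^ CARD('n))"
    using emeasure_dilate[OF assms(1), of v a "ancestor 1 p"] by simp
  also have "\<dots> = 2 ^ CARD('n) * emeasure lebesgue (dilate v L a p)"
    using assms by (subst ennreal_mult) (auto simp: emeasure_dilate ennreal_power[symmetric])
  finally show ?thesis .
qed

text \<open>Containment of the cubes orders their faces coordinate by coordinate, and the contained
  cube has the smaller side, so its margin is the smaller one too.\<close>

lemma dilate_mono_dilate:
  assumes "0 < L" "dcube v L p \<subseteq> dcube v L q"
  shows "dilate v L a p \<subseteq> dilate v L a q"
proof
  fix x assume x: "x \<in> dilate v L a p"
  define s t where "s = L / 2 ^ fst p" and "t = L / 2 ^ fst q"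
  have "fst q \<le> fst p" by (rule dcube_subset_level[OF assms])
  then have st: "s \<le> t" "0 < s" using assms(1) unfolding s_def t_def
    by (auto intro!: divide_left_mono)
  define l where "l = (\<chi> i. v $ i + of_int (snd p i) * s)"
  have "l \<in> dcube v L p" using st unfolding mem_dilate s_def[symmetric] by (simp add: l_def algebra_simps)
  then have lq: "l \<in> dcube v L q" using assms by auto
  have "of_int (snd q i) * t \<le> of_int (snd p i) * s \<and> of_int (snd p i + 1) * s \<le> of_int (snd q i + 1) * t" for i
  proof
    show "of_int (snd q i) * t \<le> of_int (snd p i) * s"
      using lq by (auto simp: mem_dilate l_def t_def)
    show "of_int (snd p i + 1) * s \<le> of_int (snd q i + 1) * t"
    proof (rule ccontr)
      assume "\<not> ?thesis"
      then have gt: "of_int (snd q i + 1) * t < of_int (snd p i + 1) * s" by simp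
      \<comment> \<open>The upper corner is missing from a half-open cube. This point of
        \<open>p\<close> replaces it: its coordinate \<open>i\<close> lies on or beyond the upper
        face of \<open>q\<close>.\<close>
      define y where "y = (\<chi> j. v $ j + (if j = i then max (of_int (snd q i + 1) * t) (of_int (snd p i) * s) else of_int (snd p j) * s))"
      have "y \<in> dcube v L p" using gt st unfolding mem_dilate s_def[symmetric] by (auto simp: y_def max_def algebra_simps)
      then have "y \<in> dcube v L q" using assms by auto
      then have "y $ i - v $ i < (of_int (snd q i) + 1 + real 0) * t" unfolding mem_dilate t_def[symmetric] by blast
      then show False by (simp add: y_def max_def algebra_simps split: if_splits)
    qed
  qed
  note b = this
  show "x \<in> dilate v L a q"
    unfolding mem_dilate
  proof (intro allI)
    fix i
    have 1: "(of_int (snd p i) - real a) * s \<le> x $ i - v $ i"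
      and 2: "x $ i - v $ i < (of_int (snd p i) + 1 + real a) * s"
      using x by (auto simp: mem_dilate s_def)
    have 3: "real a * s \<le> real a * t" using st by (intro mult_left_mono) auto
    show "(of_int (snd q i) - real a) * (L / 2 ^ fst q) \<le> x $ i - v $ i \<and>
      x $ i - v $ i < (of_int (snd q i) + 1 + real a) * (L / 2 ^ fst q)"
      using 1 2 3 b[of i] unfolding t_def[symmetric] by (simp add: algebra_simps)
  qed
qed

lemma dcube_subset_dilate: "0 < L \<Longrightarrow> a \<le> b \<Longrightarrow> dilate v L a p \<subseteq> dilate v L b p"
proof
  fix x assume L: "0 < L" "a \<le> b" and x: "x \<in> dilate v L a p"
  have "real a * (L / 2 ^ fst p) \<le> real b * (L / 2 ^ fst p)"
    using L by (intro mult_right_mono) auto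
  then show "x \<in> dilate v L b p"
    using x unfolding mem_dilate distrib_right left_diff_distrib
    by (intro allI) (drule_tac x = i in spec, linarith)
qed

section \<open>Maximal cubes of a family\<close>

definition maximal :: "real^'n \<Rightarrow> real \<Rightarrow> 'n dyadic_index set \<Rightarrow> 'n dyadic_index set" where
  "maximal v L S = {p \<in> S. \<forall>q\<in>S. dcube v L p \<subseteq> dcube v L q \<longrightarrow> q = p}"

lemma maximal_subset: "maximal v L S \<subseteq> S" by (auto simp: maximal_def)

text \<open>Levels are natural numbers, so among the cubes of \<open>S\<close> above a given one
  there is one of least level. This is where it matters that the cubes of a grid have bounded
  size.\<close>

lemma ex_maximal:
  assumes "0 < L" "p \<in> S"
  shows "\<exists>q\<in>maximal v L S. dcube v L p \<subseteq> dcube v L q"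
proof -
  define P where "P q \<longleftrightarrow> q \<in> S \<and> dcube v L p \<subseteq> dcube v L q" for q
  have "P p" using assms by (simp add: P_def)
  then obtain q where q: "P q" "\<forall>r. P r \<longrightarrow> fst q \<le> fst r"
    using ex_has_least_nat[of P p fst] by blast
  have "q \<in> maximal v L S"
    unfolding maximal_def
  proof safe
    show "q \<in> S" using q P_def by auto
    fix r assume r: "r \<in> S" "dcube v L q \<subseteq> dcube v L r"
    then have "P r" using q(1) by (auto simp: P_def)
    then have "fst q \<le> fst r" "fst r \<le> fst q" using q(2) dcube_subset_level[OF assms(1) r(2)] by blast+
    moreover obtain x where "x \<in> dcube v L q" using dcube_nonempty[OF assms(1)] by blast
    ultimately show "r = q" using r dcube_same_level[OF assms(1), of x v r q] by auto
  qed
  then show ?thesis using q(1) by (auto simp: P_def)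
qed

lemma disjoint_maximal:
  assumes "0 < L" shows "disjoint_family_on (dcube v L) (maximal v L S)"
  unfolding disjoint_family_on_def
proof (intro ballI impI, rule ccontr)
  fix p q assume pq: "p \<in> maximal v L S" "q \<in> maximal v L S" "p \<noteq> q" and "dcube v L p \<inter> dcube v L q \<noteq> {}"
  then obtain x where "x \<in> dcube v L p" "x \<in> dcube v L q" by blast
  with pq
  show False
    using dcube_nested[OF assms, of x v p q] dcube_nested[OF assms, of x v q p]
    by (cases "fst p \<le> fst q") (auto simp: maximal_def)
qed

lemma UN_maximal:
  assumes "0 < L" shows "(\<Union>p\<in>maximal v L S. dcube v L p) = (\<Union>p\<in>S. dcube v L p)"
  using ex_maximal[OF assms, of _ S v] maximal_subset[of v L S] by blast

text \<open>The stopping condition fails on the proper ancestors of a selected cube. Applied to the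
  parent, this turns maximality into an upper bound on the cube itself, up to a factor
  \<open>2 ^ d\<close>.\<close>

lemma maximal_parent_notin:
  assumes "0 < L" "p \<in> maximal v L S" "0 < j" "j \<le> fst p" 
  shows "ancestor j p \<notin> S"
proof
  assume "ancestor j p \<in> S"
  then have "ancestor j p = p" using assms dcube_ancestor_subset[OF assms(1,4)] by (auto simp: maximal_def)
  then have "fst (ancestor j p) = fst p" by simp
  then show False using assms by simp
qed

text \<open>The bound \<open>k\<close> on the level serves to find proper subcubes of a given
  cube.\<close>

lemma ex_small_dcube:
  fixes x :: "real^'n"
  assumes "0 < L" "open G" "x \<in> G"
  shows "\<exists>p. k \<le> fst p \<and> x \<in> dcube v L p \<and> dcube v L p \<subseteq> G"
proof -
  obtain e where e: "0 < e" "ball x e \<subseteq> G" using assms openE by blast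
  define C where "C = real CARD('n) * L"
  have C: "0 < C" using assms by (simp add: C_def)
  have "\<exists>n. C / e < 2 ^ n" by (simp add: real_arch_pow)
  then obtain n where n: "C / e < 2 ^ n" by blast
  define N where "N = n + k"
  have "(2::real) ^ n \<le> 2 ^ N" by (simp add: N_def)
  then have "C / e < 2 ^ N" using n by linarith
  then have N: "C / 2 ^ N < e" using e by (simp add: field_simps)
  define p :: "'n dyadic_index" where "p = (N, \<lambda>i. \<lfloor>(x $ i - v $ i) / (L / 2 ^ N)\<rfloor>)"
  have xp: "x \<in> dcube v L p" using assms by (simp add: mem_dcube_iff p_def)
  have "y \<in> ball x e" if y: "y \<in> dcube v L p" for y
  proof -
    have "\<bar>(x - y) $ i\<bar> \<le> L / 2 ^ N" for i
      using xp y unfolding mem_dilate by (auto simp: p_def algebra_simps abs_le_iff dest!: spec[of _ i])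
    then have "norm (x - y) \<le> (\<Sum>i\<in>(UNIV::'n set). L / 2 ^ N)"
      by (intro order.trans[OF norm_le_l1_cart] sum_mono) auto
    then show ?thesis using N by (simp add: C_def dist_norm)
  qed
  then show ?thesis using xp e by (intro exI[of _ p]) (auto simp: p_def N_def)
qed

section \<open>Comparison of measures on unions\<close>

lemma disjoint_UN_emeasure_le:
  assumes "countable I" "disjoint_family_on A I"
    and "\<And>i. i \<in> I \<Longrightarrow> A i \<in> sets M" "\<And>i. i \<in> I \<Longrightarrow> A i \<in> sets N"
    and "\<And>i. i \<in> I \<Longrightarrow> emeasure M (A i) \<le> c * emeasure N (A i)"
  shows "emeasure M (\<Union>i\<in>I. A i) \<le> c * emeasure N (\<Union>i\<in>I. A i)"
proof -
  have "(\<integral>\<^sup>+i. emeasure M (A i) \<partial>count_space I) \<le> (\<integral>\<^sup>+i. c * emeasure N (A i) \<partial>count_space I)"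
    using assms by (intro nn_integral_mono) auto
  then show ?thesis
    using assms by (simp add: emeasure_UN_countable nn_integral_cmult)
qed

text \<open>The sets \<open>B i\<close> may overlap, as the dilates of disjoint cubes do: the
  indicator of their union is at most the sum of their indicators, and only the \<open>A i\<close>
  have to be added up exactly.\<close>

lemma UN_emeasure_le:
  assumes "countable I" "disjoint_family_on A I"
    and "\<And>i. i \<in> I \<Longrightarrow> A i \<in> sets N" "\<And>i. i \<in> I \<Longrightarrow> B i \<in> sets M"
    and "\<And>i. i \<in> I \<Longrightarrow> emeasure M (B i) \<le> c * emeasure N (A i)"
  shows "emeasure M (\<Union>i\<in>I. B i) \<le> c * emeasure N (\<Union>i\<in>I. A i)"
proof -
  have "(\<Union>i\<in>I. B i) \<in> sets M" using assms by (intro sets.countable_UN'') auto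
  then have "emeasure M (\<Union>i\<in>I. B i) = (\<integral>\<^sup>+x. indicator (\<Union>i\<in>I. B i) x \<partial>M)" by simp
  also have "\<dots> \<le> (\<integral>\<^sup>+x. (\<integral>\<^sup>+i. indicator (B i) x \<partial>count_space I) \<partial>M)"
  proof (intro nn_integral_mono)
    fix x
    show "indicator (\<Union>i\<in>I. B i) x \<le> (\<integral>\<^sup>+i. indicator (B i) x \<partial>count_space I)"
    proof (cases "x \<in> (\<Union>i\<in>I. B i)")
      case True
      then obtain i where i: "i \<in> I" "x \<in> B i" by blast
      have "(1::ennreal) = (\<integral>\<^sup>+j. indicator {i} j \<partial>count_space I)"
        using i by (simp add: nn_integral_indicator)
      also have "\<dots> \<le> (\<integral>\<^sup>+j. indicator (B j) x \<partial>count_space I)"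
        using i by (intro nn_integral_mono) (auto simp: indicator_def)
      finally show ?thesis using True by simp
    qed simp
  qed
  also have "\<dots> = (\<integral>\<^sup>+i. (\<integral>\<^sup>+x. indicator (B i) x \<partial>M) \<partial>count_space I)"
    using assms by (intro nn_integral_count_space_nn_integral) auto
  also have "\<dots> = (\<integral>\<^sup>+i. emeasure M (B i) \<partial>count_space I)"
    using assms by (intro nn_integral_cong) auto
  also have "\<dots> \<le> (\<integral>\<^sup>+i. c * emeasure N (A i) \<partial>count_space I)"
    using assms by (intro nn_integral_mono) auto
  also have "\<dots> = c * emeasure N (\<Union>i\<in>I. A i)"
    using assms by (simp add: emeasure_UN_countable nn_integral_cmult)
  finally show ?thesis .
qed

section \<open>Dilates as unions of neighbouring cubes\<close>

lemma dilate_neighbours: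
  assumes "0 < L" "x \<in> dilate v L a p"
  shows "\<exists>m. (\<forall>i. \<bar>m i - snd p i\<bar> \<le> int a) \<and> x \<in> dcube v L (fst p, m)"
proof -
  define s where "s = L / 2 ^ fst p"
  have s: "0 < s" using assms by (simp add: s_def)
  define m where "m i = \<lfloor>(x $ i - v $ i) / s\<rfloor>" for i
  have "\<bar>m i - snd p i\<bar> \<le> int a" for i
  proof -
    have "(of_int (snd p i) - real a) * s \<le> x $ i - v $ i" "x $ i - v $ i < (of_int (snd p i) + 1 + real a) * s"
      using assms(2) by (auto simp: mem_dilate s_def)
    then have "of_int (snd p i - int a) \<le> (x $ i - v $ i) / s" "(x $ i - v $ i) / s < of_int (snd p i + 1 + int a)"
      using s by (simp_all add: pos_le_divide_eq pos_divide_less_eq)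
    then have "snd p i - int a \<le> m i" "m i < snd p i + 1 + int a"
      unfolding m_def by (simp_all only: le_floor_iff floor_less_iff)
    then show ?thesis by auto
  qed
  then show ?thesis
    using assms(1) by (intro exI[of _ m]) (auto simp: mem_dcube_iff m_def s_def)
qed

text \<open>Being at most \<open>a\<close> grid steps apart is symmetric. The second inclusion
  carries information found on a neighbour back to the cube it belongs to.\<close>

lemma neighbour_subset_dilate:
  assumes "0 < L" "\<forall>i. \<bar>m i - snd p i\<bar> \<le> int a"
  shows "dcube v L (fst p, m) \<subseteq> dilate v L a p" "dcube v L p \<subseteq> dilate v L a (fst p, m)"
proof -
  define s where "s = L / 2 ^ fst p"
  have s: "0 < s" using assms by (simp add: s_def)
  have "real_of_int (snd p i) - real a \<le> of_int (m i)" "real_of_int (m i) + 1 \<le> of_int (snd p i) + 1 + real a"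
    "real_of_int (m i) - real a \<le> of_int (snd p i)" "real_of_int (snd p i) + 1 \<le> of_int (m i) + 1 + real a" for i
    using assms(2)[rule_format, of i] by linarith+
  then have "(of_int (snd p i) - real a) * s \<le> of_int (m i) * s" "(of_int (m i) + 1) * s \<le> (of_int (snd p i) + 1 + real a) * s"
     "(of_int (m i) - real a) * s \<le> of_int (snd p i) * s" "(of_int (snd p i) + 1) * s \<le> (of_int (m i) + 1 + real a) * s" for i
    using s by (blast intro: mult_right_mono less_imp_le)+
  then show "dcube v L (fst p, m) \<subseteq> dilate v L a p" "dcube v L p \<subseteq> dilate v L a (fst p, m)"
    unfolding subset_iff mem_dilate fst_conv snd_conv s_def[symmetric] of_nat_0 diff_0_right add_0_right
    by (meson order.trans less_le_trans)+
qed

lemma dilate_UN_neighbours: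
  assumes "0 < L"
  shows "dilate v L a p = (\<Union>m\<in>{m. \<forall>i. \<bar>m i - snd p i\<bar> \<le> int a}. dcube v L (fst p, m))"
proof (intro subset_antisym subsetI)
  fix x assume "x \<in> dilate v L a p"
  from dilate_neighbours[OF assms this] show "x \<in> (\<Union>m\<in>{m. \<forall>i. \<bar>m i - snd p i\<bar> \<le> int a}. dcube v L (fst p, m))"
    by (elim exE) (rule UN_I, auto)
next
  fix x assume "x \<in> (\<Union>m\<in>{m. \<forall>i. \<bar>m i - snd p i\<bar> \<le> int a}. dcube v L (fst p, m))"
  then obtain m where "\<forall>i. \<bar>m i - snd p i\<bar> \<le> int a" "x \<in> dcube v L (fst p, m)" by (elim UN_E) (simp only: mem_Collect_eq)
  with neighbour_subset_dilate(1)[OF assms this(1)] show "x \<in> dilate v L a p" by (rule_tac subsetD)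
qed

lemma finite_neighbours: "finite {m :: 'n::finite \<Rightarrow> int. \<forall>i. \<bar>m i - u i\<bar> \<le> c}"
proof -
  have "{m. \<forall>i. \<bar>m i - u i\<bar> \<le> c} \<subseteq> (UNIV \<rightarrow>\<^sub>E (\<Union>i. {u i - c .. u i + c}))"
  proof (rule subsetI, rule PiE_I)
    fix m i assume "m \<in> {m. \<forall>i. \<bar>m i - u i\<bar> \<le> c}"
    then have "\<bar>m i - u i\<bar> \<le> c" by simp
    then have "m i \<in> {u i - c .. u i + c}" by (simp add: abs_le_iff)
    then show "m i \<in> (\<Union>i. {u i - c .. u i + c})" by blast
  qed simp
  then show ?thesis by (rule finite_subset) (auto intro!: finite_PiE)
qed

text \<open>To be read in contrapositive: if the average over a dilate is large, it is large over
  one of the dyadic cubes that make up the dilate.\<close>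

lemma emeasure_dilate_le_neighbours:
  fixes v :: "real^'n"
  assumes L: "0 < L" and M: "sets M = sets lebesgue"
    and le: "\<And>m. (\<forall>i. \<bar>m i - snd p i\<bar> \<le> int a) \<Longrightarrow>
        emeasure M (dcube v L (fst p, m)) \<le> c * emeasure lebesgue (dcube v L (fst p, m))"
  shows "emeasure M (dilate v L a p) \<le> c * emeasure lebesgue (dilate v L a p)"
  apply (subst (1 2) dilate_UN_neighbours[OF L])
proof (rule disjoint_UN_emeasure_le)
  show "disjoint_family_on (\<lambda>m. dcube v L (fst p, m)) {m. \<forall>i. \<bar>m i - snd p i\<bar> \<le> int a}"
    unfolding disjoint_family_on_def using dcube_same_level[OF L, of _ v] by fastforce
qed (use M le in \<open>auto intro: countable_finite finite_neighbours\<close>)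

section \<open>Square integrable functions and operators\<close>

lemma L2_space_iff:
  "f \<in> L2_space M \<longleftrightarrow> f \<in> borel_measurable M \<and> (\<integral>\<^sup>+x. ennreal ((cmod (f x))\<^sup>2) \<partial>M) < \<infinity>"
  unfolding L2_space_def by (auto simp: integrable_iff_bounded)

lemma L2_space_measurable: "f \<in> L2_space M \<Longrightarrow> f \<in> borel_measurable M"
  by (simp add: L2_space_def)

lemma L2_nrm_nonneg [simp]: "0 \<le> L2_nrm M f"
  by (simp add: L2_nrm_def)

lemma nn_integral_L2_nrm:
  assumes "f \<in> L2_space M"
  shows "(\<integral>\<^sup>+x. ennreal ((cmod (f x))\<^sup>2) \<partial>M) = ennreal ((L2_nrm M f)\<^sup>2)"
  using assms by (simp add: L2_space_def L2_nrm_def nn_integral_eq_integral)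

lemma L2_nrm_le:
  assumes "0 \<le> c" "(\<integral>\<^sup>+x. ennreal ((cmod (f x))\<^sup>2) \<partial>M) \<le> ennreal (c\<^sup>2)"
    and "f \<in> borel_measurable M"
  shows "L2_nrm M f \<le> c" "f \<in> L2_space M"
proof -
  show L: "f \<in> L2_space M"
    using assms by (auto simp: L2_space_iff intro: le_less_trans[OF _ ennreal_less_top])
  show "L2_nrm M f \<le> c"
    using assms(2) unfolding nn_integral_L2_nrm[OF L] using assms(1)
    by (simp add: power2_le_iff_abs_le)
qed

lemma L2_nrm_cong_AE:
  assumes "f \<in> borel_measurable M" "g \<in> borel_measurable M" "AE x in M. f x = g x"
  shows "L2_nrm M f = L2_nrm M g"
  unfolding L2_nrm_def using assms by (intro arg_cong[where f = sqrt] integral_cong_AE) auto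

lemma cmod_add_squared_le: "(cmod (x + y))\<^sup>2 \<le> 2 * (cmod x)\<^sup>2 + 2 * (cmod y)\<^sup>2"
proof -
  have "(cmod (x + y))\<^sup>2 \<le> (cmod x + cmod y)\<^sup>2"
    by (intro power_mono norm_triangle_ineq) auto
  also have "\<dots> \<le> 2 * (cmod x)\<^sup>2 + 2 * (cmod y)\<^sup>2"
    using sum_squares_bound[of "cmod x" "cmod y"] by (simp add: power2_sum)
  finally show ?thesis .
qed

lemma nn_integral_add_squared_le:
  assumes [measurable]: "f \<in> borel_measurable M" "g \<in> borel_measurable M"
  shows "(\<integral>\<^sup>+x. ennreal ((cmod (f x + g x))\<^sup>2) \<partial>M) \<le>
    2 * (\<integral>\<^sup>+x. ennreal ((cmod (f x))\<^sup>2) \<partial>M) + 2 * (\<integral>\<^sup>+x. ennreal ((cmod (g x))\<^sup>2) \<partial>M)"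
proof -
  have "(\<integral>\<^sup>+x. ennreal ((cmod (f x + g x))\<^sup>2) \<partial>M) \<le>
      (\<integral>\<^sup>+x. 2 * ennreal ((cmod (f x))\<^sup>2) + 2 * ennreal ((cmod (g x))\<^sup>2) \<partial>M)"
  proof (intro nn_integral_mono)
    fix x
    have "ennreal ((cmod (f x + g x))\<^sup>2) \<le> ennreal (2 * (cmod (f x))\<^sup>2 + 2 * (cmod (g x))\<^sup>2)"
      by (intro ennreal_leI cmod_add_squared_le)
    then show "ennreal ((cmod (f x + g x))\<^sup>2) \<le> 2 * ennreal ((cmod (f x))\<^sup>2) + 2 * ennreal ((cmod (g x))\<^sup>2)"
      by (simp add: ennreal_mult')
  qed
  then show ?thesis by (simp add: nn_integral_add nn_integral_cmult)
qed

lemma L2_space_add: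
  assumes "f \<in> L2_space M" "g \<in> L2_space M"
  shows "(\<lambda>x. f x + g x) \<in> L2_space M"
proof -
  have "2 * (\<integral>\<^sup>+x. ennreal ((cmod (f x))\<^sup>2) \<partial>M) + 2 * (\<integral>\<^sup>+x. ennreal ((cmod (g x))\<^sup>2) \<partial>M) < \<infinity>"
    using assms by (auto simp: L2_space_iff ennreal_mult_less_top)
  with nn_integral_add_squared_le[of f M g] assms show ?thesis
    by (auto simp: L2_space_iff intro: le_less_trans)
qed

lemma L2_space_cmult:
  assumes "f \<in> L2_space M" shows "(\<lambda>x. a * f x) \<in> L2_space M"
  using assms by (auto simp: L2_space_def norm_mult power_mult_distrib)

lemma L2_nrm_cmult: "L2_nrm M (\<lambda>x. a * f x) = cmod a * L2_nrm M f"
  by (simp add: L2_nrm_def norm_mult power_mult_distrib real_sqrt_mult)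

lemma L2_space_zero [simp]: "(\<lambda>x. 0) \<in> L2_space M"
  by (simp add: L2_space_def)

lemma L2_space_diff:
  assumes "f \<in> L2_space M" "g \<in> L2_space M"
  shows "(\<lambda>x. f x - g x) \<in> L2_space M"
  using L2_space_add[OF assms(1) L2_space_cmult[OF assms(2), of "-1"]] by simp

lemma L2_space_sum:
  assumes "\<And>i. i \<in> I \<Longrightarrow> f i \<in> L2_space M"
  shows "(\<lambda>x. \<Sum>i\<in>I. f i x) \<in> L2_space M"
  using assms by (induction I rule: infinite_finite_induct) (auto intro: L2_space_add)

lemma L2_nrm_eq_0_iff:
  assumes "f \<in> L2_space M"
  shows "L2_nrm M f = 0 \<longleftrightarrow> (AE x in M. f x = 0)"
  using assms unfolding L2_nrm_def L2_space_def
  by (subst real_sqrt_eq_0_iff) (auto simp: integral_nonneg_eq_0_iff_AE)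

text \<open>\<open>L2_opnorm\<close> is a supremum of reals, so the unspecified bound
  \<open>B\<close> is first used to see that the values are bounded above. \<open>B\<close> also
  settles functions of norm 0, which cannot be rescaled to norm 1.\<close>

lemma L2_opnorm_bound:
  assumes T: "L2_bounded_operator M T" and f: "f \<in> L2_space M"
  shows "L2_nrm M (T f) \<le> L2_opnorm M T * L2_nrm M f"
proof -
  obtain B where B: "\<And>f. f \<in> L2_space M \<Longrightarrow> L2_nrm M (T f) \<le> B * L2_nrm M f"
    using T unfolding L2_bounded_operator_def by blast
  have Tm: "\<And>f. f \<in> L2_space M \<Longrightarrow> T f \<in> L2_space M"
    using T by (auto simp: L2_bounded_operator_def)
  show ?thesis
  proof (cases "L2_nrm M f = 0")
    case True
    then show ?thesis using B[OF f] by simp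
  next
    case False
    then have pos: "0 < L2_nrm M f" using L2_nrm_nonneg[of M f] by linarith
    define c where "c = complex_of_real (1 / L2_nrm M f)"
    define g where "g = (\<lambda>x. c * f x)"
    have g: "g \<in> L2_space M" unfolding g_def by (rule L2_space_cmult[OF f])
    have g1: "L2_nrm M g = 1" using pos unfolding g_def L2_nrm_cmult by (simp add: c_def norm_divide)
    have "AE x in M. T (\<lambda>y. c * f y + 0 * f y) x = c * T f x + 0 * T f x"
      using T f unfolding L2_bounded_operator_def by blast
    then have "AE x in M. T g x = c * T f x" by (simp add: g_def)
    then have "L2_nrm M (T g) = L2_nrm M (\<lambda>x. c * T f x)"
      using Tm[OF g] Tm[OF f] by (intro L2_nrm_cong_AE) (auto dest: L2_space_measurable)
    also have "\<dots> = L2_nrm M (T f) / L2_nrm M f"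
      using pos unfolding L2_nrm_cmult by (simp add: c_def norm_divide)
    finally have eq: "L2_nrm M (T g) = L2_nrm M (T f) / L2_nrm M f" .
    have "L2_nrm M (T g) \<le> L2_opnorm M T"
      unfolding L2_opnorm_def
    proof (rule cSUP_upper)
      show "bdd_above ((\<lambda>f. L2_nrm M (T f)) ` {f \<in> L2_space M. L2_nrm M f \<le> 1})"
      proof (rule bdd_aboveI2)
        fix f assume "f \<in> {f \<in> L2_space M. L2_nrm M f \<le> 1}"
        then have "L2_nrm M (T f) \<le> B * L2_nrm M f" "L2_nrm M f \<le> 1" using B by auto
        moreover have "B * L2_nrm M f \<le> \<bar>B\<bar> * 1" using \<open>L2_nrm M f \<le> 1\<close>
          by (intro mult_mono) auto
        ultimately show "L2_nrm M (T f) \<le> \<bar>B\<bar>" by simp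
      qed
    qed (use g g1 in auto)
    then show ?thesis using eq pos by (simp add: pos_divide_le_eq)
  qed
qed

lemma nn_integral_op_le:
  assumes T: "L2_bounded_operator M T" and f: "f \<in> L2_space M"
  shows "(\<integral>\<^sup>+x. ennreal ((cmod (T f x))\<^sup>2) \<partial>M) \<le>
    ennreal ((L2_opnorm M T)\<^sup>2) * (\<integral>\<^sup>+x. ennreal ((cmod (f x))\<^sup>2) \<partial>M)"
proof -
  have Tf: "T f \<in> L2_space M" using T f by (auto simp: L2_bounded_operator_def)
  have "(L2_nrm M (T f))\<^sup>2 \<le> (L2_opnorm M T * L2_nrm M f)\<^sup>2"
    using L2_opnorm_bound[OF T f] by (intro power_mono) auto
  then show ?thesis
    unfolding nn_integral_L2_nrm[OF Tf] nn_integral_L2_nrm[OF f]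
    by (simp add: power_mult_distrib ennreal_mult'[symmetric] ennreal_leI)
qed

context
  fixes M :: "'a measure" and T
  assumes T: "L2_bounded_operator M T"
begin

lemma op_L2: "f \<in> L2_space M \<Longrightarrow> T f \<in> L2_space M"
  using T by (auto simp: L2_bounded_operator_def)

lemma op_lincomb:
  assumes "f \<in> L2_space M" "g \<in> L2_space M"
  shows "AE x in M. T (\<lambda>y. a * f y + b * g y) x = a * T f x + b * T g x"
  using T assms unfolding L2_bounded_operator_def by blast

lemma op_add:
  assumes "f \<in> L2_space M" "g \<in> L2_space M"
  shows "AE x in M. T (\<lambda>y. f y + g y) x = T f x + T g x"
  using op_lincomb[OF assms, of 1 1] by simp

lemma op_diff:
  assumes "f \<in> L2_space M" "g \<in> L2_space M"
  shows "AE x in M. T (\<lambda>y. f y - g y) x = T f x - T g x"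
  using op_lincomb[OF assms, of 1 "-1"] by simp

lemma op_zero_AE:
  assumes f: "f \<in> L2_space M" and "AE x in M. f x = 0"
  shows "AE x in M. T f x = 0"
proof -
  have "L2_nrm M f = 0" using assms by (simp add: L2_nrm_eq_0_iff)
  with L2_opnorm_bound[OF T f] have "L2_nrm M (T f) = 0" using L2_nrm_nonneg[of M "T f"] by simp
  then show ?thesis using op_L2[OF f] by (simp add: L2_nrm_eq_0_iff)
qed

lemma op_sum:
  assumes "finite I" "\<And>i. i \<in> I \<Longrightarrow> f i \<in> L2_space M"
  shows "AE x in M. T (\<lambda>y. \<Sum>i\<in>I. f i y) x = (\<Sum>i\<in>I. T (f i) x)"
  using assms
proof (induction I rule: finite_induct)
  case empty
  then show ?case using op_zero_AE[of "\<lambda>x. 0"] by simp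
next
  case (insert i I)
  have "AE x in M. T (\<lambda>y. f i y + (\<Sum>i\<in>I. f i y)) x = T (f i) x + T (\<lambda>y. \<Sum>i\<in>I. f i y) x"
    using insert by (intro op_add L2_space_sum) auto
  moreover have "AE x in M. T (\<lambda>y. \<Sum>i\<in>I. f i y) x = (\<Sum>i\<in>I. T (f i) x)"
    using insert by auto
  ultimately show ?case
    by eventually_elim (use insert.hyps in simp)
qed

end

text \<open>These functions lie in \<open>L2_space lebesgue\<close>, satisfy the hypotheses of
  \<open>has_kernel\<close>, and stay in the class under restriction to measurable sets and under
  finite linear combinations.\<close>

definition test_function :: "('a::euclidean_space \<Rightarrow> complex) \<Rightarrow> bool" where
  "test_function f \<longleftrightarrow> f \<in> borel_measurable lebesgue \<and> bounded (range f) \<and> bounded {x. f x \<noteq> 0}"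

definition restrict_to :: "'a set \<Rightarrow> ('a \<Rightarrow> complex) \<Rightarrow> 'a \<Rightarrow> complex" where
  "restrict_to A f = (\<lambda>x. if x \<in> A then f x else 0)"

lemma test_function_measurable: "test_function f \<Longrightarrow> f \<in> borel_measurable lebesgue"
  by (simp add: test_function_def)

lemma niceI:
  assumes "f \<in> borel_measurable lebesgue" "\<And>x. cmod (f x) \<le> B" "\<And>x. f x \<noteq> 0 \<Longrightarrow> norm x \<le> R"
  shows "test_function f"
  using assms unfolding test_function_def bounded_iff by auto

lemma test_function_bound:
  assumes "test_function f" obtains B where "0 < B" "\<And>x. cmod (f x) \<le> B"
proof -
  obtain B where "\<And>x. cmod (f x) \<le> B" using assms by (auto simp: test_function_def bounded_iff)
  then show ?thesis using that[of "max B 1"] by (metis less_max_iff_disj max.coboundedI1 zero_less_one)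
qed

lemma test_function_radius:
  assumes "test_function f" obtains R where "0 < R" "\<And>x. f x \<noteq> 0 \<Longrightarrow> norm x \<le> R"
proof -
  obtain B where "\<And>x. f x \<noteq> 0 \<Longrightarrow> norm x \<le> B" using assms by (auto simp: test_function_def bounded_iff)
  then show ?thesis using that[of "max B 1"] by (metis less_max_iff_disj max.coboundedI1 zero_less_one)
qed

lemma test_function_restrict_to:
  assumes "test_function f" "A \<in> sets lebesgue" shows "test_function (restrict_to A f)"
proof -
  obtain B where B: "0 < B" "\<And>x. cmod (f x) \<le> B" using test_function_bound[OF assms(1)] by metis
  obtain R where R: "0 < R" "\<And>x. f x \<noteq> 0 \<Longrightarrow> norm x \<le> R" using test_function_radius[OF assms(1)] by metis
  have [measurable]: "f \<in> borel_measurable lebesgue" "A \<in> sets lebesgue" using assms test_function_measurable by auto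
  show ?thesis
  proof (rule niceI[of _ B R])
    show "restrict_to A f \<in> borel_measurable lebesgue" unfolding restrict_to_def by measurable
  qed (use B R in \<open>auto simp: restrict_to_def less_imp_le split: if_splits\<close>)
qed

lemma test_function_add:
  assumes "test_function f" "test_function g" shows "test_function (\<lambda>x. f x + g x)"
proof -
  obtain B where B: "0 < B" "\<And>x. cmod (f x) \<le> B" using test_function_bound[OF assms(1)] by metis
  obtain R where R: "0 < R" "\<And>x. f x \<noteq> 0 \<Longrightarrow> norm x \<le> R" using test_function_radius[OF assms(1)] by metis
  obtain B' where B': "0 < B'" "\<And>x. cmod (g x) \<le> B'" using test_function_bound[OF assms(2)] by metis
  obtain R' where R': "0 < R'" "\<And>x. g x \<noteq> 0 \<Longrightarrow> norm x \<le> R'" using test_function_radius[OF assms(2)] by metis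
  have [measurable]: "f \<in> borel_measurable lebesgue" "g \<in> borel_measurable lebesgue" using assms test_function_measurable by auto
  show ?thesis
  proof (rule niceI[of _ "B + B'" "max R R'"])
    show "cmod (f x + g x) \<le> B + B'" for x
      using norm_triangle_ineq[of "f x" "g x"] B(2)[of x] B'(2)[of x] by linarith
    show "norm x \<le> max R R'" if "f x + g x \<noteq> 0" for x
      using that R(2)[of x] R'(2)[of x] by (cases "f x = 0") auto
  qed measurable
qed

lemma test_function_cmult:
  assumes "test_function f" shows "test_function (\<lambda>x. c * f x)"
proof -
  obtain B where B: "0 < B" "\<And>x. cmod (f x) \<le> B" using test_function_bound[OF assms(1)] by metis
  obtain R where R: "0 < R" "\<And>x. f x \<noteq> 0 \<Longrightarrow> norm x \<le> R" using test_function_radius[OF assms(1)] by metis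
  have [measurable]: "f \<in> borel_measurable lebesgue" using assms test_function_measurable by auto
  show ?thesis
  proof (rule niceI[of _ "cmod c * B" R])
    show "cmod (c * f x) \<le> cmod c * B" for x
      using B(2)[of x] by (simp add: norm_mult mult_left_mono)
    show "norm x \<le> R" if "c * f x \<noteq> 0" for x using that R(2)[of x] by simp
  qed measurable
qed

lemma test_function_diff:
  assumes "test_function f" "test_function g" shows "test_function (\<lambda>x. f x - g x)"
  using test_function_add[OF assms(1) test_function_cmult[OF assms(2), of "-1"]] by simp

lemma test_function_sum:
  assumes "\<And>i. i \<in> I \<Longrightarrow> test_function (f i)"
  shows "test_function (\<lambda>x. \<Sum>i\<in>I. f i x)"
proof -
  have "test_function (\<lambda>x. 0 :: complex)" by (rule niceI[of _ 0 0]) auto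
  then show ?thesis using assms
    by (induction I rule: infinite_finite_induct) (auto intro: test_function_add)
qed

lemma test_function_indicator:
  assumes "A \<in> sets lebesgue" "bounded A" shows "test_function (restrict_to A (\<lambda>_. c))"
proof -
  obtain R where R: "\<And>x. x \<in> A \<Longrightarrow> norm x \<le> R" using assms by (auto simp: bounded_iff)
  have [measurable]: "A \<in> sets lebesgue" by fact
  show ?thesis
  proof (rule niceI[of _ "cmod c" R])
    show "restrict_to A (\<lambda>_. c) \<in> borel_measurable lebesgue" unfolding restrict_to_def by measurable
  qed (use R in \<open>auto simp: restrict_to_def split: if_splits\<close>)
qed

lemma emeasure_bounded_finite:
  fixes A :: "'a::euclidean_space set"
  assumes "bounded A" shows "emeasure lebesgue A < \<infinity>"
proof (cases "A \<in> sets lebesgue")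
  case True
  then show ?thesis using bounded_set_imp_lmeasurable[OF assms True] by (simp add: fmeasurable_def)
qed (simp add: emeasure_notin_sets)

lemma test_function_integral_finite:
  assumes f: "test_function f" shows "(\<integral>\<^sup>+x. ennreal (cmod (f x)) \<partial>lebesgue) < \<infinity>"
    "(\<integral>\<^sup>+x. ennreal ((cmod (f x))\<^sup>2) \<partial>lebesgue) < \<infinity>"
proof -
  obtain B where B: "0 < B" "\<And>x. cmod (f x) \<le> B" using test_function_bound[OF f] by metis
  obtain R where R: "0 < R" "\<And>x. f x \<noteq> 0 \<Longrightarrow> norm x \<le> R" using test_function_radius[OF f] by metis
  have fin: "(\<integral>\<^sup>+x. ennreal c * indicator (cball 0 R :: 'a set) x \<partial>lebesgue) < \<infinity>" for c
    using emeasure_bounded_finite[of "cball 0 R :: 'a set"]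
    by (subst nn_integral_cmult_indicator) (auto simp: ennreal_mult_less_top)
  have "(\<integral>\<^sup>+x. ennreal (cmod (f x)) \<partial>lebesgue) \<le> (\<integral>\<^sup>+x. ennreal B * indicator (cball 0 R :: 'a set) x \<partial>lebesgue)"
    using B R by (intro nn_integral_mono) (auto simp: indicator_def intro!: ennreal_leI)
  then show "(\<integral>\<^sup>+x. ennreal (cmod (f x)) \<partial>lebesgue) < \<infinity>" using fin le_less_trans by blast
  have "(\<integral>\<^sup>+x. ennreal ((cmod (f x))\<^sup>2) \<partial>lebesgue) \<le> (\<integral>\<^sup>+x. ennreal (B\<^sup>2) * indicator (cball 0 R :: 'a set) x \<partial>lebesgue)"
    using B R by (intro nn_integral_mono) (auto simp: indicator_def intro!: ennreal_leI power_mono)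
  then show "(\<integral>\<^sup>+x. ennreal ((cmod (f x))\<^sup>2) \<partial>lebesgue) < \<infinity>" using fin le_less_trans by blast
qed

lemma test_function_L2: "test_function f \<Longrightarrow> f \<in> L2_space lebesgue"
  using test_function_integral_finite(2)[of f] by (simp add: L2_space_iff test_function_measurable)

lemma test_function_integrable: "test_function f \<Longrightarrow> integrable lebesgue f"
  using test_function_integral_finite(1)[of f] by (simp add: integrable_iff_bounded test_function_measurable)

lemma test_function_compact_support: "test_function f \<Longrightarrow> compact (closed_support f)"
  by (simp add: test_function_def closed_support_def compact_closure)

section \<open>Kernel estimates\<close>

lemma dil1_near:
  assumes "0 < L" "y \<in> dcube v L p" "\<And>i. \<bar>x $ i - y $ i\<bar> < L / 2 ^ fst p"
  shows "x \<in> dilate v L 1 p"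
proof -
  define s where "s = L / 2 ^ fst p"
  show ?thesis
    unfolding mem_dilate s_def[symmetric]
  proof
    fix i
    have "of_int (snd p i) * s \<le> y $ i - v $ i" "y $ i - v $ i < (of_int (snd p i) + 1) * s"
      using assms(2) unfolding mem_dilate s_def[symmetric] by auto
    moreover have "\<bar>x $ i - y $ i\<bar> < s" using assms(3) by (simp add: s_def)
    ultimately show "(of_int (snd p i) - real 1) * s \<le> x $ i - v $ i \<and>
         x $ i - v $ i < (of_int (snd p i) + 1 + real 1) * s"
      unfolding distrib_right left_diff_distrib by (simp add: abs_less_iff)
  qed
qed

text \<open>Membership in cubes controls coordinates, so the vanishing is required on a
  neighbourhood described by coordinates, which contains the ball of radius
  \<open>s\<close>.\<close>

lemma notin_closed_support:
  fixes x :: "real^'n"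
  assumes "0 < s" "\<And>y. (\<And>i. \<bar>y $ i - x $ i\<bar> < s) \<Longrightarrow> f y = 0"
  shows "x \<notin> closed_support f"
proof -
  have "{y. f y \<noteq> 0} \<inter> ball x s = {}"
  proof safe
    fix y assume "y \<in> ball x s" "f y \<noteq> 0"
    moreover have "\<bar>y $ i - x $ i\<bar> < s" if "y \<in> ball x s" for i
      using that component_le_norm_cart[of "y - x" i] by (simp add: dist_norm norm_minus_commute)
    ultimately show "y \<in> {}" using assms(2) by blast
  qed
  then have "closure {y. f y \<noteq> 0} \<inter> ball x s = {}"
    using open_Int_closure_eq_empty[of "ball x s" "{y. f y \<noteq> 0}"] by (simp add: Int_commute)
  then show ?thesis using assms(1) by (auto simp: closed_support_def)
qed

text \<open>A margin of one side length separates the point from the closure of the support, as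
  \<open>has_kernel\<close> demands. \<open>closed_support_dcube\<close> is the mirror image, with
  the support in the cube and the point outside the dilate.\<close>

lemma dcube_notin_closed_support:
  assumes "0 < L" "x \<in> dcube v L q" "\<And>y. y \<in> dilate v L 1 q \<Longrightarrow> h y = 0"
  shows "x \<notin> closed_support h"
  by (rule notin_closed_support[of "L / 2 ^ fst q"])
     (use assms dil1_near[OF assms(1,2)] in auto)

lemma closed_support_dcube:
  assumes "0 < L" "x \<notin> dilate v L 1 p" "\<And>y. y \<notin> dcube v L p \<Longrightarrow> b y = 0"
  shows "x \<notin> closed_support b"
proof (rule notin_closed_support[of "L / 2 ^ fst p"])
  fix y assume y: "\<And>i. \<bar>y $ i - x $ i\<bar> < L / 2 ^ fst p"
  then have "\<And>i. \<bar>x $ i - y $ i\<bar> < L / 2 ^ fst p" by (simp add: abs_minus_commute)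
  then have "y \<notin> dcube v L p" using dil1_near[OF assms(1), of y v p x] assms(2) by blast
  then show "b y = 0" using assms(3) by simp
qed (use assms in simp)

lemma norm_less_dcube:
  fixes x :: "real^'n"
  assumes "\<And>i. \<bar>x $ i - y $ i\<bar> < s"
  shows "norm (x - y) < real CARD('n) * s"
proof -
  have "norm (x - y) \<le> (\<Sum>i\<in>UNIV. \<bar>(x - y) $ i\<bar>)" by (rule norm_le_l1_cart)
  also have "\<dots> < (\<Sum>i\<in>(UNIV :: 'n set). s)"
    using assms by (intro sum_strict_mono) auto
  finally show ?thesis by simp
qed

lemma dcube_coord_less:
  assumes "x \<in> dcube v L p" "y \<in> dcube v L p"
  shows "\<bar>x $ i - y $ i\<bar> < L / 2 ^ fst p"
proof -
  define s where "s = L / 2 ^ fst p"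
  have "of_int (snd p i) * s \<le> y $ i - v $ i" "y $ i - v $ i < (of_int (snd p i) + 1) * s"
    "of_int (snd p i) * s \<le> x $ i - v $ i" "x $ i - v $ i < (of_int (snd p i) + 1) * s"
    using assms unfolding mem_dilate s_def[symmetric] by auto
  then show ?thesis unfolding s_def[symmetric] distrib_right by (simp add: abs_less_iff)
qed

lemma norm_ge_notin_dilate:
  fixes x :: "real^'n"
  assumes "0 < L" "x \<notin> dilate v L a p" "y \<in> dcube v L p"
  shows "\<exists>i. real a * (L / 2 ^ fst p) \<le> \<bar>x $ i - y $ i\<bar>"
proof (rule ccontr)
  define s where "s = L / 2 ^ fst p"
  assume "\<not> ?thesis"
  then have *: "\<bar>x $ i - y $ i\<bar> < real a * s" for i by (auto simp: s_def not_le)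
  have "x \<in> dilate v L a p"
    unfolding mem_dilate s_def[symmetric]
  proof
    fix i
    have "of_int (snd p i) * s \<le> y $ i - v $ i" "y $ i - v $ i < (of_int (snd p i) + 1) * s"
      using assms(3) unfolding mem_dilate s_def[symmetric] by auto
    with *[of i] show "(of_int (snd p i) - real a) * s \<le> x $ i - v $ i \<and>
         x $ i - v $ i < (of_int (snd p i) + 1 + real a) * s"
      unfolding distrib_right left_diff_distrib by (simp add: abs_less_iff)
  qed
  with assms show False by simp
qed

lemma integrable_dominated_test_function:
  assumes "g \<in> borel_measurable lebesgue" "test_function f" "\<And>y. f y \<noteq> 0 \<Longrightarrow> cmod (g y) \<le> D"
  shows "integrable lebesgue (\<lambda>y. g y * f y)"
proof (rule Bochner_Integration.integrable_bound)
  show "integrable lebesgue (\<lambda>y. D * cmod (f y))"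
    using test_function_integrable[OF assms(2)] by simp
  show "(\<lambda>y. g y * f y) \<in> borel_measurable lebesgue"
    using assms(1) test_function_measurable[OF assms(2)] by measurable
  show "AE y in lebesgue. norm (g y * f y) \<le> norm (D * cmod (f y))"
  proof (intro always_eventually allI)
    fix y
    have "cmod (g y) * cmod (f y) \<le> D * cmod (f y)"
      using assms(3)[of y] by (cases "f y = 0") (auto intro: mult_right_mono)
    then show "norm (g y * f y) \<le> norm (D * cmod (f y))"
      by (simp add: norm_mult)
  qed
qed

lemma sets_borel_lebesgue: "A \<in> sets borel \<Longrightarrow> A \<in> sets lebesgue"
  by (rule sets_completionI_sets) simp

lemma geometric_ennreal:
  assumes "0 \<le> c" "0 \<le> q" "q < 1"
  shows "(\<Sum>j. ennreal (c * q ^ j)) = ennreal (c / (1 - q))"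
proof -
  have "(\<lambda>j. c * q ^ j) sums (c * (1 / (1 - q)))"
    using assms by (intro sums_mult geometric_sums) auto
  then show ?thesis using assms by (intro suminf_ennreal_eq) auto
qed

lemma ennreal_le_suminf: "f j \<le> (\<Sum>j. f j :: ennreal)"
  using sum_le_suminf[OF summableI, of "{j}" f] by simp

text \<open>Sum over shells in the maximum norm. On the shell between \<open>R j\<close> and
  \<open>R (Suc j) = 2 * R j\<close> the integrand is at most
  \<open>R j powr - (d + \<alpha>)\<close>, and the shell lies in a box of volume
  \<open>(4 * R j) ^ d\<close>. The powers of dimension \<open>d\<close> cancel and leave a
  geometric series in \<open>2 powr - \<alpha>\<close>.\<close>

lemma tail_integral:
  fixes c :: "real^'n"
  assumes r: "0 < r" and \<alpha>: "0 < \<alpha>"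
  shows "(\<integral>\<^sup>+x. ennreal (norm (x - c) powr - (real CARD('n) + \<alpha>)) * indicator {x. \<exists>i. r \<le> \<bar>x $ i - c $ i\<bar>} x \<partial>lebesgue)
    \<le> ennreal (4 ^ CARD('n) * r powr - \<alpha> / (1 - 2 powr - \<alpha>))"
proof -
  define e where "e = real CARD('n) + \<alpha>"
  define R where "R j = 2 ^ j * r" for j :: nat
  have R: "0 < R j" for j using r by (simp add: R_def)
  define H where "H j = half_open_box (\<chi> i. c $ i - R (Suc j)) (\<chi> i. c $ i + R (Suc j))" for j
  have "(\<integral>\<^sup>+x. ennreal (norm (x - c) powr - e) * indicator {x. \<exists>i. r \<le> \<bar>x $ i - c $ i\<bar>} x \<partial>lebesgue)
     \<le> (\<integral>\<^sup>+x. (\<Sum>j. ennreal (R j powr - e) * indicator (H j) x) \<partial>lebesgue)"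
  proof (rule nn_integral_mono)
    fix x :: "real^'n"
    show "ennreal (norm (x - c) powr - e) * indicator {x. \<exists>i. r \<le> \<bar>x $ i - c $ i\<bar>} x
      \<le> (\<Sum>j. ennreal (R j powr - e) * indicator (H j) x)"
    proof (cases "\<exists>i. r \<le> \<bar>x $ i - c $ i\<bar>")
      case True
      define \<mu> where "\<mu> = Max (range (\<lambda>i. \<bar>x $ i - c $ i\<bar>))"
      have \<mu>: "\<bar>x $ i - c $ i\<bar> \<le> \<mu>" for i unfolding \<mu>_def by (intro Max_ge) auto
      have "\<mu> \<in> range (\<lambda>i. \<bar>x $ i - c $ i\<bar>)" unfolding \<mu>_def by (intro Max_in) auto
      then obtain i0 where i0: "\<mu> = \<bar>x $ i0 - c $ i0\<bar>" by blast
      have r\<mu>: "r \<le> \<mu>" using True \<mu> order.trans by blast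
      have "\<exists>n. \<mu> / r < 2 ^ n" by (simp add: real_arch_pow)
      then obtain n where "\<mu> / r < 2 ^ n" by blast
      then have "\<mu> < 2 ^ n * r" using r by (simp add: pos_divide_less_eq)
      also have "\<dots> \<le> R (Suc n)" using r by (simp add: R_def)
      finally have ex: "\<exists>n. \<mu> < R (Suc n)" by blast
      \<comment> \<open>The number of the shell that contains \<open>x\<close>, since
        \<open>\<mu>\<close> is the distance from \<open>c\<close> in the maximum norm.\<close>
      define j where "j = (LEAST n. \<mu> < R (Suc n))"
      have j1: "\<mu> < R (Suc j)" unfolding j_def using ex by (rule LeastI_ex)
      have j2: "R j \<le> \<mu>"
      proof (cases j)
        case 0
        then show ?thesis using r\<mu> by (simp add: R_def)
      next
        case (Suc k)
        then have "\<not> \<mu> < R (Suc k)" using not_less_Least[of k "\<lambda>n. \<mu> < R (Suc n)"] by (simp add: j_def)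
        then show ?thesis using Suc by simp
      qed
      have "x \<in> H j"
        unfolding H_def half_open_box_def using \<mu> j1
        by (auto simp: abs_le_iff) (smt (verit, best))+
      moreover have "\<mu> \<le> norm (x - c)"
        using component_le_norm_cart[of "x - c" i0] i0 by simp
      then have "norm (x - c) powr - e \<le> R j powr - e"
        using j2 R[of j] \<alpha> by (intro powr_mono2') (auto simp: e_def)
      then have "ennreal (norm (x - c) powr - e) \<le> ennreal (R j powr - e)" by (rule ennreal_leI)
      ultimately have "ennreal (norm (x - c) powr - e) * indicator {x. \<exists>i. r \<le> \<bar>x $ i - c $ i\<bar>} x
        \<le> ennreal (R j powr - e) * indicator (H j) x"
        using True by simp
      also have "\<dots> \<le> (\<Sum>j. ennreal (R j powr - e) * indicator (H j) x)"
        by (rule ennreal_le_suminf)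
      finally show ?thesis .
    qed simp
  qed
  also have "\<dots> = (\<Sum>j. (\<integral>\<^sup>+x. ennreal (R j powr - e) * indicator (H j) x \<partial>lebesgue))"
    unfolding H_def by (intro nn_integral_suminf) measurable
  also have "\<dots> = (\<Sum>j. ennreal (4 ^ CARD('n) * r powr - \<alpha> * (2 powr - \<alpha>) ^ j))"
  proof (intro suminf_cong)
    fix j
    have "(\<integral>\<^sup>+x. ennreal (R j powr - e) * indicator (H j) x \<partial>lebesgue) = ennreal (R j powr - e) * emeasure lebesgue (H j)"
      unfolding H_def by (intro nn_integral_cmult_indicator) measurable
    also have "emeasure lebesgue (H j) = ennreal ((4 * R j) ^ CARD('n))"
      unfolding H_def using r by (subst emeasure_half_open_box) (auto simp: R_def ac_simps)
    also have "ennreal (R j powr - e) * \<dots> = ennreal (R j powr - e * (4 * R j) ^ CARD('n))"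
      using R[of j] by (simp add: ennreal_mult)
    also have "R j powr - e * (4 * R j) ^ CARD('n) = 4 ^ CARD('n) * R j powr - \<alpha>"
    proof -
      have "R j powr - e = R j powr - real CARD('n) * R j powr - \<alpha>"
        by (simp add: e_def powr_add[symmetric])
      moreover have "R j powr - real CARD('n) * R j ^ CARD('n) = 1"
        using R[of j] by (simp add: powr_minus powr_realpow)
      ultimately show ?thesis by (simp add: power_mult_distrib mult.assoc mult.left_commute)
    qed
    also have "R j powr - \<alpha> = r powr - \<alpha> * (2 powr - \<alpha>) ^ j"
    proof -
      have "(2 ^ j) powr - \<alpha> = (2 powr - \<alpha>) ^ j"
        by (simp add: powr_realpow[symmetric] powr_powr mult.commute)
      then show ?thesis using r by (simp add: R_def powr_mult)
    qed
    finally show "(\<integral>\<^sup>+x. ennreal (R j powr - e) * indicator (H j) x \<partial>lebesgue) =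
      ennreal (4 ^ CARD('n) * r powr - \<alpha> * (2 powr - \<alpha>) ^ j)" by (simp add: mult.assoc)
  qed
  also have "\<dots> = ennreal (4 ^ CARD('n) * r powr - \<alpha> / (1 - 2 powr - \<alpha>))"
    using \<alpha> by (intro geometric_ennreal) (auto simp: powr_less_one)
  finally show ?thesis by (simp add: e_def)
qed

section \<open>Consequences of the kernel conditions\<close>

context
  fixes Ccz \<alpha> :: real and K :: "real^'n \<Rightarrow> real^'n \<Rightarrow> complex"
  assumes \<alpha>: "0 < \<alpha>" and K: "CZ_kernel Ccz \<alpha> K"
begin

lemma kernel_size: "x \<noteq> y \<Longrightarrow> cmod (K x y) \<le> Ccz / norm (x - y) ^ CARD('n)"
  using K by (simp add: CZ_kernel_def)

lemma Ccz_nonneg: "0 \<le> Ccz"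
proof -
  have "(0::real^'n) \<noteq> axis undefined 1" by (metis axis_eq_0_iff zero_neq_one)
  from order.trans[OF norm_ge_zero kernel_size[OF this]]
  have "0 \<le> Ccz / norm ((0::real^'n) - axis undefined 1) ^ CARD('n)" .
  then show ?thesis by simp
qed

lemma kernel_smooth:
  assumes "norm (x - x') < norm (x - y) / 2"
  shows "cmod (K x y - K x' y) \<le> Ccz * (norm (x - x') powr \<alpha> / norm (x - y) powr (real CARD('n) + \<alpha>))"
    and "cmod (K y x - K y x') \<le> Ccz * (norm (x - x') powr \<alpha> / norm (x - y) powr (real CARD('n) + \<alpha>))"
proof -
  have "cmod (K x y - K x' y) + cmod (K y x - K y x')
          \<le> Ccz * (norm (x - x') powr \<alpha> / norm (x - y) powr (real CARD('n) + \<alpha>))"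
    using K assms by (simp add: CZ_kernel_def)
  then show "cmod (K x y - K x' y) \<le> Ccz * (norm (x - x') powr \<alpha> / norm (x - y) powr (real CARD('n) + \<alpha>))"
    and "cmod (K y x - K y x') \<le> Ccz * (norm (x - x') powr \<alpha> / norm (x - y) powr (real CARD('n) + \<alpha>))"
    using norm_ge_zero[of "K x y - K x' y"] norm_ge_zero[of "K y x - K y x'"] by linarith+
qed

lemma kernel_continuous: "continuous_on (- {x}) (K x)"
  unfolding continuous_on_eq_continuous_within[of "- {x}"]
proof
  fix y assume y: "y \<in> - {x}"
  then have pos: "0 < norm (y - x)" by simp
  have "((\<lambda>z. K x z - K x y) \<longlongrightarrow> 0) (at y)"
  proof (rule Lim_null_comparison)
    have "\<forall>\<^sub>F z in at y. dist z y < norm (y - x) / 2"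
      using pos by (auto simp: eventually_at intro!: exI[of _ "norm (y - x) / 2"])
    then show "\<forall>\<^sub>F z in at y. norm (K x z - K x y) \<le>
        Ccz * (norm (z - y) powr \<alpha> / norm (y - x) powr (real CARD('n) + \<alpha>))"
    proof eventually_elim
      case (elim z)
      then have "norm (y - z) < norm (y - x) / 2" by (simp add: dist_norm norm_minus_commute)
      from kernel_smooth(2)[OF this] show ?case by (simp add: norm_minus_commute)
    qed
    have "((\<lambda>z. norm (z - y) powr \<alpha>) \<longlongrightarrow> 0 powr \<alpha>) (at y)"
      using \<alpha> by (intro tendsto_powr2 tendsto_norm_zero) (auto intro!: tendsto_eq_intros)
    then show "((\<lambda>z. Ccz * (norm (z - y) powr \<alpha> / norm (y - x) powr (real CARD('n) + \<alpha>))) \<longlongrightarrow> 0) (at y)"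
      using tendsto_mult_left[of _ "0 powr \<alpha>" "at y" "Ccz / norm (y - x) powr (real CARD('n) + \<alpha>)"] by simp
  qed
  then have "(K x \<longlongrightarrow> K x y) (at y)" by (simp add: LIM_zero_iff)
  then show "continuous (at y within - {x}) (K x)"
    unfolding continuous_within by (rule Lim_at_imp_Lim_at_within)
qed

text \<open>The kernel conditions give continuity off the diagonal and leave the value
  \<open>K x x\<close> open, so that single point is treated apart.\<close>

lemma kernel_measurable: "K x \<in> borel_measurable lebesgue"
proof -
  have "(\<lambda>y. indicator (- {x}) y *\<^sub>R K x y) \<in> borel_measurable borel"
    by (intro borel_measurable_continuous_on_indicator kernel_continuous) auto
  then have [measurable]: "(\<lambda>y. indicator (- {x}) y *\<^sub>R K x y) \<in> borel_measurable lebesgue"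
    by (intro measurable_completion) simp
  have "(\<lambda>y. indicator (- {x}) y *\<^sub>R K x y + indicator {x} y *\<^sub>R K x x) \<in> borel_measurable lebesgue"
  proof (rule borel_measurable_add)
    show "(\<lambda>y. indicator (- {x}) y *\<^sub>R K x y) \<in> borel_measurable lebesgue" by fact
    show "(\<lambda>y. indicator {x} y *\<^sub>R K x x) \<in> borel_measurable lebesgue"
      by (intro borel_measurable_scaleR borel_measurable_indicator) auto
  qed
  also have "(\<lambda>y. indicator (- {x}) y *\<^sub>R K x y + indicator {x} y *\<^sub>R K x x) = K x"
    by (auto simp: indicator_def)
  finally show ?thesis .
qed

lemma kernel_integrable:
  assumes "test_function f" "x \<notin> closed_support f"
  shows "integrable lebesgue (\<lambda>y. K x y * f y)"
proof -
  have "open (- closed_support f)" unfolding closed_support_def by (intro open_Compl closed_closure)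
  then obtain e where e: "0 < e" "ball x e \<subseteq> - closed_support f"
    using assms(2) openE by blast
  have ge: "e \<le> norm (x - y)" if "f y \<noteq> 0" for y
  proof (rule ccontr)
    assume "\<not> ?thesis"
    then have "y \<in> ball x e" by (simp add: dist_norm)
    moreover have "y \<in> closed_support f" using that closure_subset by (force simp: closed_support_def)
    ultimately show False using e by blast
  qed
  show ?thesis
  proof (rule integrable_dominated_test_function[OF kernel_measurable assms(1)])
    fix y assume y: "f y \<noteq> 0"
    then have "x \<noteq> y" using ge[OF y] e(1) by auto
    have "cmod (K x y) \<le> Ccz / norm (x - y) ^ CARD('n)" by (rule kernel_size) fact
    also have "\<dots> \<le> Ccz / e ^ CARD('n)"
      using ge[OF y] e(1) Ccz_nonneg \<open>x \<noteq> y\<close>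
      by (intro divide_left_mono power_mono mult_pos_pos zero_less_power) auto
    finally show "cmod (K x y) \<le> Ccz / e ^ CARD('n)" .
  qed
qed

text \<open>Here \<open>x\<close> and \<open>x'\<close> are points of one cube of side
  \<open>s\<close>, and \<open>d * s\<close> bounds its diameter. The condition on \<open>t\<close>
  puts \<open>y\<close> at more than twice the distance between them. The first bound freezes the
  distance at \<open>t\<close>, for sums over shells; the second keeps it, for an integration over
  \<open>y\<close>.\<close>

lemma kernel_diff_le:
  assumes s: "0 < s" and t: "2 * real CARD('n) * s \<le> t" and "norm (x - x') < real CARD('n) * s" and "t \<le> norm (x - y)"
  shows "cmod (K x y - K x' y) \<le> Ccz * (real CARD('n) * s) powr \<alpha> * t powr - (real CARD('n) + \<alpha>)"
    and "cmod (K y x - K y x') \<le> Ccz * (real CARD('n) * s) powr \<alpha> * norm (x - y) powr - (real CARD('n) + \<alpha>)"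
proof -
  have tpos: "0 < t" using s t by (smt (verit) mult_pos_pos of_nat_0_less_iff zero_less_card_finite)
  have "norm (x - x') < norm (x - y) / 2" using assms by linarith
  note S = kernel_smooth[OF this]
  have 1: "norm (x - x') powr \<alpha> \<le> (real CARD('n) * s) powr \<alpha>"
    using assms \<alpha> by (intro powr_mono2) auto
  have 2: "norm (x - y) powr - (real CARD('n) + \<alpha>) \<le> t powr - (real CARD('n) + \<alpha>)"
    using assms \<alpha> tpos by (intro powr_mono2') auto
  have 3: "norm (x - x') powr \<alpha> / norm (x - y) powr (real CARD('n) + \<alpha>) =
     norm (x - x') powr \<alpha> * norm (x - y) powr - (real CARD('n) + \<alpha>)"
    by (simp only: powr_minus divide_inverse)
  show "cmod (K x y - K x' y) \<le> Ccz * (real CARD('n) * s) powr \<alpha> * t powr - (real CARD('n) + \<alpha>)"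
    unfolding mult.assoc
    by (rule order.trans[OF S(1)], unfold 3, intro mult_left_mono mult_mono 1 2 Ccz_nonneg) auto
  show "cmod (K y x - K y x') \<le> Ccz * (real CARD('n) * s) powr \<alpha> * norm (x - y) powr - (real CARD('n) + \<alpha>)"
    unfolding mult.assoc
    by (rule order.trans[OF S(2)], unfold 3, intro mult_left_mono mult_right_mono 1 Ccz_nonneg) auto
qed

text \<open>As \<open>b\<close> has mean value zero, the kernel may be replaced by its increment
  from the point \<open>c\<close> of the cube. The increment gains
  \<open>(d * s) powr \<alpha>\<close>, which pays for the tail integral outside the dilate.\<close>

lemma bad_part:
  assumes T: "has_kernel T K" and L: "0 < L" and b: "test_function b"
    and supp: "\<And>y. y \<notin> dcube v L p \<Longrightarrow> b y = 0" and mean: "(LINT y|lebesgue. b y) = 0"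
  shows "(\<integral>\<^sup>+x. ennreal (cmod (T b x)) * indicator (- dilate v L (2 * CARD('n)) p) x \<partial>lebesgue) \<le>
    ennreal (Ccz * 4 ^ CARD('n) / (1 - 2 powr - \<alpha>)) * (\<integral>\<^sup>+y. ennreal (cmod (b y)) \<partial>lebesgue)"
proof -
  define d where "d = real CARD('n)"
  define s where "s = L / 2 ^ fst p"
  have s: "0 < s" using L by (simp add: s_def)
  have d: "1 \<le> d" by (simp add: d_def Suc_le_eq)
  obtain c where c: "c \<in> dcube v L p" using dcube_nonempty[OF L] by blast
  define Ib where "Ib = (LINT y|lebesgue. cmod (b y))"
  have Ib0: "0 \<le> Ib" unfolding Ib_def by simp
  have Ib: "(\<integral>\<^sup>+y. ennreal (cmod (b y)) \<partial>lebesgue) = ennreal Ib"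
    unfolding Ib_def using test_function_integrable[OF b] by (intro nn_integral_eq_integral) auto
  have "AE x in lebesgue. x \<notin> closed_support b \<longrightarrow> T b x = (LINT y|lebesgue. K x y * b y)"
    using T b test_function_compact_support[OF b] unfolding has_kernel_def test_function_def by blast
  then have ptw: "AE x in lebesgue. ennreal (cmod (T b x)) * indicator (- dilate v L (2 * CARD('n)) p) x \<le>
     ennreal (Ccz * (d * s) powr \<alpha> * Ib) * (ennreal (norm (x - c) powr - (d + \<alpha>)) *
       indicator {x. \<exists>i. 2 * d * s \<le> \<bar>x $ i - c $ i\<bar>} x)"
  proof eventually_elim
    case (elim x)
    show ?case
    proof (cases "x \<in> dilate v L (2 * CARD('n)) p")
      case False
      have "1 \<le> 2 * CARD('n)" by (simp add: Suc_le_eq)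
      then have "x \<notin> dilate v L 1 p" using dcube_subset_dilate[OF L, of 1 "2 * CARD('n)" v p] False by blast
      then have xs: "x \<notin> closed_support b" by (rule closed_support_dcube[OF L _ supp])
      then have Tb: "T b x = (LINT y|lebesgue. K x y * b y)" using elim by simp
      have int: "integrable lebesgue (\<lambda>y. K x y * b y)" by (rule kernel_integrable[OF b xs])
      obtain i where i: "2 * d * s \<le> \<bar>x $ i - c $ i\<bar>"
        using norm_ge_notin_dilate[OF L False c] by (auto simp: d_def s_def)
      have xc: "2 * d * s \<le> norm (c - x)"
        using i component_le_norm_cart[of "x - c" i] by (simp add: norm_minus_commute)
      have int2: "integrable lebesgue (\<lambda>y. K x c * b y)" using test_function_integrable[OF b] by simp
      \<comment> \<open>The subtracted term is zero by \<open>mean\<close>; it lets the smoothness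
        of the kernel in its second variable act.\<close>
      have "T b x = (LINT y|lebesgue. K x y * b y) - K x c * (LINT y|lebesgue. b y)"
        using Tb mean by simp
      also have "\<dots> = (LINT y|lebesgue. K x y * b y - K x c * b y)"
        using int int2 by simp
      finally have eq: "T b x = (LINT y|lebesgue. K x y * b y - K x c * b y)" .
      have "cmod (T b x) \<le> (LINT y|lebesgue. Ccz * (d * s) powr \<alpha> * norm (x - c) powr - (d + \<alpha>) * cmod (b y))"
        unfolding eq
      proof (rule Bochner_Integration.integral_norm_bound_integral)
        show "integrable lebesgue (\<lambda>y. K x y * b y - K x c * b y)" using int int2 by simp
        show "integrable lebesgue (\<lambda>y. Ccz * (d * s) powr \<alpha> * norm (x - c) powr - (d + \<alpha>) * cmod (b y))"
          using test_function_integrable[OF b] by simp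
        fix y
        show "norm (K x y * b y - K x c * b y) \<le> Ccz * (d * s) powr \<alpha> * norm (x - c) powr - (d + \<alpha>) * cmod (b y)"
        proof (cases "y \<in> dcube v L p")
          case True
          have "norm (c - y) < d * s"
            unfolding d_def s_def by (rule norm_less_dcube[OF dcube_coord_less[OF c True]])
          from kernel_diff_le(2)[OF s _ this[unfolded d_def] xc]
          have "cmod (K x c - K x y) \<le> Ccz * (d * s) powr \<alpha> * norm (c - x) powr - (d + \<alpha>)"
            by (simp add: d_def)
          then have "cmod (K x y - K x c) * cmod (b y) \<le> Ccz * (d * s) powr \<alpha> * norm (x - c) powr - (d + \<alpha>) * cmod (b y)"
            by (intro mult_right_mono) (auto simp: norm_minus_commute)
          then show ?thesis by (simp add: norm_mult[symmetric] left_diff_distrib)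
        qed (simp add: supp)
      qed
      also have "\<dots> = Ccz * (d * s) powr \<alpha> * Ib * norm (x - c) powr - (d + \<alpha>)"
        by (simp add: Ib_def)
      finally have "ennreal (cmod (T b x)) \<le> ennreal (Ccz * (d * s) powr \<alpha> * Ib * norm (x - c) powr - (d + \<alpha>))"
        by (rule ennreal_leI)
      also have "\<dots> = ennreal (Ccz * (d * s) powr \<alpha> * Ib) * ennreal (norm (x - c) powr - (d + \<alpha>))"
        using Ccz_nonneg Ib0 by (simp add: ennreal_mult)
      finally have "ennreal (cmod (T b x)) \<le> ennreal (Ccz * (d * s) powr \<alpha> * Ib) * ennreal (norm (x - c) powr - (d + \<alpha>))" .
      moreover have "x \<in> {x. \<exists>i. 2 * d * s \<le> \<bar>x $ i - c $ i\<bar>}" using i by blast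
      then have "indicator {x. \<exists>i. 2 * d * s \<le> \<bar>x $ i - c $ i\<bar>} x = (1 :: ennreal)" by (rule indicator_simps(1))
      ultimately show ?thesis using False by simp
    qed simp
  qed
  have "(\<integral>\<^sup>+x. ennreal (cmod (T b x)) * indicator (- dilate v L (2 * CARD('n)) p) x \<partial>lebesgue) \<le>
     (\<integral>\<^sup>+x. ennreal (Ccz * (d * s) powr \<alpha> * Ib) * (ennreal (norm (x - c) powr - (d + \<alpha>)) *
       indicator {x. \<exists>i. 2 * d * s \<le> \<bar>x $ i - c $ i\<bar>} x) \<partial>lebesgue)"
    by (rule nn_integral_mono_AE[OF ptw])
  also have "\<dots> = ennreal (Ccz * (d * s) powr \<alpha> * Ib) * (\<integral>\<^sup>+x. (ennreal (norm (x - c) powr - (d + \<alpha>)) *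
       indicator {x. \<exists>i. 2 * d * s \<le> \<bar>x $ i - c $ i\<bar>} x) \<partial>lebesgue)"
  proof (rule nn_integral_cmult)
    have "{x. \<exists>i. 2 * d * s \<le> \<bar>x $ i - c $ i\<bar>} \<in> sets borel" by measurable
    then have [measurable]: "{x. \<exists>i. 2 * d * s \<le> \<bar>x $ i - c $ i\<bar>} \<in> sets lebesgue" by (rule sets_borel_lebesgue)
    have "(\<lambda>x. norm (x - c) powr - (d + \<alpha>)) \<in> borel_measurable borel" by measurable
    then have [measurable]: "(\<lambda>x. norm (x - c) powr - (d + \<alpha>)) \<in> borel_measurable lebesgue" by (intro measurable_completion) simp
    show "(\<lambda>x. ennreal (norm (x - c) powr - (d + \<alpha>)) * indicator {x. \<exists>i. 2 * d * s \<le> \<bar>x $ i - c $ i\<bar>} x) \<in> borel_measurable lebesgue"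
      by measurable
  qed
  also have "\<dots> \<le> ennreal (Ccz * (d * s) powr \<alpha> * Ib) * ennreal (4 ^ CARD('n) * (2 * d * s) powr - \<alpha> / (1 - 2 powr - \<alpha>))"
    using tail_integral[of "2 * d * s" \<alpha> c] s d \<alpha> by (intro mult_left_mono) (auto simp: d_def)
  also have "\<dots> = ennreal (Ccz * (d * s) powr \<alpha> * Ib * (4 ^ CARD('n) * (2 * d * s) powr - \<alpha> / (1 - 2 powr - \<alpha>)))"
    using Ccz_nonneg Ib0 by (intro ennreal_mult'[symmetric]) auto
  also have "\<dots> \<le> ennreal (Ccz * 4 ^ CARD('n) / (1 - 2 powr - \<alpha>) * Ib)"
  proof (rule ennreal_leI)
    \<comment> \<open>The side length disappears: the gain of smoothness and the loss in the tail
      differ by the factor \<open>2 powr - \<alpha>\<close>, which is at most 1.\<close>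
    have "(2 * (d * s)) powr - \<alpha> = 2 powr - \<alpha> * (d * s) powr - \<alpha>"
      using s d by (intro powr_mult)
    moreover have "(d * s) powr \<alpha> * (d * s) powr - \<alpha> = 1"
      using s d by (simp add: powr_add[symmetric])
    ultimately have "(d * s) powr \<alpha> * (2 * d * s) powr - \<alpha> = 2 powr - \<alpha>" by (simp add: mult.assoc mult.left_commute)
    moreover have "2 powr - \<alpha> < (1::real)" using \<alpha> by (simp add: powr_less_one)
    ultimately have "(d * s) powr \<alpha> * (2 * d * s) powr - \<alpha> \<le> 1" by simp
    then have "(d * s) powr \<alpha> * (2 * d * s) powr - \<alpha> * (Ccz * 4 ^ CARD('n) / (1 - 2 powr - \<alpha>) * Ib) \<le>
       1 * (Ccz * 4 ^ CARD('n) / (1 - 2 powr - \<alpha>) * Ib)"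
      using Ccz_nonneg Ib0 \<open>2 powr - \<alpha> < 1\<close> by (intro mult_right_mono) auto
    then show "Ccz * (d * s) powr \<alpha> * Ib * (4 ^ CARD('n) * (2 * d * s) powr - \<alpha> / (1 - 2 powr - \<alpha>)) \<le>
      Ccz * 4 ^ CARD('n) / (1 - 2 powr - \<alpha>) * Ib" by (simp add: ac_simps)
  qed
  also have "\<dots> = ennreal (Ccz * 4 ^ CARD('n) / (1 - 2 powr - \<alpha>)) * ennreal Ib"
    using Ib0 by (rule ennreal_mult'')
  finally show ?thesis unfolding Ib .
qed

text \<open>The support of \<open>h\<close> is cut into the differences of the dilates of successive
  ancestors of \<open>q\<close>. In the difference number \<open>j\<close> the distance to
  \<open>q\<close> is at least \<open>t j\<close>, so the kernel changes by at most
  \<open>w j\<close>, while the hypothesis on averages bounds the mass of \<open>h\<close> there.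
  The products decay like \<open>2 powr - \<alpha>\<close> to the power \<open>j\<close>.\<close>

lemma oscillation:
  assumes L: "0 < L" and h: "test_function h" and x: "x \<in> dcube v L q" and x': "x' \<in> dcube v L q"
    and J: "J \<le> fst q" and c: "0 \<le> c"
    and h0: "\<And>y. y \<in> dilate v L (2 * CARD('n)) q \<Longrightarrow> h y = 0"
    and hJ: "\<And>y. y \<notin> dilate v L (2 * CARD('n)) (ancestor J q) \<Longrightarrow> h y = 0"
    and av: "\<And>j. 1 \<le> j \<Longrightarrow> j \<le> J \<Longrightarrow> (\<integral>\<^sup>+y. ennreal (cmod (h y)) * indicator (dilate v L (2 * CARD('n)) (ancestor j q)) y \<partial>lebesgue)
        \<le> ennreal c * emeasure lebesgue (dilate v L (2 * CARD('n)) (ancestor j q))"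
  shows "cmod ((LINT y|lebesgue. K x y * h y) - (LINT y|lebesgue. K x' y * h y)) \<le> Ccz * 5 ^ CARD('n) / (1 - 2 powr - \<alpha>) * c"
proof -
  define d where "d = real CARD('n)"
  define s where "s = L / 2 ^ fst q"
  define D where "D j = dilate v L (2 * CARD('n)) (ancestor j q)" for j
  define t where "t j = 2 * d * (2 ^ j * s)" for j :: nat
  define w where "w j = Ccz * (d * s) powr \<alpha> * t j powr - (d + \<alpha>)" for j
  have s: "0 < s" using L by (simp add: s_def)
  have d: "1 \<le> d" by (simp add: d_def Suc_le_eq)
  have w: "0 \<le> w j" for j unfolding w_def using Ccz_nonneg by simp
  have one: "1 \<le> 2 * CARD('n)" by (simp add: Suc_le_eq)
  have h01: "h y = 0" if "y \<in> dilate v L 1 q" for y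
    using h0 dcube_subset_dilate[OF L one] that by blast
  have sj: "L / 2 ^ fst (ancestor j q) = 2 ^ j * s" if "j \<le> J" for j
    using that J by (simp add: s_def power_diff)
  have int: "integrable lebesgue (\<lambda>y. K x y * h y)" "integrable lebesgue (\<lambda>y. K x' y * h y)"
    using kernel_integrable[OF h dcube_notin_closed_support[OF L x h01]]
      kernel_integrable[OF h dcube_notin_closed_support[OF L x' h01]] by auto
  have hm [measurable]: "h \<in> borel_measurable lebesgue" by (rule test_function_measurable[OF h])
  have Dm [measurable]: "D j \<in> sets lebesgue" for j unfolding D_def by measurable
  have ptw: "ennreal (cmod (K x y * h y - K x' y * h y)) \<le>
      (\<Sum>j<J. ennreal (w j) * (ennreal (cmod (h y)) * indicator (D (Suc j)) y))" for y
  proof (cases "h y = 0")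
    case False
    then have yJ: "y \<in> D J" using hJ by (auto simp: D_def)
    have y0: "y \<notin> D 0" using h0 False by (auto simp: D_def)
    \<comment> \<open>The first dilate that reaches \<open>y\<close>. It is not the dilate of
      \<open>q\<close> itself, where \<open>h\<close> vanishes, and its predecessor misses
      \<open>y\<close>, which gives the lower bound on the distance.\<close>
    define m where "m = (LEAST j. y \<in> D j)"
    have ym: "y \<in> D m" unfolding m_def using yJ by (rule LeastI)
    have mJ: "m \<le> J" unfolding m_def using yJ by (rule Least_le)
    have "m \<noteq> 0" using ym y0 by metis
    then obtain j where j: "m = Suc j" by (cases m) auto
    have ynj: "y \<notin> D j" using not_less_Least[of j "\<lambda>j. y \<in> D j"] j by (simp add: m_def)
    have jJ: "j < J" using mJ j by simp
    have "x \<in> dcube v L (ancestor j q)" using mem_dcube_ancestor[OF L x] jJ J by auto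
    then obtain i where "real (2 * CARD('n)) * (L / 2 ^ fst (ancestor j q)) \<le> \<bar>y $ i - x $ i\<bar>"
      using norm_ge_notin_dilate[OF L ynj[unfolded D_def]] by blast
    then have "t j \<le> \<bar>y $ i - x $ i\<bar>" unfolding sj[OF less_imp_le[OF jJ]] by (simp add: t_def d_def)
    then have tj: "t j \<le> norm (x - y)"
      using component_le_norm_cart[of "y - x" i] by (simp add: norm_minus_commute)
    have "norm (x - x') < d * s"
      unfolding d_def s_def by (rule norm_less_dcube[OF dcube_coord_less[OF x x']])
    moreover have "2 * d * s \<le> t j"
      using s d by (auto simp: t_def intro!: mult_left_mono)
    ultimately have "cmod (K x y - K x' y) \<le> w j"
      unfolding w_def d_def using s tj by (intro kernel_diff_le(1)) (auto simp: d_def)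
    then have "cmod (K x y - K x' y) * cmod (h y) \<le> w j * cmod (h y)"
      by (intro mult_right_mono) auto
    then have "ennreal (cmod (K x y * h y - K x' y * h y)) \<le> ennreal (w j * cmod (h y))"
      by (intro ennreal_leI) (simp add: norm_mult[symmetric] left_diff_distrib)
    also have "\<dots> = ennreal (w j) * (ennreal (cmod (h y)) * indicator (D (Suc j)) y)"
      using ym j w by (simp add: ennreal_mult)
    also have "\<dots> \<le> (\<Sum>j<J. ennreal (w j) * (ennreal (cmod (h y)) * indicator (D (Suc j)) y))"
      using jJ by (intro member_le_sum) auto
    finally show ?thesis .
  qed simp
  have "ennreal (cmod ((LINT y|lebesgue. K x y * h y) - (LINT y|lebesgue. K x' y * h y))) =
     ennreal (norm (LINT y|lebesgue. K x y * h y - K x' y * h y))"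
    using int by simp
  also have "\<dots> \<le> (\<integral>\<^sup>+y. ennreal (cmod (K x y * h y - K x' y * h y)) \<partial>lebesgue)"
    using int by (intro integral_norm_bound_ennreal) auto
  also have "\<dots> \<le> (\<integral>\<^sup>+y. (\<Sum>j<J. ennreal (w j) * (ennreal (cmod (h y)) * indicator (D (Suc j)) y)) \<partial>lebesgue)"
    by (intro nn_integral_mono ptw)
  also have "\<dots> = (\<Sum>j<J. ennreal (w j) * (\<integral>\<^sup>+y. ennreal (cmod (h y)) * indicator (D (Suc j)) y \<partial>lebesgue))"
    by (subst nn_integral_sum) (auto simp: nn_integral_cmult)
  also have "\<dots> \<le> (\<Sum>j<J. ennreal (Ccz * 5 ^ CARD('n) * c * (2 powr - \<alpha>) ^ j))"
  proof (rule sum_mono)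
    fix j assume j: "j \<in> {..<J}"
    have "ennreal (w j) * (\<integral>\<^sup>+y. ennreal (cmod (h y)) * indicator (D (Suc j)) y \<partial>lebesgue) \<le>
       ennreal (w j) * (ennreal c * emeasure lebesgue (D (Suc j)))"
      using av[of "Suc j"] j by (intro mult_left_mono) (auto simp: D_def)
    also have "emeasure lebesgue (D (Suc j)) = ennreal ((real (2 * (2 * CARD('n)) + 1) * (2 ^ Suc j * s)) ^ CARD('n))"
      using sj[of "Suc j"] j unfolding D_def by (simp add: emeasure_dilate[OF L])
    also have "ennreal (w j) * (ennreal c * \<dots>) = ennreal (w j * (c * (real (2 * (2 * CARD('n)) + 1) * (2 ^ Suc j * s)) ^ CARD('n)))"
      using w c s by (simp add: ennreal_mult)
    also have "\<dots> \<le> ennreal (Ccz * 5 ^ CARD('n) * c * (2 powr - \<alpha>) ^ j)"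
    proof (rule ennreal_leI)
      have tpos: "0 < t j" using d s by (simp add: t_def)
      \<comment> \<open>Source of the factor \<open>5 ^ d\<close>: \<open>4 d + 1 \<le> 5 d\<close>,
        so the dilate of ancestor \<open>j + 1\<close> has side at most
        \<open>5 * t j\<close>.\<close>
      have "real (2 * (2 * CARD('n)) + 1) * (2 ^ Suc j * s) \<le> 5 * d * (2 ^ Suc j * s)"
        using s d by (intro mult_right_mono) (auto simp: d_def)
      also have "\<dots> = 5 * t j" by (simp add: t_def)
      finally have "(real (2 * (2 * CARD('n)) + 1) * (2 ^ Suc j * s)) ^ CARD('n) \<le> (5 * t j) ^ CARD('n)"
        using s by (intro power_mono) auto
      then have "w j * (c * (real (2 * (2 * CARD('n)) + 1) * (2 ^ Suc j * s)) ^ CARD('n)) \<le> w j * (c * (5 * t j) ^ CARD('n))"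
        using w c by (intro mult_left_mono) auto
      also have "\<dots> = Ccz * c * 5 ^ CARD('n) * ((d * s) powr \<alpha> * (t j powr - (d + \<alpha>) * t j ^ CARD('n)))"
        by (simp add: w_def power_mult_distrib ac_simps)
      also have "t j powr - (d + \<alpha>) * t j ^ CARD('n) = t j powr - \<alpha>"
      proof -
        have "t j powr - (d + \<alpha>) = t j powr - d * t j powr - \<alpha>" by (simp add: powr_add[symmetric])
        moreover have "t j powr - d * t j ^ CARD('n) = 1"
          using tpos by (simp add: d_def powr_minus powr_realpow)
        ultimately show ?thesis by (simp add: ac_simps)
      qed
      finally have A: "w j * (c * (real (2 * (2 * CARD('n)) + 1) * (2 ^ Suc j * s)) ^ CARD('n)) \<le>
        Ccz * c * 5 ^ CARD('n) * ((d * s) powr \<alpha> * t j powr - \<alpha>)" .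
      have "(d * s) powr \<alpha> * t j powr - \<alpha> \<le> (2 powr - \<alpha>) ^ j"
      proof -
        have "t j = 2 * (2 ^ j * (d * s))" by (simp add: t_def ac_simps)
        then have "t j powr - \<alpha> = 2 powr - \<alpha> * ((2 ^ j) powr - \<alpha> * (d * s) powr - \<alpha>)"
          using s d by (simp add: powr_mult)
        moreover have "(2 ^ j) powr - \<alpha> = (2 powr - \<alpha>) ^ j"
          by (simp add: powr_realpow[symmetric] powr_powr mult.commute)
        moreover have "(d * s) powr \<alpha> * (d * s) powr - \<alpha> = 1"
          using s d by (simp add: powr_add[symmetric])
        ultimately have "(d * s) powr \<alpha> * t j powr - \<alpha> = 2 powr - \<alpha> * (2 powr - \<alpha>) ^ j"
          by (simp add: ac_simps)
        also have "\<dots> \<le> 1 * (2 powr - \<alpha>) ^ j"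
          using \<alpha> by (intro mult_right_mono) (auto simp: powr_less_one less_imp_le)
        finally show ?thesis by simp
      qed
      then have "Ccz * c * 5 ^ CARD('n) * ((d * s) powr \<alpha> * t j powr - \<alpha>) \<le> Ccz * c * 5 ^ CARD('n) * (2 powr - \<alpha>) ^ j"
        using Ccz_nonneg c by (intro mult_left_mono) auto
      with A show "w j * (c * (real (2 * (2 * CARD('n)) + 1) * (2 ^ Suc j * s)) ^ CARD('n)) \<le>
          Ccz * 5 ^ CARD('n) * c * (2 powr - \<alpha>) ^ j"
        by (simp add: ac_simps)
    qed
    finally show "ennreal (w j) * (\<integral>\<^sup>+y. ennreal (cmod (h y)) * indicator (D (Suc j)) y \<partial>lebesgue) \<le>
      ennreal (Ccz * 5 ^ CARD('n) * c * (2 powr - \<alpha>) ^ j)" .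
  qed
  also have "\<dots> \<le> (\<Sum>j. ennreal (Ccz * 5 ^ CARD('n) * c * (2 powr - \<alpha>) ^ j))"
    by (intro sum_le_suminf summableI) auto
  also have "\<dots> = ennreal (Ccz * 5 ^ CARD('n) * c / (1 - 2 powr - \<alpha>))"
    using \<alpha> Ccz_nonneg c by (intro geometric_ennreal) (auto simp: powr_less_one)
  finally have "cmod ((LINT y|lebesgue. K x y * h y) - (LINT y|lebesgue. K x' y * h y)) \<le> Ccz * 5 ^ CARD('n) * c / (1 - 2 powr - \<alpha>)"
    using \<alpha> Ccz_nonneg c by (subst (asm) ennreal_le_iff) (auto simp: powr_less_one less_imp_le)
  then show ?thesis by simp
qed

end

section \<open>The weak type (1,1) bound\<close>

text \<open>Integrals of \<open>|f|\<close> over sets become values of a measure, so that the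
  comparison of measures on unions of cubes applies to averages of \<open>|f|\<close>.\<close>

definition modulus_measure :: "('a::euclidean_space \<Rightarrow> complex) \<Rightarrow> 'a measure" where
  "modulus_measure f = density lebesgue (\<lambda>x. ennreal (cmod (f x)))"

lemma sets_modulus_measure [simp]: "sets (modulus_measure f) = sets lebesgue"
  by (simp add: modulus_measure_def)

lemma space_modulus_measure [simp]: "space (modulus_measure f) = UNIV"
  by (simp add: modulus_measure_def)

lemma emeasure_modulus_measure:
  assumes "test_function f" "A \<in> sets lebesgue"
  shows "emeasure (modulus_measure f) A = (\<integral>\<^sup>+x. ennreal (cmod (f x)) * indicator A x \<partial>lebesgue)"
  unfolding modulus_measure_def using assms test_function_measurable[OF assms(1)] by (subst emeasure_density) auto

lemma emeasure_modulus_measure_le: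
  assumes "test_function f"
  shows "emeasure (modulus_measure f) A \<le> ennreal (LINT x|lebesgue. cmod (f x))"
proof -
  have "emeasure (modulus_measure f) A \<le> emeasure (modulus_measure f) UNIV"
    using emeasure_space[of "modulus_measure f" A] by simp
  also have "\<dots> = (\<integral>\<^sup>+x. ennreal (cmod (f x)) \<partial>lebesgue)"
    using emeasure_modulus_measure[OF assms, of UNIV] by simp
  also have "\<dots> = ennreal (LINT x|lebesgue. cmod (f x))"
    using test_function_integrable[OF assms] by (intro nn_integral_eq_integral) auto
  finally show ?thesis .
qed

lemma emeasure_modulus_measure_restrict_to:
  assumes "test_function f" "A \<in> sets lebesgue" "B \<in> sets lebesgue"
  shows "emeasure (modulus_measure (restrict_to A f)) B = emeasure (modulus_measure f) (A \<inter> B)"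
  unfolding emeasure_modulus_measure[OF test_function_restrict_to[OF assms(1,2)] assms(3)] emeasure_modulus_measure[OF assms(1) sets.Int[OF assms(2,3)]]
  by (intro nn_integral_cong) (auto simp: restrict_to_def indicator_def)

lemma emeasure_le_nn_integral:
  assumes "A \<in> sets M" "0 < l" "\<And>x. x \<in> A \<Longrightarrow> ennreal l \<le> h x"
  shows "emeasure M A \<le> ennreal (1 / l) * (\<integral>\<^sup>+x. h x \<partial>M)"
proof -
  have "ennreal l * emeasure M A = (\<integral>\<^sup>+x. ennreal l * indicator A x \<partial>M)"
    using assms by (simp add: nn_integral_cmult_indicator)
  also have "\<dots> \<le> (\<integral>\<^sup>+x. h x \<partial>M)"
    using assms(3) by (intro nn_integral_mono) (auto simp: indicator_def)
  finally have "ennreal (1 / l) * (ennreal l * emeasure M A) \<le> ennreal (1 / l) * (\<integral>\<^sup>+x. h x \<partial>M)"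
    by (rule mult_left_mono) simp
  then show ?thesis
    using assms(2) by (simp add: mult.assoc[symmetric] ennreal_mult[symmetric])
qed

text \<open>Every point of an open set has small dyadic cubes inside it. Exceptional sets are
  therefore enlarged to open ones, at the price of a factor 2.\<close>

lemma open_superset_lebesgue:
  fixes S :: "'a::euclidean_space set"
  assumes "S \<in> sets lebesgue" "emeasure lebesgue S \<le> ennreal c" "0 < c"
  obtains G where "open G" "S \<subseteq> G" "emeasure lebesgue G \<le> ennreal (2 * c)"
proof -
  obtain G where G: "open G" "S \<subseteq> G" "(G - S) \<in> lmeasurable" "emeasure lebesgue (G - S) < ennreal c"
    using sets_lebesgue_outer_open[OF assms(1,3)] .
  have "G = S \<union> (G - S)" using G by auto
  then have "emeasure lebesgue G \<le> emeasure lebesgue S + emeasure lebesgue (G - S)"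
    using emeasure_subadditive[of S lebesgue "G - S"] assms(1) G(3) by (metis fmeasurableD)
  also have "\<dots> \<le> ennreal c + ennreal c"
    using assms(2) G(4) by (intro add_mono) auto
  also have "\<dots> = ennreal (2 * c)" using assms(3) by (simp add: ennreal_plus[symmetric] del: ennreal_plus)
  finally show ?thesis using that G by blast
qed

text \<open>Continuity from above along the finite index sets given by an enumeration.\<close>

lemma finite_UN_approx:
  fixes A :: "'i::countable \<Rightarrow> 'a set"
  assumes A: "\<And>i. i \<in> I \<Longrightarrow> A i \<in> sets M" and fin: "emeasure M (\<Union>i\<in>I. A i) < \<infinity>" and e: "0 < e"
  obtains J where "finite J" "J \<subseteq> I" "emeasure M ((\<Union>i\<in>I. A i) - (\<Union>i\<in>J. A i)) < e"
proof -
  define J where "J n = {i \<in> I. to_nat i < n}" for n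
  have fJ: "finite (J n)" for n
  proof -
    have "J n \<subseteq> from_nat ` {..<n}"
    proof
      fix i assume "i \<in> J n"
      then have "i = from_nat (to_nat i)" "to_nat i \<in> {..<n}" by (auto simp: J_def)
      then show "i \<in> from_nat ` {..<n}" by blast
    qed
    then show ?thesis by (rule finite_subset) auto
  qed
  have JI: "J n \<subseteq> I" for n by (auto simp: J_def)
  define D where "D n = (\<Union>i\<in>I. A i) - (\<Union>i\<in>J n. A i)" for n
  have UNm: "(\<Union>i\<in>I. A i) \<in> sets M" using A by (intro sets.countable_UN'') auto
  have Dm: "D n \<in> sets M" for n
    unfolding D_def using UNm A JI by (intro sets.Diff sets.countable_UN'') auto
  have "(\<lambda>n. emeasure M (D n)) \<longlonglongrightarrow> emeasure M (\<Inter>n. D n)"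
  proof (rule Lim_emeasure_decseq)
    show "range D \<subseteq> sets M" using Dm by auto
    show "decseq D" unfolding decseq_def D_def J_def by force
    show "emeasure M (D n) \<noteq> \<infinity>" for n
    proof -
      have "emeasure M (D n) \<le> emeasure M (\<Union>i\<in>I. A i)"
        using UNm by (intro emeasure_mono) (auto simp: D_def)
      then show ?thesis using fin by (auto simp: top_unique)
    qed
  qed
  moreover have "(\<Inter>n. D n) = {}"
  proof safe
    fix x assume x: "x \<in> (\<Inter>n. D n)"
    then have "x \<in> (\<Union>i\<in>I. A i)" by (auto simp: D_def)
    then obtain i where i: "i \<in> I" "x \<in> A i" by blast
    have "x \<in> D (Suc (to_nat i))" using x by blast
    then show "x \<in> {}" using i by (auto simp: D_def J_def)
  qed
  ultimately have "(\<lambda>n. emeasure M (D n)) \<longlonglongrightarrow> 0" by simp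
  then have "eventually (\<lambda>n. emeasure M (D n) < e) sequentially"
    using e by (rule order_tendstoD(2))
  then obtain n where "emeasure M (D n) < e" by (auto simp: eventually_sequentially)
  then show ?thesis using that[of "J n"] fJ JI unfolding D_def by blast
qed

lemma ennreal_half_less: "0 < (x::ennreal) \<Longrightarrow> x < \<infinity> \<Longrightarrow> ennreal (1/2) * x < x"
proof (cases x)
  case (real r)
  assume "0 < x"
  then have "0 < r" using real by simp
  moreover have "ennreal (1/2) * ennreal r = ennreal (1/2 * r)" using real by (intro ennreal_mult[symmetric]) auto
  ultimately show ?thesis using real by (simp only: ennreal_less_iff)
qed simp

lemma sum_emeasure_modulus:
  assumes "finite J" "disjoint_family_on A J" "\<And>p. p \<in> J \<Longrightarrow> A p \<in> sets lebesgue"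
  shows "(\<Sum>p\<in>J. emeasure (modulus_measure f) (A p)) = emeasure (modulus_measure f) (\<Union>p\<in>J. A p)"
  using assms by (intro sum_emeasure) (auto simp: image_subset_iff)

text \<open>The three terms belong to the three exceptional sets of the weak type estimate: where
  the good part exceeds half the height (Chebyshev with squares), the dilated cubes, and where the
  bad parts exceed half the height off those dilates (Chebyshev).\<close>

definition weak_const :: "nat \<Rightarrow> real \<Rightarrow> real \<Rightarrow> real \<Rightarrow> real" where
  "weak_const d Ccz \<alpha> B = 4 * B\<^sup>2 * (2 + 5 * 4 ^ d) + 5 * real (2 * (2 * d) + 1) ^ d
     + 4 * (Ccz * 4 ^ d / (1 - 2 powr - \<alpha>))"

context
  fixes Ccz \<alpha> :: real and K :: "real^'n \<Rightarrow> real^'n \<Rightarrow> complex" and T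
  assumes \<alpha>: "0 < \<alpha>" and K: "CZ_kernel Ccz \<alpha> K"
    and T: "L2_bounded_operator lebesgue T" and TK: "has_kernel T K"
begin

lemma bad_const_nonneg: "0 \<le> Ccz * 4 ^ CARD('n) / (1 - 2 powr - \<alpha>)"
  using Ccz_nonneg[OF \<alpha> K] \<alpha> by (simp add: powr_less_one less_imp_le)

text \<open>
  The Calderon--Zygmund cubes are selected by the averages of \<open>|f|\<close> and also by their share of an open
  set \<open>G\<close> containing \<open>{|f| > l}\<close>. As every point of \<open>G\<close> has a small dyadic cube inside \<open>G\<close>, this gives
  \<open>|f| \<le> l\<close> off the selected cubes without Lebesgue differentiation. Only finitely many cubes \<open>J\<close>
  enter the bad part, the others are left in \<open>g\<close>, so that no infinite sum passes through \<open>T\<close>.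
\<close>

lemma weak_type_pos:
  assumes f: "test_function f" and l: "0 < l" and F: "0 < (LINT x|lebesgue. cmod (f x))"
  shows "emeasure lebesgue {x. l < cmod (T f x)} \<le> ennreal (weak_const CARD('n) Ccz \<alpha> (L2_opnorm lebesgue T) * (LINT x|lebesgue. cmod (f x)) / l)"
proof -
  define F where "F = (LINT x|lebesgue. cmod (f x))"
  define B where "B = L2_opnorm lebesgue T"
  define d where "d = CARD('n)"
  define a where "a = 2 * CARD('n)"
  define Cb where "Cb = Ccz * 4 ^ CARD('n) / (1 - 2 powr - \<alpha>)"
  have F0: "0 < F" using F by (simp add: F_def)
  have Cb: "0 \<le> Cb" unfolding Cb_def by (rule bad_const_nonneg)
  have intF: "(\<integral>\<^sup>+x. ennreal (cmod (f x)) \<partial>lebesgue) = ennreal F"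
    unfolding F_def using test_function_integrable[OF f] by (intro nn_integral_eq_integral) auto
  have fm [measurable]: "f \<in> borel_measurable lebesgue" by (rule test_function_measurable[OF f])
  obtain Bf where Bf: "0 < Bf" "\<And>x. cmod (f x) \<le> Bf" using test_function_bound[OF f] by metis
  have "{x \<in> space lebesgue. l < cmod (f x)} \<in> sets lebesgue" by measurable
  then have Sm: "{x. l < cmod (f x)} \<in> sets lebesgue" by simp
  have "emeasure lebesgue {x. l < cmod (f x)} \<le> ennreal (1 / l) * (\<integral>\<^sup>+x. ennreal (cmod (f x)) \<partial>lebesgue)"
    using l by (intro emeasure_le_nn_integral Sm) (auto intro: ennreal_leI)
  then have "emeasure lebesgue {x. l < cmod (f x)} \<le> ennreal (F / l)"
    using l F0 by (simp add: intF ennreal_mult[symmetric])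
  then obtain G where G: "open G" "{x. l < cmod (f x)} \<subseteq> G" "emeasure lebesgue G \<le> ennreal (2 * (F / l))"
    using open_superset_lebesgue[OF Sm] F0 l by (metis divide_pos_pos)
  have Gm [measurable]: "G \<in> sets lebesgue" using G(1) by (intro sets_borel_lebesgue) auto
  \<comment> \<open>Large enough that no cube of top level is selected: both its average of
    \<open>|f|\<close> and its share of \<open>G\<close> stay below the thresholds. Hence every
    selected cube has a parent. The maximum with 1 gives \<open>L \<le> L ^ d\<close>.\<close>
  define L where "L = max 1 (4 * F / l)"
  have L: "0 < L" by (simp add: L_def)
  have Ld: "4 * F / l \<le> L ^ d"
  proof -
    have "L \<le> L ^ d" by (rule self_le_power) (auto simp: L_def d_def)
    then show ?thesis by (simp add: L_def)
  qed
  let ?C = "dcube (0::real^'n) L"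
  let ?e = "emeasure lebesgue"
  define S where "S = {p. ennreal l * ?e (?C p) < emeasure (modulus_measure f) (?C p) \<or> ennreal (1/2) * ?e (?C p) < ?e (?C p \<inter> G)}"
  define M where "M = maximal 0 L S"
  define \<Omega> where "\<Omega> = (\<Union>p\<in>M. ?C p)"
  have Cm: "?C p \<in> sets lebesgue" for p by measurable
  have disj: "disjoint_family_on ?C M" unfolding M_def by (rule disjoint_maximal[OF L])
  have Mlev: "0 < fst p" if "p \<in> M" for p
  proof (rule ccontr)
    assume "\<not> 0 < fst p"
    then have ep: "?e (?C p) = ennreal (L ^ d)" by (simp add: emeasure_dilate[OF L] d_def)
    have "ennreal F \<le> ennreal (l * L ^ d)"
      using Ld l F0 by (intro ennreal_leI) (auto simp: field_simps)
    then have "emeasure (modulus_measure f) (?C p) \<le> ennreal l * ?e (?C p)"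
      using emeasure_modulus_measure_le[OF f, of "?C p"] l L by (simp add: ep F_def ennreal_mult)
    moreover have "?e (?C p \<inter> G) \<le> ennreal (1/2) * ?e (?C p)"
    proof -
      have "?e (?C p \<inter> G) \<le> ?e G" by (intro emeasure_mono) auto
      also have "\<dots> \<le> ennreal (2 * (F / l))" by (rule G)
      also have "\<dots> \<le> ennreal (1/2 * L ^ d)" using Ld by (intro ennreal_leI) (auto simp: field_simps)
      also have "\<dots> = ennreal (1/2) * ?e (?C p)" using L unfolding ep by (intro ennreal_mult) auto
      finally show ?thesis .
    qed
    moreover have "p \<in> S" using that maximal_subset by (auto simp: M_def)
    ultimately show False by (auto simp: S_def)
  qed
  have muM: "emeasure (modulus_measure f) (?C p) \<le> ennreal (l * 2 ^ d) * ?e (?C p)" if p: "p \<in> M" for p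
  proof -
    have "ancestor 1 p \<notin> S" using maximal_parent_notin[OF L p[unfolded M_def], of 1] Mlev[OF p] by simp
    then have "emeasure (modulus_measure f) (?C (ancestor 1 p)) \<le> ennreal l * ?e (?C (ancestor 1 p))" by (auto simp: S_def not_less)
    also have "?e (?C (ancestor 1 p)) = 2 ^ d * ?e (?C p)"
      using Mlev[OF p] unfolding d_def by (intro emeasure_dilate_parent L)
    finally have "emeasure (modulus_measure f) (?C (ancestor 1 p)) \<le> ennreal l * (2 ^ d * ?e (?C p))" .
    moreover have "emeasure (modulus_measure f) (?C p) \<le> emeasure (modulus_measure f) (?C (ancestor 1 p))"
      using dcube_ancestor_subset[OF L, of 1 p 0] Mlev[OF p] by (intro emeasure_mono) auto
    moreover have "ennreal l * (2 ^ d * ?e (?C p)) = ennreal (l * 2 ^ d) * ?e (?C p)"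
      using l by (simp add: ennreal_mult mult.assoc ennreal_power[symmetric])
    ultimately show ?thesis by simp
  qed
  \<comment> \<open>One measure for the two selection criteria: by either of them it dominates
    Lebesgue measure on a selected cube. Its total mass on the union is at most \<open>F / l\<close>
    plus twice the measure of \<open>G\<close>, hence the 5.\<close>
  define N where "N = density lebesgue (\<lambda>x. ennreal (1 / l) * ennreal (cmod (f x)) + 2 * indicator G x)"
  have N: "emeasure N A = ennreal (1 / l) * emeasure (modulus_measure f) A + 2 * ?e (A \<inter> G)" if [measurable]: "A \<in> sets lebesgue" for A
  proof -
    have "emeasure N A = (\<integral>\<^sup>+x. ennreal (1 / l) * (ennreal (cmod (f x)) * indicator A x) + 2 * indicator (A \<inter> G) x \<partial>lebesgue)"
      unfolding N_def by (subst emeasure_density) (auto intro!: nn_integral_cong simp: indicator_def)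
    then show ?thesis by (simp add: nn_integral_add nn_integral_cmult emeasure_modulus_measure[OF f])
  qed
  have \<Omega>m [measurable]: "\<Omega> \<in> sets lebesgue" unfolding \<Omega>_def by (intro sets.countable_UN'') auto
  have e\<Omega>: "?e \<Omega> \<le> ennreal (5 * F / l)"
  proof -
    have "?e \<Omega> \<le> 1 * emeasure N \<Omega>"
      unfolding \<Omega>_def
    proof (rule disjoint_UN_emeasure_le[OF _ disj])
      show "?e (?C p) \<le> 1 * emeasure N (?C p)" if "p \<in> M" for p
      proof -
        have "p \<in> S" using that maximal_subset by (auto simp: M_def)
        then consider "ennreal l * ?e (?C p) < emeasure (modulus_measure f) (?C p)" | "ennreal (1/2) * ?e (?C p) < ?e (?C p \<inter> G)"
          by (auto simp: S_def)
        then show ?thesis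
        proof cases
          case 1
          then have "ennreal (1 / l) * (ennreal l * ?e (?C p)) \<le> ennreal (1 / l) * emeasure (modulus_measure f) (?C p)"
            by (intro mult_left_mono) auto
          then have "?e (?C p) \<le> ennreal (1 / l) * emeasure (modulus_measure f) (?C p)"
            using l by (simp add: mult.assoc[symmetric] ennreal_mult[symmetric])
          then show ?thesis by (simp add: N[OF Cm] add_increasing2)
        next
          case 2
          then have "2 * (ennreal (1/2) * ?e (?C p)) \<le> 2 * ?e (?C p \<inter> G)"
            by (intro mult_left_mono) auto
          moreover have "2 * (ennreal (1/2) * ?e (?C p)) = ?e (?C p)"
          proof -
            have "(2::ennreal) * ennreal (1/2) = ennreal (2 * (1/2))" by (subst ennreal_mult) auto
            then show ?thesis by (simp add: mult.assoc[symmetric])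
          qed
          ultimately show ?thesis by (simp add: N[OF Cm] add_increasing)
        qed
      qed
    qed (auto simp: N_def)
    also have "\<dots> \<le> ennreal (1 / l) * ennreal F + 2 * ennreal (2 * (F / l))"
    proof -
      have "?e (\<Omega> \<inter> G) \<le> ?e G" by (intro emeasure_mono) auto
      then show ?thesis
        using emeasure_modulus_measure_le[OF f, of \<Omega>] G(3) unfolding N[OF \<Omega>m] mult_1 F_def[symmetric]
        by (intro add_mono mult_left_mono) auto
    qed
    also have "\<dots> = ennreal (5 * F / l)"
    proof -
      have "2 * ennreal (2 * (F / l)) = ennreal (4 * (F / l))"
        using F0 l by (subst (1) ennreal_numeral[symmetric], subst ennreal_mult[symmetric]) auto
      moreover have "ennreal (1 / l) * ennreal F = ennreal (F / l)"
        using F0 l by (simp add: ennreal_mult[symmetric])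
      ultimately show ?thesis
        using F0 l by (simp add: ennreal_plus[symmetric] del: ennreal_plus)
    qed
    finally show ?thesis .
  qed
  have off: "cmod (f x) \<le> l" if "x \<notin> \<Omega>" for x
  proof (rule ccontr)
    assume "\<not> cmod (f x) \<le> l"
    then have "x \<in> G" using G(2) by auto
    then obtain p where p: "x \<in> ?C p" "?C p \<subseteq> G"
      using ex_small_dcube[OF L G(1), of x 0 0] by blast
    then have "?C p \<inter> G = ?C p" by auto
    then have "p \<in> S" using ennreal_half_less[OF emeasure_dilate_pos[OF L] emeasure_dilate_finite[OF L], of 0 0 p]
      by (simp add: S_def)
    then have "x \<in> \<Omega>" using UN_maximal[OF L, of 0 S] p by (auto simp: \<Omega>_def M_def)
    with that show False by simp
  qed
  \<comment> \<open>On the cubes left out of \<open>J\<close> the function \<open>g\<close> equals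
    \<open>f\<close>, and \<open>|f|\<close> is merely bounded by \<open>Bf\<close>. With this
    choice they add at most \<open>l * F\<close> to the integral of the square of
    \<open>g\<close>.\<close>
  define \<epsilon> where "\<epsilon> = l * F / Bf\<^sup>2"
  have \<epsilon>: "0 < \<epsilon>" using l F0 Bf by (simp add: \<epsilon>_def)
  have "?e \<Omega> < \<infinity>" using e\<Omega> by (auto intro: le_less_trans)
  then obtain J where J: "finite J" "J \<subseteq> M" "?e (\<Omega> - (\<Union>p\<in>J. ?C p)) < ennreal \<epsilon>"
    using finite_UN_approx[of M ?C lebesgue "ennreal \<epsilon>"] \<epsilon> unfolding \<Omega>_def by (metis Cm ennreal_less_zero_iff)
  define \<Omega>J where "\<Omega>J = (\<Union>p\<in>J. ?C p)"
  have \<Omega>Jm [measurable]: "\<Omega>J \<in> sets lebesgue" unfolding \<Omega>J_def using J by (intro sets.finite_UN) auto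
  have \<Omega>J\<Omega>: "\<Omega>J \<subseteq> \<Omega>" unfolding \<Omega>J_def \<Omega>_def using J by auto
  define av where "av p = (LINT y|lebesgue. restrict_to (?C p) f y) / complex_of_real (measure lebesgue (?C p))" for p
  define b where "b p = (\<lambda>x. restrict_to (?C p) f x - restrict_to (?C p) (\<lambda>_. av p) x)" for p
  have mp: "0 < measure lebesgue (?C p)" "?e (?C p) = ennreal (measure lebesgue (?C p))" for p
    using emeasure_dilate_pos[OF L, of 0 0 p] emeasure_dilate_finite[OF L, of 0 0 p]
    by (auto simp: measure_def enn2real_positive_iff less_top[symmetric])
  have bdC: "bounded (?C p)" for p
  proof -
    have "?C p \<subseteq> cbox (\<chi> i. 0 $ i + (of_int (snd p i) - real 0) * (L / 2 ^ fst p)) (\<chi> i. 0 $ i + (of_int (snd p i) + 1 + real 0) * (L / 2 ^ fst p))"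
      unfolding dilate_def half_open_box_def by (auto simp: mem_box_cart less_imp_le)
    then show ?thesis by (rule bounded_subset[OF bounded_cbox])
  qed
  have nres: "test_function (restrict_to (?C p) f)" for p by (rule test_function_restrict_to[OF f Cm])
  have nav: "test_function (restrict_to (?C p) (\<lambda>_. c))" for p c by (rule test_function_indicator[OF Cm bdC])
  have nb: "test_function (b p)" for p unfolding b_def by (rule test_function_diff[OF nres nav])
  have int_const: "(LINT y|lebesgue. restrict_to (?C p) (\<lambda>_. c) y) = measure lebesgue (?C p) * c" for p and c :: complex
  proof -
    have "(LINT y|lebesgue. restrict_to (?C p) (\<lambda>_. c) y) = (LINT y|lebesgue. indicator (?C p) y *\<^sub>R c)"
      by (intro Bochner_Integration.integral_cong) (auto simp: restrict_to_def indicator_def)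
    also have "\<dots> = measure lebesgue (?C p) *\<^sub>R c"
      using emeasure_dilate_finite[OF L, of 0 0 p] by (subst integral_scaleR_left) (auto simp: Cm)
    finally show ?thesis by (simp add: scaleR_conv_of_real)
  qed
  have mean: "(LINT y|lebesgue. b p y) = 0" for p
    unfolding b_def using mp(1)[of p]
    by (subst Bochner_Integration.integral_diff[OF test_function_integrable[OF nres] test_function_integrable[OF nav]])
       (simp add: int_const av_def)
  have suppb: "b p y = 0" if "y \<notin> ?C p" for p y using that by (simp add: b_def restrict_to_def)
  have avle: "ennreal (cmod (av p)) * ?e (?C p) \<le> emeasure (modulus_measure f) (?C p)" for p
  proof -
    have "ennreal (cmod (LINT y|lebesgue. restrict_to (?C p) f y)) \<le> (\<integral>\<^sup>+y. ennreal (cmod (restrict_to (?C p) f y)) \<partial>lebesgue)"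
      by (rule integral_norm_bound_ennreal[OF test_function_integrable[OF nres]])
    also have "\<dots> = emeasure (modulus_measure f) (?C p)"
      unfolding emeasure_modulus_measure[OF f Cm] by (intro nn_integral_cong) (auto simp: restrict_to_def indicator_def)
    also have "ennreal (cmod (LINT y|lebesgue. restrict_to (?C p) f y)) = ennreal (cmod (av p)) * ?e (?C p)"
      using mp(1)[of p] unfolding mp(2) by (simp add: av_def norm_divide ennreal_mult[symmetric])
    finally show ?thesis .
  qed
  have av_bound: "cmod (av p) \<le> l * 2 ^ d" if "p \<in> M" for p
  proof -
    have "ennreal (cmod (av p)) * ?e (?C p) \<le> ennreal (l * 2 ^ d) * ?e (?C p)"
      using avle muM[OF that] by (rule order.trans)
    then show ?thesis using mp(1)[of p] l unfolding mp(2) by (simp add: ennreal_mult[symmetric])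
  qed
  have b1: "(\<integral>\<^sup>+y. ennreal (cmod (b p y)) \<partial>lebesgue) \<le> 2 * emeasure (modulus_measure f) (?C p)" for p
  proof -
    have "(\<integral>\<^sup>+y. ennreal (cmod (b p y)) \<partial>lebesgue) \<le>
       (\<integral>\<^sup>+y. ennreal (cmod (f y)) * indicator (?C p) y + ennreal (cmod (av p)) * indicator (?C p) y \<partial>lebesgue)"
    proof (intro nn_integral_mono)
      fix y
      have "ennreal (cmod (f y - av p)) \<le> ennreal (cmod (f y)) + ennreal (cmod (av p))"
        using ennreal_leI[OF norm_triangle_ineq4[of "f y" "av p"]] by simp
      then show "ennreal (cmod (b p y)) \<le> ennreal (cmod (f y)) * indicator (?C p) y + ennreal (cmod (av p)) * indicator (?C p) y"
        by (auto simp: b_def restrict_to_def indicator_def)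
    qed
    also have "\<dots> = emeasure (modulus_measure f) (?C p) + ennreal (cmod (av p)) * ?e (?C p)"
      using Cm by (simp add: nn_integral_add nn_integral_cmult_indicator emeasure_modulus_measure[OF f])
    also have "\<dots> \<le> emeasure (modulus_measure f) (?C p) + emeasure (modulus_measure f) (?C p)"
      by (intro add_left_mono avle)
    finally show ?thesis by (simp add: mult_2)
  qed
  define g where "g = (\<lambda>x. f x - (\<Sum>p\<in>J. b p x))"
  have nsum: "test_function (\<lambda>x. \<Sum>p\<in>J. b p x)" by (intro test_function_sum nb)
  have ng: "test_function g" unfolding g_def by (rule test_function_diff[OF f nsum])
  have bsum1: "(\<Sum>q\<in>J. b q x) = f x - av p" if "p \<in> J" "x \<in> ?C p" for p x
  proof -
    have "b q x = 0" if "q \<in> J - {p}" for q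
    proof -
      have "?C q \<inter> ?C p = {}" using disj that \<open>p \<in> J\<close> J(2) by (auto simp: disjoint_family_on_def)
      then show ?thesis using suppb \<open>x \<in> ?C p\<close> by blast
    qed
    then have "(\<Sum>q\<in>J. b q x) = b p x"
      using J(1) that by (subst sum.remove[of J p]) auto
    then show ?thesis using that by (simp add: b_def restrict_to_def)
  qed
  have bsum0: "(\<Sum>q\<in>J. b q x) = 0" if "x \<notin> \<Omega>J" for x
    using that suppb by (intro sum.neutral) (auto simp: \<Omega>J_def)
  have gptw: "ennreal ((cmod (g x))\<^sup>2) \<le> ennreal l * ennreal (cmod (f x)) +
      (ennreal (Bf\<^sup>2) * indicator (\<Omega> - \<Omega>J) x + ennreal ((l * 2 ^ d)\<^sup>2) * indicator \<Omega> x)" for x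
  proof -
    consider p where "p \<in> J" "x \<in> ?C p" | "x \<in> \<Omega> - \<Omega>J" | "x \<notin> \<Omega>" unfolding \<Omega>J_def by blast
    then show ?thesis
    proof cases
      case 1
      then have "g x = av p" by (simp add: g_def bsum1)
      then have "ennreal ((cmod (g x))\<^sup>2) \<le> ennreal ((l * 2 ^ d)\<^sup>2)"
        using av_bound[of p] 1 J(2) by (intro ennreal_leI power_mono) auto
      moreover have "x \<in> \<Omega>" using 1 \<Omega>J\<Omega> by (auto simp: \<Omega>J_def)
      ultimately show ?thesis by (simp add: add_increasing)
    next
      case 2
      then have "g x = f x" by (simp add: g_def bsum0)
      then have "ennreal ((cmod (g x))\<^sup>2) \<le> ennreal (Bf\<^sup>2)"
        using Bf by (intro ennreal_leI power_mono) auto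
      then show ?thesis using 2 by (simp add: add_increasing add_increasing2)
    next
      case 3
      then have "g x = f x" using \<Omega>J\<Omega> by (subst g_def, subst bsum0) auto
      then have "ennreal ((cmod (g x))\<^sup>2) \<le> ennreal (l * cmod (f x))"
        using off[OF 3] by (intro ennreal_leI) (auto simp: power2_eq_square mult_right_mono)
      then show ?thesis using l by (simp add: ennreal_mult add_increasing2)
    qed
  qed
  \<comment> \<open>One \<open>l * F\<close> comes from the complement of the cubes, another from
    the omitted cubes, and the rest from the cubes of \<open>J\<close>, where \<open>g\<close> is an
    average of size at most \<open>l * 2 ^ d\<close> and the total volume is at most
    \<open>5 * F / l\<close>.\<close>
  have g2: "(\<integral>\<^sup>+x. ennreal ((cmod (g x))\<^sup>2) \<partial>lebesgue) \<le> ennreal ((2 + 5 * 4 ^ d) * l * F)"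
  proof -
    have "(\<integral>\<^sup>+x. ennreal ((cmod (g x))\<^sup>2) \<partial>lebesgue) \<le> (\<integral>\<^sup>+x. ennreal l * ennreal (cmod (f x)) +
      (ennreal (Bf\<^sup>2) * indicator (\<Omega> - \<Omega>J) x + ennreal ((l * 2 ^ d)\<^sup>2) * indicator \<Omega> x) \<partial>lebesgue)"
      by (intro nn_integral_mono gptw)
    also have "\<dots> = ennreal l * ennreal F + (ennreal (Bf\<^sup>2) * ?e (\<Omega> - \<Omega>J) + ennreal ((l * 2 ^ d)\<^sup>2) * ?e \<Omega>)"
      by (simp add: nn_integral_add nn_integral_cmult nn_integral_cmult_indicator intF)
    also have "\<dots> \<le> ennreal l * ennreal F + (ennreal (Bf\<^sup>2) * ennreal \<epsilon> + ennreal ((l * 2 ^ d)\<^sup>2) * ennreal (5 * F / l))"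
      using J(3) e\<Omega> by (intro add_mono mult_left_mono) (auto simp: \<Omega>J_def)
    also have "\<dots> = ennreal (l * F + (Bf\<^sup>2 * \<epsilon> + (l * 2 ^ d)\<^sup>2 * (5 * F / l)))"
      using l F0 \<epsilon> by (simp add: ennreal_mult[symmetric] ennreal_plus[symmetric] del: ennreal_plus)
    also have "l * F + (Bf\<^sup>2 * \<epsilon> + (l * 2 ^ d)\<^sup>2 * (5 * F / l)) = (2 + 5 * 4 ^ d) * l * F"
    proof -
      have "Bf\<^sup>2 * \<epsilon> = l * F" using Bf by (simp add: \<epsilon>_def)
      moreover have "((2::real) ^ d)\<^sup>2 = 4 ^ d" by (simp add: power2_eq_square power_mult_distrib[symmetric])
      then have "(l * 2 ^ d)\<^sup>2 * (5 * F / l) = 5 * 4 ^ d * l * F"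
        using l F0 by (simp only: power_mult_distrib) (simp add: power2_eq_square)
      ultimately show ?thesis by (simp add: algebra_simps)
    qed
    finally show ?thesis .
  qed
  define D where "D = (\<Union>p\<in>J. dilate 0 L a p)"
  have Dm [measurable]: "D \<in> sets lebesgue" unfolding D_def using J by (intro sets.finite_UN) auto
  have eD: "?e D \<le> ennreal (5 * real (2 * a + 1) ^ d * F / l)"
  proof -
    have "?e D \<le> ennreal (real (2 * a + 1) ^ d) * ?e \<Omega>J"
      unfolding D_def \<Omega>J_def
    proof (rule UN_emeasure_le)
      show "disjoint_family_on ?C J" using disj J(2) by (rule disjoint_family_on_mono[rotated])
    qed (auto simp: emeasure_dilate_dcube[OF L, of 0 a] d_def)
    also have "\<dots> \<le> ennreal (real (2 * a + 1) ^ d) * ennreal (5 * F / l)"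
    proof (intro mult_left_mono)
      show "?e \<Omega>J \<le> ennreal (5 * F / l)"
        using emeasure_mono[OF \<Omega>J\<Omega>, of lebesgue] e\<Omega> by (auto intro: order.trans)
    qed simp
    also have "\<dots> = ennreal (real (2 * a + 1) ^ d * (5 * F / l))"
      using F0 l by (intro ennreal_mult[symmetric]) auto
    finally show ?thesis by (simp add: ac_simps)
  qed
  have Tbm [measurable]: "T (b p) \<in> borel_measurable lebesgue" for p
    by (rule L2_space_measurable[OF op_L2[OF T test_function_L2[OF nb]]])
  have Tgm [measurable]: "T g \<in> borel_measurable lebesgue"
    by (rule L2_space_measurable[OF op_L2[OF T test_function_L2[OF ng]]])
  have Tfm [measurable]: "T f \<in> borel_measurable lebesgue"
    by (rule L2_space_measurable[OF op_L2[OF T test_function_L2[OF f]]])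
  \<comment> \<open>Each \<open>T (b p)\<close> is counted off the dilate of its own cube, where
    \<open>bad_part\<close> controls it. The dilates themselves are discarded through
    \<open>D\<close>.\<close>
  define H where "H x = (\<Sum>p\<in>J. ennreal (cmod (T (b p) x)) * indicator (- dilate 0 L a p) x)" for x
  have Hint: "(\<integral>\<^sup>+x. H x \<partial>lebesgue) \<le> ennreal (2 * Cb * F)"
  proof -
    have "(\<integral>\<^sup>+x. H x \<partial>lebesgue) = (\<Sum>p\<in>J. (\<integral>\<^sup>+x. ennreal (cmod (T (b p) x)) * indicator (- dilate 0 L a p) x \<partial>lebesgue))"
      unfolding H_def by (intro nn_integral_sum) measurable
    also have "\<dots> \<le> (\<Sum>p\<in>J. ennreal Cb * (2 * emeasure (modulus_measure f) (?C p)))"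
    proof (rule sum_mono)
      fix p
      have "(\<integral>\<^sup>+x. ennreal (cmod (T (b p) x)) * indicator (- dilate 0 L a p) x \<partial>lebesgue) \<le>
          ennreal Cb * (\<integral>\<^sup>+y. ennreal (cmod (b p y)) \<partial>lebesgue)"
        unfolding Cb_def a_def by (rule bad_part[OF \<alpha> K TK L nb suppb mean])
      also have "\<dots> \<le> ennreal Cb * (2 * emeasure (modulus_measure f) (?C p))"
        by (intro mult_left_mono b1) auto
      finally show "(\<integral>\<^sup>+x. ennreal (cmod (T (b p) x)) * indicator (- dilate 0 L a p) x \<partial>lebesgue) \<le>
         ennreal Cb * (2 * emeasure (modulus_measure f) (?C p))" .
    qed
    also have "\<dots> = ennreal Cb * (2 * emeasure (modulus_measure f) \<Omega>J)"
      unfolding sum_distrib_left[symmetric] \<Omega>J_def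
      using J Cm disj by (subst sum_emeasure_modulus) (auto intro: disjoint_family_on_mono)
    also have "\<dots> \<le> ennreal Cb * (2 * ennreal F)"
      using emeasure_modulus_measure_le[OF f, of \<Omega>J] by (intro mult_left_mono) (auto simp: F_def)
    also have "\<dots> = ennreal (2 * Cb * F)"
      using Cb F0 by (simp add: ennreal_mult ac_simps)
    finally show ?thesis .
  qed
  define E1 where "E1 = {x. l / 2 < cmod (T g x)}"
  define E3 where "E3 = {x. ennreal (l / 2) \<le> H x}"
  have Hm [measurable]: "H \<in> borel_measurable lebesgue" unfolding H_def by measurable
  have "{x \<in> space lebesgue. l / 2 < cmod (T g x)} \<in> sets lebesgue" by measurable
  then have E1m: "E1 \<in> sets lebesgue" unfolding E1_def by simp
  have "{x \<in> space lebesgue. ennreal (l / 2) \<le> H x} \<in> sets lebesgue" by measurable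
  then have E3m: "E3 \<in> sets lebesgue" unfolding E3_def by simp
  have E1: "?e E1 \<le> ennreal (4 * B\<^sup>2 * (2 + 5 * 4 ^ d) * F / l)"
  proof -
    have "?e E1 \<le> ennreal (1 / (l / 2)\<^sup>2) * (\<integral>\<^sup>+x. ennreal ((cmod (T g x))\<^sup>2) \<partial>lebesgue)"
    proof (rule emeasure_le_nn_integral[OF E1m])
      fix x assume "x \<in> E1"
      then show "ennreal ((l / 2)\<^sup>2) \<le> ennreal ((cmod (T g x))\<^sup>2)"
        using l by (intro ennreal_leI power_mono) (auto simp: E1_def)
    qed (use l in simp)
    also have "\<dots> \<le> ennreal (1 / (l / 2)\<^sup>2) * (ennreal (B\<^sup>2) * (\<integral>\<^sup>+x. ennreal ((cmod (g x))\<^sup>2) \<partial>lebesgue))"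
      unfolding B_def by (intro mult_left_mono nn_integral_op_le[OF T test_function_L2[OF ng]]) auto
    also have "\<dots> \<le> ennreal (1 / (l / 2)\<^sup>2) * (ennreal (B\<^sup>2) * ennreal ((2 + 5 * 4 ^ d) * l * F))"
      by (intro mult_left_mono g2) auto
    also have "\<dots> = ennreal (1 / (l / 2)\<^sup>2 * (B\<^sup>2 * ((2 + 5 * 4 ^ d) * l * F)))"
      by (subst ennreal_mult'[symmetric], simp, rule ennreal_mult'[symmetric], simp)
    also have "1 / (l / 2)\<^sup>2 * (B\<^sup>2 * ((2 + 5 * 4 ^ d) * l * F)) = 4 * B\<^sup>2 * (2 + 5 * 4 ^ d) * F / l"
      using l by (simp add: power2_eq_square field_simps)
    finally show ?thesis .
  qed
  have E3: "?e E3 \<le> ennreal (4 * Cb * F / l)"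
  proof -
    have "?e E3 \<le> ennreal (1 / (l / 2)) * (\<integral>\<^sup>+x. H x \<partial>lebesgue)"
      using l by (intro emeasure_le_nn_integral[OF E3m]) (auto simp: E3_def)
    also have "\<dots> \<le> ennreal (1 / (l / 2)) * ennreal (2 * Cb * F)"
      by (intro mult_left_mono Hint) auto
    also have "\<dots> = ennreal (1 / (l / 2) * (2 * Cb * F))"
      using l Cb F0 by (intro ennreal_mult[symmetric]) auto
    finally show ?thesis using l by (simp add: field_simps)
  qed
  have "AE x in lebesgue. T g x = T f x - T (\<lambda>x. \<Sum>p\<in>J. b p x) x"
    unfolding g_def by (rule op_diff[OF T test_function_L2[OF f] test_function_L2[OF nsum]])
  moreover have "AE x in lebesgue. T (\<lambda>x. \<Sum>p\<in>J. b p x) x = (\<Sum>p\<in>J. T (b p) x)"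
    by (rule op_sum[OF T J(1) test_function_L2[OF nb]])
  ultimately have "AE x in lebesgue. x \<in> {x. l < cmod (T f x)} \<longrightarrow> x \<in> E1 \<union> D \<union> E3"
  proof eventually_elim
    case (elim x)
    show ?case
    proof (intro impI, rule ccontr)
      assume x: "x \<in> {x. l < cmod (T f x)}" "x \<notin> E1 \<union> D \<union> E3"
      then have 1: "cmod (T g x) \<le> l / 2" and xD: "x \<notin> D" and 3: "H x < ennreal (l / 2)"
        by (auto simp: E1_def E3_def not_less not_le)
      have "H x = (\<Sum>p\<in>J. ennreal (cmod (T (b p) x)))"
        unfolding H_def using xD by (intro sum.cong) (auto simp: D_def)
      also have "\<dots> = ennreal (\<Sum>p\<in>J. cmod (T (b p) x))" by (intro sum_ennreal) auto
      finally have "(\<Sum>p\<in>J. cmod (T (b p) x)) < l / 2"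
        using 3 by (simp add: ennreal_less_iff sum_nonneg)
      then have "cmod (\<Sum>p\<in>J. T (b p) x) < l / 2"
        using norm_sum[of "\<lambda>p. T (b p) x" J] by linarith
      moreover have "T f x = T g x + (\<Sum>p\<in>J. T (b p) x)" using elim by simp
      ultimately have "cmod (T f x) < l" using 1 norm_triangle_ineq[of "T g x" "\<Sum>p\<in>J. T (b p) x"] by simp
      then show False using x by simp
    qed
  qed
  then have "?e {x. l < cmod (T f x)} \<le> ?e (E1 \<union> D \<union> E3)"
    using E1m E3m by (intro emeasure_mono_AE) auto
  also have "\<dots> \<le> ?e E1 + ?e D + ?e E3"
    using E1m E3m by (intro order.trans[OF emeasure_subadditive] add_right_mono emeasure_subadditive) auto
  also have "\<dots> \<le> ennreal (4 * B\<^sup>2 * (2 + 5 * 4 ^ d) * F / l) + ennreal (5 * real (2 * a + 1) ^ d * F / l) + ennreal (4 * Cb * F / l)"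
    by (intro add_mono E1 eD E3)
  also have "\<dots> = ennreal (4 * B\<^sup>2 * (2 + 5 * 4 ^ d) * F / l + 5 * real (2 * a + 1) ^ d * F / l + 4 * Cb * F / l)"
  proof -
    have "0 \<le> 4 * B\<^sup>2 * (2 + 5 * 4 ^ d) * F / l" "0 \<le> 5 * real (2 * a + 1) ^ d * F / l" "0 \<le> 4 * Cb * F / l"
      using F0 l Cb by auto
    then show ?thesis by (simp only: ennreal_plus add_nonneg_nonneg)
  qed
  also have "4 * B\<^sup>2 * (2 + 5 * 4 ^ d) * F / l + 5 * real (2 * a + 1) ^ d * F / l + 4 * Cb * F / l = weak_const CARD('n) Ccz \<alpha> (L2_opnorm lebesgue T) * F / l"
    unfolding weak_const_def B_def Cb_def a_def d_def by (simp only: add_divide_distrib distrib_right)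
  finally show ?thesis by (simp add: F_def)
qed

text \<open>When the integral vanishes there is no positive room for an open superset, but then
  \<open>f\<close> and with it \<open>T f\<close> vanish almost everywhere.\<close>

lemma weak_type:
  assumes f: "test_function f" and l: "0 < l"
  shows "emeasure lebesgue {x. l < cmod (T f x)} \<le> ennreal (weak_const CARD('n) Ccz \<alpha> (L2_opnorm lebesgue T) * (LINT x|lebesgue. cmod (f x)) / l)"
proof (cases "(LINT x|lebesgue. cmod (f x)) = 0")
  case True
  then have "AE x in lebesgue. f x = 0"
    using test_function_integrable[OF f] by (subst (asm) integral_nonneg_eq_0_iff_AE) auto
  then have "AE x in lebesgue. T f x = 0" by (rule op_zero_AE[OF T test_function_L2[OF f]])
  then have "AE x in lebesgue. \<not> l < cmod (T f x)"
    by eventually_elim (use l in auto)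
  then have "emeasure lebesgue {x \<in> space lebesgue. l < cmod (T f x)} = 0" by (rule emeasure_eq_0_AE)
  then show ?thesis by simp
next
  case False
  moreover have "0 \<le> (LINT x|lebesgue. cmod (f x))" by simp
  ultimately show ?thesis using weak_type_pos[OF f l] by linarith
qed

lemma weak_const_nonneg: "0 \<le> weak_const CARD('n) Ccz \<alpha> (L2_opnorm lebesgue T)"
  unfolding weak_const_def using bad_const_nonneg by simp

end

section \<open>The stopping cubes\<close>

definition avg :: "(real^'n \<Rightarrow> complex) \<Rightarrow> real \<Rightarrow> nat \<Rightarrow> 'n dyadic_index \<Rightarrow> real" where
  "avg f L a p = measure (modulus_measure f) (dilate 0 L a p) / measure lebesgue (dilate 0 L a p)"

lemma avg_nonneg [simp]: "0 \<le> avg f L a p"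
  by (simp add: avg_def)

lemma emeasure_dilate_measure:
  assumes "0 < L"
  shows "emeasure lebesgue (dilate v L a p) = ennreal (measure lebesgue (dilate v L a p))"
    "0 < measure lebesgue (dilate v L a p)"
  using emeasure_dilate_pos[OF assms, of v a p] emeasure_dilate_finite[OF assms, of v a p]
  by (auto simp: measure_def enn2real_positive_iff less_top[symmetric])

lemma measure_dilate_dcube:
  fixes v :: "real^'n"
  assumes "0 < L"
  shows "measure lebesgue (dilate v L a p) = real (2 * a + 1) ^ CARD('n) * measure lebesgue (dcube v L p)"
  using emeasure_dilate_dcube[OF assms, of v a p]
  by (simp add: measure_def enn2real_mult)

lemma emeasure_modulus_measure_avg:
  assumes "0 < L" "test_function f"
  shows "emeasure (modulus_measure f) (dilate 0 L a p) = ennreal (avg f L a p * measure lebesgue (dilate 0 L a p))"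
proof -
  have "emeasure (modulus_measure f) (dilate 0 L a p) < \<infinity>"
    using emeasure_modulus_measure_le[OF assms(2), of "dilate 0 L a p"] by (auto intro: le_less_trans)
  then show ?thesis using emeasure_dilate_measure(2)[OF assms(1), of 0 a p]
    by (simp add: avg_def measure_def)
qed

lemma LINT_restrict_to:
  assumes "test_function f" "A \<in> sets lebesgue"
  shows "ennreal (LINT x|lebesgue. cmod (restrict_to A f x)) = emeasure (modulus_measure f) A"
proof -
  have "ennreal (LINT x|lebesgue. cmod (restrict_to A f x)) = (\<integral>\<^sup>+x. ennreal (cmod (restrict_to A f x)) \<partial>lebesgue)"
    using test_function_integrable[OF test_function_restrict_to[OF assms]] by (intro nn_integral_eq_integral[symmetric]) auto
  also have "\<dots> = emeasure (modulus_measure f) A"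
    unfolding emeasure_modulus_measure[OF assms] by (intro nn_integral_cong) (auto simp: restrict_to_def indicator_def)
  finally show ?thesis .
qed

text \<open>With \<open>N = 4 d + 1\<close>, the height at which each exceptional set fills at most
  the fraction \<open>1 / 2 ^ (d + 4)\<close> of the cube. The weak type bound asks for
  \<open>weak_const * N ^ d\<close>, the dilated cubes of large average for
  \<open>N ^ (2 * d)\<close>; the factor \<open>weak_const + 1\<close> covers both.\<close>

definition stop_height :: "nat \<Rightarrow> real \<Rightarrow> real \<Rightarrow> real \<Rightarrow> real" where
  "stop_height d Ccz \<alpha> B = (weak_const d Ccz \<alpha> B + 1) * real (2 * (2 * d) + 1) ^ (2 * d) * 2 ^ (d + 4)"

text \<open>In units of the average over the dilate of the parent cube: at a good point of a
  stopping cube, the bounds for \<open>T\<close> of \<open>f\<close> restricted to the dilate of the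
  parent and to that of the stopping cube itself, then the oscillation over the stopping cube of
  what separates them.\<close>

definition stop_const :: "nat \<Rightarrow> real \<Rightarrow> real \<Rightarrow> real \<Rightarrow> real" where
  "stop_const d Ccz \<alpha> B = stop_height d Ccz \<alpha> B + (stop_height d Ccz \<alpha> B)\<^sup>2
     + Ccz * 5 ^ d / (1 - 2 powr - \<alpha>) * stop_height d Ccz \<alpha> B"

context
  fixes Ccz \<alpha> :: real and K :: "real^'n \<Rightarrow> real^'n \<Rightarrow> complex" and T
  assumes \<alpha>: "0 < \<alpha>" and K: "CZ_kernel Ccz \<alpha> K"
    and T: "L2_bounded_operator lebesgue T" and TK: "has_kernel T K"
begin

lemma stop_height_ge:
  "1 \<le> stop_height CARD('n) Ccz \<alpha> (L2_opnorm lebesgue T)"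
  "weak_const CARD('n) Ccz \<alpha> (L2_opnorm lebesgue T) * real (2 * (2 * CARD('n)) + 1) ^ CARD('n) * 2 ^ (CARD('n) + 4) \<le> stop_height CARD('n) Ccz \<alpha> (L2_opnorm lebesgue T)"
  "real (2 * (2 * CARD('n)) + 1) ^ (2 * CARD('n)) * 2 ^ (CARD('n) + 4) \<le> stop_height CARD('n) Ccz \<alpha> (L2_opnorm lebesgue T)"
proof -
  define W N c where "W = weak_const CARD('n) Ccz \<alpha> (L2_opnorm lebesgue T)" and "N = real (2 * (2 * CARD('n)) + 1)" and "c = (2::real) ^ (CARD('n) + 4)"
  have W: "0 \<le> W" unfolding W_def by (rule weak_const_nonneg[OF \<alpha> K T TK])
  have N: "1 \<le> N ^ CARD('n)" "N ^ CARD('n) \<le> N ^ (2 * CARD('n))"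
    unfolding N_def by (auto intro!: one_le_power power_increasing)
  have c: "1 \<le> c" unfolding c_def by (rule one_le_power) simp
  have s: "stop_height CARD('n) Ccz \<alpha> (L2_opnorm lebesgue T) = (W + 1) * N ^ (2 * CARD('n)) * c" by (simp add: stop_height_def W_def N_def c_def)
  have "1 * (N ^ (2 * CARD('n)) * c) \<le> (W + 1) * (N ^ (2 * CARD('n)) * c)"
    using W N c by (intro mult_right_mono) auto
  then show 3: "N ^ (2 * CARD('n)) * c \<le> stop_height CARD('n) Ccz \<alpha> (L2_opnorm lebesgue T)" by (simp add: s mult.assoc)
  have "1 * 1 \<le> N ^ (2 * CARD('n)) * c" using N c by (intro mult_mono) auto
  then show "1 \<le> stop_height CARD('n) Ccz \<alpha> (L2_opnorm lebesgue T)" using 3 by linarith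
  have "W * N ^ CARD('n) * c \<le> (W + 1) * N ^ (2 * CARD('n)) * c"
    using W N c by (intro mult_right_mono mult_mono) auto
  then show "W * N ^ CARD('n) * c \<le> stop_height CARD('n) Ccz \<alpha> (L2_opnorm lebesgue T)" by (simp add: s)
qed

lemma stop_const_nonneg: "0 \<le> stop_const CARD('n) Ccz \<alpha> (L2_opnorm lebesgue T)"
  unfolding stop_const_def using stop_height_ge(1) Ccz_nonneg[OF \<alpha> K] \<alpha>
  by (auto intro!: add_nonneg_nonneg mult_nonneg_nonneg divide_nonneg_nonneg simp: powr_less_one less_imp_le)

text \<open>
  In the next proof \<open>E\<close> is the set where \<open>T\<close> is large, and \<open>H\<close> is the set where the maximal function is
  large, enlarged so that it contains every dyadic cube whose dilate has a large average. A cube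
  that is at most half filled by \<open>U = G \<union> H\<close> then contains a point \<open>x'\<close> at which all local quantities are
  controlled, and the smoothness of the kernel carries the control to the whole cube.
\<close>

lemma stop_step_pos:
  assumes f: "test_function f" and L: "0 < L" and V0: "0 < avg f L (2 * CARD('n)) p"
  shows "\<exists>P. (\<forall>q\<in>P. dcube 0 L q \<subseteq> dcube 0 L p) \<and> disjoint_family_on (dcube 0 L) P \<and>
    emeasure lebesgue (\<Union>q\<in>P. dcube 0 L q) \<le> ennreal (1/2) * emeasure lebesgue (dcube 0 L p) \<and>
    (AE x in lebesgue. (x \<in> dcube 0 L p - (\<Union>q\<in>P. dcube 0 L q) \<longrightarrow>
         cmod (T (restrict_to (dilate 0 L (2 * CARD('n)) p) f) x) \<le> stop_const CARD('n) Ccz \<alpha> (L2_opnorm lebesgue T) * avg f L (2 * CARD('n)) p) \<and>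
       (\<forall>q\<in>P. x \<in> dcube 0 L q \<longrightarrow> cmod (T (restrict_to (dilate 0 L (2 * CARD('n)) p) f) x) \<le>
          stop_const CARD('n) Ccz \<alpha> (L2_opnorm lebesgue T) * avg f L (2 * CARD('n)) p + cmod (T (restrict_to (dilate 0 L (2 * CARD('n)) q) f) x)))"
proof -
  define a where "a = 2 * CARD('n)"
  define d where "d = CARD('n)"
  define N where "N = real (2 * a + 1)"
  define V where "V = avg f L a p"
  define A where "A = stop_height CARD('n) Ccz \<alpha> (L2_opnorm lebesgue T)"
  define W where "W = weak_const CARD('n) Ccz \<alpha> (L2_opnorm lebesgue T)"
  \<comment> \<open>The budget in terms of \<open>\<theta> = 8 * \<kappa>\<close>: the open superset
    \<open>G\<close> costs \<open>2 * \<kappa>\<close> and \<open>H\<close> costs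
    \<open>\<kappa>\<close>, together at most \<open>\<theta> / 2\<close>. Moreover
    \<open>1/2 + \<kappa> < 1\<close>, which is needed to find a good point.\<close>
  define \<kappa> where "\<kappa> = 1 / (2::real) ^ (d + 4)"
  let ?C = "dcube (0::real^'n) L" and ?D = "dilate (0::real^'n) L a"
  let ?e = "emeasure (lebesgue :: (real^'n) measure)"
  define m where "m r = measure lebesgue (?C r)" for r
  have V: "0 < V" using V0 by (simp add: V_def a_def)
  have A1: "1 \<le> A" unfolding A_def by (rule stop_height_ge)
  have W0: "0 \<le> W" unfolding W_def by (rule weak_const_nonneg[OF \<alpha> K T TK])
  have AW: "W * N ^ d / A \<le> \<kappa>" using stop_height_ge(2) A1
    by (simp add: A_def W_def N_def d_def a_def \<kappa>_def field_simps)
  have NN: "N ^ d * N ^ d = N ^ (2 * d)" by (simp add: power_add[symmetric] mult_2)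
  have AN: "N ^ d * N ^ d / A \<le> \<kappa>" using stop_height_ge(3) A1
    unfolding NN by (simp add: A_def N_def d_def a_def \<kappa>_def field_simps)
  have \<kappa>: "0 < \<kappa>" "\<kappa> < 1/2"
  proof -
    have "1 / (2::real) ^ (d + 4) \<le> 1 / 2 ^ 4"
      by (intro divide_left_mono power_increasing) auto
    then show "0 < \<kappa>" "\<kappa> < 1/2" by (simp_all add: \<kappa>_def)
  qed
  have N1: "1 \<le> N" by (simp add: N_def)
  have eC: "?e (?C r) = ennreal (m r)" "0 < m r" for r
    using emeasure_dilate_measure[OF L, of 0 0 r] by (simp_all add: m_def)
  have mD: "measure lebesgue (?D r) = N ^ d * m r" for r
    using measure_dilate_dcube[OF L, of 0 a r] by (simp add: m_def N_def d_def)
  have eD: "?e (?D r) = ennreal (N ^ d * m r)" for r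
    using emeasure_dilate_measure(1)[OF L, of 0 a r] by (simp add: mD)
  have Cm: "?C r \<in> sets lebesgue" for r by measurable
  have Dm: "?D r \<in> sets lebesgue" for r by measurable
  define F1 where "F1 = restrict_to (?D p) f"
  have nF1: "test_function F1" unfolding F1_def by (rule test_function_restrict_to[OF f Dm])
  have muF1: "emeasure (modulus_measure F1) B \<le> ennreal (V * N ^ d * m p)" for B
  proof -
    have "emeasure (modulus_measure F1) B \<le> ennreal (LINT x|lebesgue. cmod (F1 x))" by (rule emeasure_modulus_measure_le[OF nF1])
    also have "\<dots> = emeasure (modulus_measure f) (?D p)" unfolding F1_def by (rule LINT_restrict_to[OF f Dm])
    also have "\<dots> = ennreal (V * N ^ d * m p)"
      using emeasure_modulus_measure_avg[OF L f, of a p] by (simp add: mD V_def mult.assoc)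
    finally show ?thesis .
  qed
  have LF1: "(LINT x|lebesgue. cmod (F1 x)) = V * N ^ d * m p"
  proof -
    have "ennreal (LINT x|lebesgue. cmod (F1 x)) = ennreal (V * N ^ d * m p)"
      unfolding F1_def LINT_restrict_to[OF f Dm] using emeasure_modulus_measure_avg[OF L f, of a p] by (simp add: mD V_def mult.assoc)
    then show ?thesis using V N1 eC(2)[of p] by (subst (asm) ennreal_inj) auto
  qed
  have TFm: "T g \<in> borel_measurable lebesgue" if "test_function g" for g
    by (rule L2_space_measurable[OF op_L2[OF T test_function_L2[OF that]]])
  have bigm: "{x. c < cmod (T g x)} \<in> sets lebesgue" if "test_function g" for g c
  proof -
    have [measurable]: "T g \<in> borel_measurable lebesgue" by (rule TFm[OF that])
    have "{x \<in> space lebesgue. c < cmod (T g x)} \<in> sets lebesgue" by measurable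
    then show ?thesis by simp
  qed
  define E where "E = {x. A * V < cmod (T F1 x)}"
  have Em: "E \<in> sets lebesgue" unfolding E_def by (rule bigm[OF nF1])
  have eE: "?e E \<le> ennreal (\<kappa> * m p)"
  proof -
    have "?e E \<le> ennreal (W * (LINT x|lebesgue. cmod (F1 x)) / (A * V))"
      unfolding E_def W_def using A1 V by (intro weak_type[OF \<alpha> K T TK nF1]) auto
    also have "W * (LINT x|lebesgue. cmod (F1 x)) / (A * V) = (W * N ^ d / A) * m p"
      using V A1 by (simp add: LF1 field_simps)
    also have "ennreal \<dots> \<le> ennreal (\<kappa> * m p)"
      using AW eC(2)[of p] by (intro ennreal_leI mult_right_mono) auto
    finally show ?thesis .
  qed
  obtain G where G: "open G" "E \<subseteq> G" "?e G \<le> ennreal (2 * (\<kappa> * m p))"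
    using open_superset_lebesgue[OF Em eE] \<kappa> eC(2)[of p] by (metis mult_pos_pos)
  have Gm: "G \<in> sets lebesgue" using G(1) by (intro sets_borel_lebesgue) auto
  define SR where "SR = {r. fst p \<le> fst r \<and> ennreal (A * V) * ?e (?C r) < emeasure (modulus_measure F1) (?C r)}"
  define MR where "MR = maximal 0 L SR"
  define H where "H = (\<Union>r\<in>MR. ?D r)"
  have Hm: "H \<in> sets lebesgue" unfolding H_def by (intro sets.countable_UN'') auto
  \<comment> \<open>Two factors \<open>N ^ d\<close> meet here: one is the volume of the dilate of
    \<open>p\<close>, over which the mass of \<open>F1\<close> is averaged, the other comes from
    dilating the maximal cubes.\<close>
  have eH: "?e H \<le> ennreal (\<kappa> * m p)"
  proof -
    have "?e H \<le> ennreal (N ^ d / (A * V)) * emeasure (modulus_measure F1) (\<Union>r\<in>MR. ?C r)"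
      unfolding H_def
    proof (rule UN_emeasure_le)
      show "disjoint_family_on ?C MR" unfolding MR_def by (rule disjoint_maximal[OF L])
      fix r assume "r \<in> MR"
      then have "ennreal (A * V) * ?e (?C r) < emeasure (modulus_measure F1) (?C r)"
        using maximal_subset[of 0 L SR] by (auto simp: MR_def SR_def)
      then have "ennreal (N ^ d / (A * V)) * (ennreal (A * V) * ?e (?C r)) \<le> ennreal (N ^ d / (A * V)) * emeasure (modulus_measure F1) (?C r)"
        by (intro mult_left_mono) auto
      moreover have "ennreal (N ^ d / (A * V)) * (ennreal (A * V) * ?e (?C r)) = ?e (?D r)"
      proof -
        have "ennreal (N ^ d / (A * V)) * ennreal (A * V) = ennreal (N ^ d / (A * V) * (A * V))"
          using A1 V N1 by (intro ennreal_mult[symmetric]) auto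
        also have "N ^ d / (A * V) * (A * V) = N ^ d" using A1 V by simp
        finally show ?thesis
          using N1 eC(2)[of r] unfolding eC(1) eD by (simp add: mult.assoc[symmetric] ennreal_mult)
      qed
      ultimately show "?e (?D r) \<le> ennreal (N ^ d / (A * V)) * emeasure (modulus_measure F1) (?C r)" by simp
    qed auto
    also have "\<dots> \<le> ennreal (N ^ d / (A * V)) * ennreal (V * N ^ d * m p)"
      by (intro mult_left_mono muF1) auto
    also have "\<dots> = ennreal (N ^ d / (A * V) * (V * N ^ d * m p))"
      using A1 V N1 eC(2)[of p] by (intro ennreal_mult[symmetric]) auto
    also have "N ^ d / (A * V) * (V * N ^ d * m p) = (N ^ d * N ^ d / A) * m p"
      using V A1 by (simp add: field_simps)
    also have "ennreal \<dots> \<le> ennreal (\<kappa> * m p)"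
      using AN eC(2)[of p] by (intro ennreal_leI mult_right_mono) auto
    finally show ?thesis .
  qed
  define U where "U = G \<union> H"
  have Um [measurable]: "U \<in> sets lebesgue" unfolding U_def using Gm Hm by auto
  \<comment> \<open>A parent filled up to the fraction \<open>\<theta>\<close> leaves its child
    filled up to \<open>2 ^ d * \<theta> = 1/2\<close>.\<close>
  define \<theta> where "\<theta> = 1 / (2::real) ^ (d + 1)"
  have \<theta>: "0 < \<theta>" "\<theta> < 1"
  proof -
    have "\<theta> \<le> 1 / 2 ^ 1"
      unfolding \<theta>_def by (intro divide_left_mono power_increasing) auto
    then show "\<theta> < 1" by simp
    show "0 < \<theta>" by (simp add: \<theta>_def)
  qed
  have eU: "?e U \<le> ennreal (\<theta> / 2 * m p)"
  proof -
    have "?e U \<le> ?e G + ?e H" unfolding U_def by (rule emeasure_subadditive[OF Gm Hm])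
    also have "\<dots> \<le> ennreal (2 * (\<kappa> * m p)) + ennreal (\<kappa> * m p)" by (intro add_mono G eH)
    also have "\<dots> = ennreal (3 * \<kappa> * m p)"
      using \<kappa> eC(2)[of p] by (subst ennreal_plus[symmetric]) auto
    also have "\<dots> \<le> ennreal (\<theta> / 2 * m p)"
      using eC(2)[of p] by (intro ennreal_leI mult_right_mono) (auto simp: \<kappa>_def \<theta>_def power_add field_simps)
    finally show ?thesis .
  qed
  define S where "S = {q. fst p < fst q \<and> ?C q \<subseteq> ?C p \<and> ennreal \<theta> * ?e (?C q) < ?e (?C q \<inter> U)}"
  define P where "P = maximal 0 L S"
  have PS: "q \<in> S" if "q \<in> P" for q using that maximal_subset by (auto simp: P_def)
  have disj: "disjoint_family_on ?C P" unfolding P_def by (rule disjoint_maximal[OF L])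
  have Usub: "q \<in> S" if "fst p < fst q" "?C q \<subseteq> ?C p" "?C q \<subseteq> U" for q
  proof -
    have "?C q \<inter> U = ?C q" using that by auto
    moreover have "ennreal \<theta> * ?e (?C q) < ?e (?C q)"
      using \<theta> eC(2)[of q] unfolding eC(1) by (simp add: ennreal_mult[symmetric] ennreal_less_iff)
    ultimately show ?thesis using that by (simp add: S_def)
  qed
  have UNP: "(\<Union>q\<in>P. ?C q) = (\<Union>q\<in>S. ?C q)" unfolding P_def by (rule UN_maximal[OF L])
  have UNPm: "(\<Union>q\<in>P. ?C q) \<in> sets lebesgue" by (intro sets.countable_UN'') auto
  have size: "?e (\<Union>q\<in>P. ?C q) \<le> ennreal (1/2) * ?e (?C p)"
  proof -
    have dn: "emeasure (density lebesgue (indicator U)) B = ?e (U \<inter> B)" if "B \<in> sets lebesgue" for B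
      by (rule emeasure_restricted[OF Um that])
    have "?e (\<Union>q\<in>P. ?C q) \<le> ennreal (1 / \<theta>) * emeasure (density lebesgue (indicator U)) (\<Union>q\<in>P. ?C q)"
    proof (rule disjoint_UN_emeasure_le[OF _ disj])
      fix q assume "q \<in> P"
      then have "ennreal \<theta> * ?e (?C q) < ?e (?C q \<inter> U)" using PS by (auto simp: S_def)
      then have "ennreal (1 / \<theta>) * (ennreal \<theta> * ?e (?C q)) \<le> ennreal (1 / \<theta>) * ?e (U \<inter> ?C q)"
        by (intro mult_left_mono) (auto simp: Int_commute)
      then show "?e (?C q) \<le> ennreal (1 / \<theta>) * emeasure (density lebesgue (indicator U)) (?C q)"
        using \<theta> by (simp add: dn[OF Cm] mult.assoc[symmetric] ennreal_mult[symmetric])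
    qed auto
    also have "\<dots> \<le> ennreal (1 / \<theta>) * ?e U"
      unfolding dn[OF UNPm] by (intro mult_left_mono emeasure_mono) auto
    also have "\<dots> \<le> ennreal (1 / \<theta>) * ennreal (\<theta> / 2 * m p)" by (intro mult_left_mono eU) auto
    also have "\<dots> = ennreal (1 / \<theta> * (\<theta> / 2 * m p))"
      using \<theta> eC(2)[of p] by (intro ennreal_mult[symmetric]) auto
    also have "1 / \<theta> * (\<theta> / 2 * m p) = 1/2 * m p" using \<theta> by simp
    also have "ennreal (1/2 * m p) = ennreal (1/2) * ?e (?C p)"
      using eC(2)[of p] unfolding eC(1) by (intro ennreal_mult) auto
    finally show ?thesis .
  qed
  have half: "?e (?C q \<inter> U) \<le> ennreal (1/2 * m q)" if q: "q \<in> P" for q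
  proof -
    have qS: "fst p < fst q" "?C q \<subseteq> ?C p" using PS[OF q] by (auto simp: S_def)
    have par: "ancestor 1 q \<notin> S" using maximal_parent_notin[OF L q[unfolded P_def], of 1] qS by simp
    obtain x where x: "x \<in> ?C q" using dcube_nonempty[OF L] by blast
    have xp: "x \<in> ?C p" "x \<in> ?C (ancestor 1 q)" using x qS mem_dcube_ancestor[OF L x, of 1] by auto
    have m2: "m (ancestor 1 q) = 2 ^ d * m q"
    proof -
      have "?e (?C (ancestor 1 q)) = 2 ^ d * ?e (?C q)"
        using qS unfolding d_def by (intro emeasure_dilate_parent L) auto
      then have "ennreal (m (ancestor 1 q)) = ennreal (2 ^ d * m q)"
        unfolding eC(1) using eC(2)[of q] by (simp add: ennreal_mult ennreal_power[symmetric])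
      then show ?thesis using eC(2)[of q] eC(2)[of "ancestor 1 q"] by (subst (asm) ennreal_inj) auto
    qed
    \<comment> \<open>The parent may be \<open>p\<close> itself, which the strict level condition
      keeps out of \<open>S\<close>. In that case the bound on all of \<open>U\<close> takes
      over.\<close>
    have "?e (?C (ancestor 1 q) \<inter> U) \<le> ennreal (\<theta> * m (ancestor 1 q))"
    proof (cases "fst p < fst (ancestor 1 q)")
      case True
      then have "?C (ancestor 1 q) \<subseteq> ?C p" using dcube_nested[OF L xp] by simp
      then have "?e (?C (ancestor 1 q) \<inter> U) \<le> ennreal \<theta> * ?e (?C (ancestor 1 q))" using True par by (auto simp: S_def not_less)
      then show ?thesis using \<theta> eC(2)[of "ancestor 1 q"] by (simp add: eC(1) ennreal_mult)
    next
      case False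
      then have "fst (ancestor 1 q) = fst p" using qS by simp
      then have eq: "ancestor 1 q = p" using dcube_same_level[OF L xp(2,1)] by simp
      have "?e (?C (ancestor 1 q) \<inter> U) \<le> ?e U" by (intro emeasure_mono) auto
      also have "\<dots> \<le> ennreal (\<theta> / 2 * m p)" by (rule eU)
      also have "\<dots> \<le> ennreal (\<theta> * m p)" using \<theta> eC(2)[of p] by (intro ennreal_leI mult_right_mono) auto
      finally show ?thesis by (simp only: eq)
    qed
    note 0 = this
    have "?e (?C q \<inter> U) \<le> ?e (?C (ancestor 1 q) \<inter> U)"
      using dcube_ancestor_subset[OF L, of 1 q 0] qS by (intro emeasure_mono) auto
    note 1 = this
    have "\<theta> * m (ancestor 1 q) = 1/2 * m q" unfolding m2 by (simp add: \<theta>_def)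
    with 0 have "?e (?C (ancestor 1 q) \<inter> U) \<le> ennreal (1/2 * m q)" by (simp only:)
    with 1 show ?thesis by (rule order.trans)
  qed
  have ancs: "emeasure (modulus_measure F1) (?D (ancestor j q)) \<le> ennreal (A * V) * ?e (?D (ancestor j q))"
    if q: "q \<in> P" and j: "fst p + j \<le> fst q" for q j
  proof (rule ccontr)
    define r where "r = ancestor j q"
    assume "\<not> ?thesis"
    then have "\<not> emeasure (modulus_measure F1) (?D r) \<le> ennreal (A * V) * ?e (?D r)" by (simp add: r_def)
    \<comment> \<open>If the dilate of an ancestor \<open>r\<close> had a large average, so would a
      neighbour of \<open>r\<close>. The maximal cube above that neighbour has a dilate containing
      \<open>r\<close>, so \<open>r\<close> and with it \<open>q\<close> would lie in
      \<open>H\<close>, although \<open>q\<close> is at most half filled by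
      \<open>U\<close>.\<close>
    then obtain k where k: "\<forall>i. \<bar>k i - snd r i\<bar> \<le> int a"
       "\<not> emeasure (modulus_measure F1) (?C (fst r, k)) \<le> ennreal (A * V) * ?e (?C (fst r, k))"
      using emeasure_dilate_le_neighbours[OF L sets_modulus_measure, of r a F1 0 "ennreal (A * V)"] by blast
    then have "(fst r, k) \<in> SR" using j by (auto simp: SR_def r_def not_le)
    then obtain r' where r': "r' \<in> MR" "?C (fst r, k) \<subseteq> ?C r'"
      using ex_maximal[OF L, of _ SR 0] unfolding MR_def by blast
    have "?C r \<subseteq> ?D (fst r, k)" by (rule neighbour_subset_dilate(2)[OF L k(1)])
    also have "\<dots> \<subseteq> ?D r'" by (rule dilate_mono_dilate[OF L r'(2)])
    also have "\<dots> \<subseteq> U" using r'(1) by (auto simp: U_def H_def)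
    finally have "?C r \<subseteq> U" .
    then have "?C q \<subseteq> U" using dcube_ancestor_subset[OF L, of j q 0] j by (auto simp: r_def)
    then have "?C q \<inter> U = ?C q" by auto
    then have "ennreal (m q) \<le> ennreal (1/2 * m q)" using half[OF q] by (simp add: eC(1))
    then show False using eC(2)[of q] by (subst (asm) ennreal_le_iff) auto
  qed
  \<comment> \<open>A point of \<open>G\<close> in \<open>p\<close> has a proper subcube of
    \<open>p\<close> around it inside \<open>G\<close>, and such a cube belongs to \<open>S\<close>.
    Points not covered by \<open>P\<close> thus lie outside \<open>G\<close>, hence outside
    \<open>E\<close>.\<close>
  have off: "cmod (T F1 x) \<le> A * V" if x: "x \<in> ?C p" "x \<notin> (\<Union>q\<in>P. ?C q)" for x
  proof (rule ccontr)
    assume "\<not> ?thesis"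
    then have "x \<in> G" using G(2) by (auto simp: E_def)
    then obtain c where c: "Suc (fst p) \<le> fst c" "x \<in> ?C c" "?C c \<subseteq> G"
      using ex_small_dcube[OF L G(1)] by blast
    have "?C c \<subseteq> ?C p" using dcube_nested[OF L x(1) c(2)] c(1) by simp
    then have "c \<in> S" using c by (intro Usub) (auto simp: U_def)
    then show False using x c UNP by blast
  qed
  have offE: "cmod (T F1 x) \<le> A * V" if "x \<notin> U" for x
  proof (rule ccontr)
    assume "\<not> ?thesis"
    then have "x \<in> E" by (simp add: E_def)
    then show False using that G(2) by (auto simp: U_def)
  qed
  have on: "AE x in lebesgue. x \<in> ?C q \<longrightarrow> cmod (T F1 x) \<le> stop_const CARD('n) Ccz \<alpha> (L2_opnorm lebesgue T) * V + cmod (T (restrict_to (?D q) f) x)"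
    if q: "q \<in> P" for q
  proof -
    have qS: "fst p < fst q" "?C q \<subseteq> ?C p" using PS[OF q] by (auto simp: S_def)
    define F2 where "F2 = restrict_to (?D q) f"
    have nF2: "test_function F2" unfolding F2_def by (rule test_function_restrict_to[OF f Dm])
    have Dqp: "?D q \<subseteq> ?D p" by (rule dilate_mono_dilate[OF L qS(2)])
    \<comment> \<open>What separates \<open>T F1\<close> from \<open>T F2\<close> on
      \<open>q\<close>: it vanishes on the dilate of \<open>q\<close>, so \<open>T h\<close> is
      given there by the kernel.\<close>
    define h where "h = (\<lambda>x. F1 x - F2 x)"
    have nh: "test_function h" unfolding h_def by (rule test_function_diff[OF nF1 nF2])
    have h0: "h y = 0" if "y \<in> ?D q" for y using that Dqp by (auto simp: h_def F1_def F2_def restrict_to_def)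
    define J where "J = fst q - fst p"
    have J: "J \<le> fst q" by (simp add: J_def)
    have ancJ: "ancestor J q = p"
    proof -
      obtain x where x: "x \<in> ?C q" using dcube_nonempty[OF L] by blast
      then have "x \<in> ?C p" using qS by auto
      from dcube_ancestor_eq[OF L this x] show ?thesis using qS by (simp add: J_def)
    qed
    have hJ: "h y = 0" if "y \<notin> ?D (ancestor J q)" for y
      using that Dqp unfolding ancJ by (auto simp: h_def F1_def F2_def restrict_to_def)
    have hF1: "cmod (h y) \<le> cmod (F1 y)" for y
      using Dqp by (auto simp: h_def F1_def F2_def restrict_to_def)
    have hav: "(\<integral>\<^sup>+y. ennreal (cmod (h y)) * indicator (?D (ancestor j q)) y \<partial>lebesgue) \<le>
        ennreal (A * V) * ?e (?D (ancestor j q))" if "1 \<le> j" "j \<le> J" for j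
    proof -
      have "(\<integral>\<^sup>+y. ennreal (cmod (h y)) * indicator (?D (ancestor j q)) y \<partial>lebesgue) \<le>
          (\<integral>\<^sup>+y. ennreal (cmod (F1 y)) * indicator (?D (ancestor j q)) y \<partial>lebesgue)"
        by (intro nn_integral_mono mult_right_mono ennreal_leI hF1) auto
      also have "\<dots> = emeasure (modulus_measure F1) (?D (ancestor j q))" by (rule emeasure_modulus_measure[OF nF1 Dm, symmetric])
      also have "\<dots> \<le> ennreal (A * V) * ?e (?D (ancestor j q))"
        using that qS by (intro ancs[OF q]) (auto simp: J_def)
      finally show ?thesis .
    qed
    have "1 \<le> a" by (simp add: a_def Suc_le_eq)
    then have nsupp: "x \<notin> closed_support h" if "x \<in> ?C q" for x
      using dcube_notin_closed_support[OF L that, of h] h0 dcube_subset_dilate[OF L, of 1 a 0 q] by blast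
    have AE1: "AE x in lebesgue. T h x = T F1 x - T F2 x"
      unfolding h_def by (rule op_diff[OF T test_function_L2[OF nF1] test_function_L2[OF nF2]])
    have AE2: "AE x in lebesgue. x \<notin> closed_support h \<longrightarrow> T h x = (LINT y|lebesgue. K x y * h y)"
      using TK nh test_function_compact_support[OF nh] unfolding has_kernel_def test_function_def by blast
    \<comment> \<open>By \<open>ancs\<close> the average over the dilate of \<open>q\<close> is at
      most \<open>A * V\<close>. The height is again \<open>A\<close> times this, so the weak type
      bound yields the same fraction \<open>\<kappa>\<close>, now of \<open>q\<close>.\<close>
    define E2 where "E2 = {x. A\<^sup>2 * V < cmod (T F2 x)}"
    have E2m: "E2 \<in> sets lebesgue" unfolding E2_def by (rule bigm[OF nF2])
    have eE2: "?e E2 \<le> ennreal (\<kappa> * m q)"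
    proof -
      have "ennreal (LINT x|lebesgue. cmod (F2 x)) = emeasure (modulus_measure F1) (?D q)"
        unfolding F2_def LINT_restrict_to[OF f Dm] F1_def emeasure_modulus_measure_restrict_to[OF f Dm Dm]
        using Dqp by (simp add: Int_absorb1)
      also have "\<dots> \<le> ennreal (A * V) * ?e (?D q)"
        using ancs[OF q, of 0] qS by simp
      also have "\<dots> = ennreal (A * V * (N ^ d * m q))"
        unfolding eD using A1 V N1 eC(2)[of q] by (intro ennreal_mult[symmetric]) auto
      finally have le: "(LINT x|lebesgue. cmod (F2 x)) \<le> A * V * (N ^ d * m q)"
        using A1 V N1 eC(2)[of q] by (subst (asm) ennreal_le_iff) auto
      have "?e E2 \<le> ennreal (W * (LINT x|lebesgue. cmod (F2 x)) / (A\<^sup>2 * V))"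
        unfolding E2_def W_def using A1 V by (intro weak_type[OF \<alpha> K T TK nF2]) auto
      also have "\<dots> \<le> ennreal (W * (A * V * (N ^ d * m q)) / (A\<^sup>2 * V))"
        using W0 A1 V le by (intro ennreal_leI divide_right_mono mult_left_mono) auto
      also have "W * (A * V * (N ^ d * m q)) / (A\<^sup>2 * V) = (W * N ^ d / A) * m q"
        using A1 V by (simp add: power2_eq_square field_simps)
      also have "ennreal \<dots> \<le> ennreal (\<kappa> * m q)"
        using AW eC(2)[of q] by (intro ennreal_leI mult_right_mono) auto
      finally show ?thesis .
    qed
    \<comment> \<open>\<open>U\<close> takes at most half of \<open>q\<close> and \<open>E2\<close>
      less than the other half. What remains has positive measure, so it meets the set where both
      almost everywhere identities hold.\<close>
    have "\<exists>x'. x' \<in> ?C q \<and> x' \<notin> U \<and> x' \<notin> E2 \<and> T h x' = T F1 x' - T F2 x' \<and>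
       (x' \<notin> closed_support h \<longrightarrow> T h x' = (LINT y|lebesgue. K x' y * h y))"
    proof (rule ccontr)
      assume no: "\<not> ?thesis"
      from AE1 AE2 have "AE x in lebesgue. x \<in> ?C q \<longrightarrow> x \<in> (?C q \<inter> U) \<union> E2"
      proof eventually_elim
        case (elim x)
        then show ?case using no by blast
      qed
      then have "?e (?C q) \<le> ?e ((?C q \<inter> U) \<union> E2)"
        using E2m by (intro emeasure_mono_AE) auto
      also have "\<dots> \<le> ?e (?C q \<inter> U) + ?e E2" using E2m by (intro emeasure_subadditive) auto
      also have "\<dots> \<le> ennreal (1/2 * m q) + ennreal (\<kappa> * m q)" by (intro add_mono half[OF q] eE2)
      also have "\<dots> = ennreal ((1/2 + \<kappa>) * m q)"
        using \<kappa> eC(2)[of q] by (subst ennreal_plus[symmetric]) (auto simp: distrib_right)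
      finally have "m q \<le> (1/2 + \<kappa>) * m q"
        unfolding eC(1) using \<kappa> eC(2)[of q] by (subst (asm) ennreal_le_iff) auto
      then have "1 \<le> 1/2 + \<kappa>" using eC(2)[of q] by simp
      then show False using \<kappa> by simp
    qed
    then obtain x' where x': "x' \<in> ?C q" "x' \<notin> U" "x' \<notin> E2" "T h x' = T F1 x' - T F2 x'"
      "T h x' = (LINT y|lebesgue. K x' y * h y)" using nsupp by blast
    have b1: "cmod (T F1 x') \<le> A * V" by (rule offE[OF x'(2)])
    have b2: "cmod (T F2 x') \<le> A\<^sup>2 * V" using x'(3) by (simp add: E2_def)
    have b3: "cmod (T h x') \<le> A * V + A\<^sup>2 * V"
      unfolding x'(4) using norm_triangle_ineq4[of "T F1 x'" "T F2 x'"] b1 b2 by linarith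
    from AE1 AE2 show ?thesis
    proof eventually_elim
      case (elim x)
      show ?case
      proof
        assume x: "x \<in> ?C q"
        then have Thx: "T h x = (LINT y|lebesgue. K x y * h y)" using elim nsupp by blast
        have "cmod (T h x - T h x') \<le> Ccz * 5 ^ CARD('n) / (1 - 2 powr - \<alpha>) * (A * V)"
          unfolding Thx x'(5)
          using h0 hJ hav A1 V unfolding a_def
          by (intro oscillation[OF \<alpha> K L nh x x'(1) J]) auto
        then have "cmod (T h x) \<le> Ccz * 5 ^ CARD('n) / (1 - 2 powr - \<alpha>) * (A * V) + (A * V + A\<^sup>2 * V)"
          using b3 norm_triangle_ineq[of "T h x - T h x'" "T h x'"] by simp
        also have "\<dots> = stop_const CARD('n) Ccz \<alpha> (L2_opnorm lebesgue T) * V"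
          by (simp add: stop_const_def A_def algebra_simps)
        finally have "cmod (T h x) \<le> stop_const CARD('n) Ccz \<alpha> (L2_opnorm lebesgue T) * V" .
        moreover have "T F1 x = T h x + T F2 x" using elim by simp
        ultimately show "cmod (T F1 x) \<le> stop_const CARD('n) Ccz \<alpha> (L2_opnorm lebesgue T) * V + cmod (T (restrict_to (?D q) f) x)"
          using norm_triangle_ineq[of "T h x" "T F2 x"] by (simp add: F2_def)
      qed
    qed
  qed
  have AVs: "A * V \<le> stop_const CARD('n) Ccz \<alpha> (L2_opnorm lebesgue T) * V"
    using V A1 Ccz_nonneg[OF \<alpha> K] \<alpha> unfolding stop_const_def A_def[symmetric]
    by (intro mult_right_mono) (auto intro!: add_nonneg_nonneg simp: powr_less_one less_imp_le)
  have "AE x in lebesgue. \<forall>q\<in>P. x \<in> ?C q \<longrightarrow> cmod (T F1 x) \<le> stop_const CARD('n) Ccz \<alpha> (L2_opnorm lebesgue T) * V + cmod (T (restrict_to (?D q) f) x)"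
    using on by (subst AE_ball_countable) auto
  then have "AE x in lebesgue. (x \<in> ?C p - (\<Union>q\<in>P. ?C q) \<longrightarrow> cmod (T F1 x) \<le> stop_const CARD('n) Ccz \<alpha> (L2_opnorm lebesgue T) * V) \<and>
       (\<forall>q\<in>P. x \<in> ?C q \<longrightarrow> cmod (T F1 x) \<le> stop_const CARD('n) Ccz \<alpha> (L2_opnorm lebesgue T) * V + cmod (T (restrict_to (?D q) f) x))"
  proof eventually_elim
    case (elim x)
    then show ?case using off[of x] AVs by auto
  qed
  moreover have "\<forall>q\<in>P. ?C q \<subseteq> ?C p" using PS by (auto simp: S_def)
  ultimately show ?thesis
    using disj size unfolding F1_def V_def a_def by blast
qed

text \<open>A zero average leaves no positive height to stop at; then the restricted function
  vanishes almost everywhere, and the empty family serves.\<close>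

lemma stop_step:
  assumes f: "test_function f" and L: "0 < L"
  shows "\<exists>P. (\<forall>q\<in>P. dcube 0 L q \<subseteq> dcube 0 L p) \<and> disjoint_family_on (dcube 0 L) P \<and>
    emeasure lebesgue (\<Union>q\<in>P. dcube 0 L q) \<le> ennreal (1/2) * emeasure lebesgue (dcube 0 L p) \<and>
    (AE x in lebesgue. (x \<in> dcube 0 L p - (\<Union>q\<in>P. dcube 0 L q) \<longrightarrow>
         cmod (T (restrict_to (dilate 0 L (2 * CARD('n)) p) f) x) \<le> stop_const CARD('n) Ccz \<alpha> (L2_opnorm lebesgue T) * avg f L (2 * CARD('n)) p) \<and>
       (\<forall>q\<in>P. x \<in> dcube 0 L q \<longrightarrow> cmod (T (restrict_to (dilate 0 L (2 * CARD('n)) p) f) x) \<le>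
          stop_const CARD('n) Ccz \<alpha> (L2_opnorm lebesgue T) * avg f L (2 * CARD('n)) p + cmod (T (restrict_to (dilate 0 L (2 * CARD('n)) q) f) x)))"
proof (cases "avg f L (2 * CARD('n)) p = 0")
  case True
  define D where "D = dilate (0::real^'n) L (2 * CARD('n)) p"
  have D: "D \<in> sets lebesgue" by (simp add: D_def dilate_lebesgue)
  have "ennreal (LINT x|lebesgue. cmod (restrict_to D f x)) = 0"
    unfolding LINT_restrict_to[OF f D] using emeasure_modulus_measure_avg[OF L f] True by (simp add: D_def)
  then have "(LINT x|lebesgue. cmod (restrict_to D f x)) = 0"
    by (metis Bochner_Integration.integral_nonneg ennreal_eq_0_iff norm_ge_zero order_antisym)
  then have "AE x in lebesgue. restrict_to D f x = 0"
    using test_function_integrable[OF test_function_restrict_to[OF f D]] by (subst (asm) integral_nonneg_eq_0_iff_AE) auto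
  then have "AE x in lebesgue. T (restrict_to D f) x = 0"
    by (rule op_zero_AE[OF T test_function_L2[OF test_function_restrict_to[OF f D]]])
  then show ?thesis
    unfolding D_def by (intro exI[of _ "{}"]) (auto simp: True disjoint_family_on_def)
next
  case False
  then have "0 < avg f L (2 * CARD('n)) p" using avg_nonneg[of f L "2 * CARD('n)" p] by linarith
  then show ?thesis by (rule stop_step_pos[OF f L])
qed

end

section \<open>Sparse domination\<close>

lemma sum_le_nn_integral_count_space:
  fixes \<phi> :: "'i \<Rightarrow> ennreal"
  assumes "finite J" "J \<subseteq> S"
  shows "(\<Sum>s\<in>J. \<phi> s) \<le> (\<integral>\<^sup>+s. \<phi> s \<partial>count_space S)"
proof -
  have "(\<Sum>s\<in>J. \<phi> s) = (\<integral>\<^sup>+s. \<phi> s \<partial>count_space J)"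
    using assms by (simp add: nn_integral_count_space_finite)
  also have "\<dots> = (\<integral>\<^sup>+s. \<phi> s * indicator J s \<partial>count_space UNIV)"
    by (rule nn_integral_count_space_indicator) simp
  also have "\<dots> \<le> (\<integral>\<^sup>+s. \<phi> s * indicator S s \<partial>count_space UNIV)"
    using assms by (intro nn_integral_mono) (auto simp: indicator_def)
  also have "\<dots> = (\<integral>\<^sup>+s. \<phi> s \<partial>count_space S)"
    by (rule nn_integral_count_space_indicator[symmetric]) simp
  finally show ?thesis .
qed

text \<open>Reduces the sparse sum to finite subfamilies, for which the maximal functions are honest
  maxima.\<close>

lemma nn_integral_count_space_le:
  fixes \<phi> :: "'i::countable \<Rightarrow> ennreal"
  assumes "\<And>J. finite J \<Longrightarrow> J \<subseteq> S \<Longrightarrow> (\<Sum>s\<in>J. \<phi> s) \<le> X"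
  shows "(\<integral>\<^sup>+s. \<phi> s \<partial>count_space S) \<le> X"
proof -
  define J where "J n = {s \<in> S. to_nat s < n}" for n
  have fJ: "finite (J n)" for n
  proof -
    have "J n \<subseteq> from_nat ` {..<n}"
    proof
      fix i assume "i \<in> J n"
      then have "i = from_nat (to_nat i)" "to_nat i \<in> {..<n}" by (auto simp: J_def)
      then show "i \<in> from_nat ` {..<n}" by blast
    qed
    then show ?thesis by (rule finite_subset) auto
  qed
  have JS: "J n \<subseteq> S" for n by (auto simp: J_def)
  have sup: "\<phi> s * indicator S s = (SUP n. \<phi> s * indicator (J n) s)" for s
  proof (rule antisym)
    have "\<phi> s * indicator S s = \<phi> s * indicator (J (Suc (to_nat s))) s" by (simp add: J_def indicator_def)
    also have "\<dots> \<le> (SUP n. \<phi> s * indicator (J n) s)" by (rule SUP_upper) simp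
    finally show "\<phi> s * indicator S s \<le> (SUP n. \<phi> s * indicator (J n) s)" .
    show "(SUP n. \<phi> s * indicator (J n) s) \<le> \<phi> s * indicator S s"
      by (rule SUP_least) (auto simp: J_def indicator_def)
  qed
  have "(\<integral>\<^sup>+s. \<phi> s \<partial>count_space S) = (\<integral>\<^sup>+s. \<phi> s * indicator S s \<partial>count_space UNIV)"
    by (rule nn_integral_count_space_indicator) simp
  also have "\<dots> = (\<integral>\<^sup>+s. (SUP n. \<phi> s * indicator (J n) s) \<partial>count_space UNIV)" by (simp only: sup)
  also have "\<dots> = (SUP n. (\<integral>\<^sup>+s. \<phi> s * indicator (J n) s \<partial>count_space UNIV))"
    by (intro nn_integral_monotone_convergence_SUP) (auto simp: incseq_def le_fun_def J_def indicator_def)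
  also have "\<dots> \<le> X"
  proof (rule SUP_least)
    fix n
    have "(\<integral>\<^sup>+s. \<phi> s * indicator (J n) s \<partial>count_space UNIV) = (\<integral>\<^sup>+s. \<phi> s \<partial>count_space (J n))"
      by (rule nn_integral_count_space_indicator[symmetric]) simp
    also have "\<dots> = (\<Sum>s\<in>J n. \<phi> s)" using fJ by (simp add: nn_integral_count_space_finite)
    also have "\<dots> \<le> X" by (rule assms[OF fJ JS])
    finally show "(\<integral>\<^sup>+s. \<phi> s * indicator (J n) s \<partial>count_space UNIV) \<le> X" .
  qed
  finally show ?thesis .
qed

context
  fixes Ccz \<alpha> :: real and K :: "real^'n \<Rightarrow> real^'n \<Rightarrow> complex" and T
  assumes \<alpha>: "0 < \<alpha>" and K: "CZ_kernel Ccz \<alpha> K"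
    and T: "L2_bounded_operator lebesgue T" and TK: "has_kernel T K"
begin

text \<open>Iterate the stopping step from \<open>p0\<close>. What the next generation leaves of a
  cube is its set \<open>E\<close>, at least half of it. The generations shrink geometrically, so
  almost every point is eventually left uncovered; along the finite branch of cubes through it, each
  step adds one average.\<close>

lemma sparse_domination:
  assumes f: "test_function f" and L: "0 < L"
  shows "\<exists>(S :: (nat \<times> 'n dyadic_index) set) E. disjoint_family_on E S \<and>
    (\<forall>s\<in>S. E s \<in> sets lebesgue \<and> E s \<subseteq> dcube 0 L (snd s) \<and>
        emeasure lebesgue (dcube 0 L (snd s)) \<le> 2 * emeasure lebesgue (E s)) \<and>
    (AE x in lebesgue. x \<in> dcube 0 L p0 \<longrightarrow>
       ennreal (cmod (T (restrict_to (dilate 0 L (2 * CARD('n)) p0) f) x)) \<le>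
       (\<integral>\<^sup>+s. ennreal (stop_const CARD('n) Ccz \<alpha> (L2_opnorm lebesgue T) * avg f L (2 * CARD('n)) (snd s)) * indicator (dcube 0 L (snd s)) x \<partial>count_space S))"
proof -
  define a where "a = 2 * CARD('n)"
  define c where "c = stop_const CARD('n) Ccz \<alpha> (L2_opnorm lebesgue T)"
  let ?C = "dcube (0::real^'n) L" and ?D = "dilate (0::real^'n) L a"
  let ?e = "emeasure (lebesgue :: (real^'n) measure)"
  have c0: "0 \<le> c" unfolding c_def by (rule stop_const_nonneg[OF \<alpha> K T TK])
  define R where "R p P \<longleftrightarrow> (\<forall>q\<in>P. ?C q \<subseteq> ?C p) \<and> disjoint_family_on ?C P \<and>
    ?e (\<Union>q\<in>P. ?C q) \<le> ennreal (1/2) * ?e (?C p) \<and>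
    (AE x in lebesgue. (x \<in> ?C p - (\<Union>q\<in>P. ?C q) \<longrightarrow> cmod (T (restrict_to (?D p) f) x) \<le> c * avg f L a p) \<and>
       (\<forall>q\<in>P. x \<in> ?C q \<longrightarrow> cmod (T (restrict_to (?D p) f) x) \<le> c * avg f L a p + cmod (T (restrict_to (?D q) f) x)))" for p P
  have "\<exists>P. R p P" for p
    unfolding a_def c_def R_def by (rule stop_step[OF \<alpha> K T TK f L])
  then obtain stop where R: "\<And>p. R p (stop p)" by metis
  have stop:
    "\<And>p q. q \<in> stop p \<Longrightarrow> ?C q \<subseteq> ?C p"
    "\<And>p. disjoint_family_on ?C (stop p)"
    "\<And>p. ?e (\<Union>q\<in>stop p. ?C q) \<le> ennreal (1/2) * ?e (?C p)"
    "\<And>p. AE x in lebesgue. (x \<in> ?C p - (\<Union>q\<in>stop p. ?C q) \<longrightarrow> cmod (T (restrict_to (?D p) f) x) \<le> c * avg f L a p) \<and>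
       (\<forall>q\<in>stop p. x \<in> ?C q \<longrightarrow> cmod (T (restrict_to (?D p) f) x) \<le> c * avg f L a p + cmod (T (restrict_to (?D q) f) x))"
    using R unfolding R_def by blast+
  define gen where "gen = rec_nat {p0} (\<lambda>_ G. \<Union>p\<in>G. stop p)"
  have gen0: "gen 0 = {p0}" and genS: "gen (Suc n) = (\<Union>p\<in>gen n. stop p)" for n
    by (simp_all add: gen_def)
  define \<Omega> where "\<Omega> n = (\<Union>p\<in>gen n. ?C p)" for n
  have Cm: "?C r \<in> sets lebesgue" for r by measurable
  have \<Omega>m [measurable]: "\<Omega> n \<in> sets lebesgue" for n unfolding \<Omega>_def by (intro sets.countable_UN'') auto
  have \<Omega>S: "\<Omega> (Suc n) \<subseteq> \<Omega> n" for n using stop(1) by (fastforce simp: \<Omega>_def genS)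
  have \<Omega>mono: "\<Omega> n \<subseteq> \<Omega> k" if "k \<le> n" for k n
    using that \<Omega>S by (rule lift_Suc_antimono_le[rotated])
  have gdisj: "disjoint_family_on ?C (gen n)" for n
  proof (induction n)
    case 0
    then show ?case by (simp add: gen0 disjoint_family_on_def)
  next
    case (Suc n)
    show ?case
      unfolding disjoint_family_on_def
    proof (intro ballI impI)
      fix q q' assume "q \<in> gen (Suc n)" "q' \<in> gen (Suc n)" and ne: "q \<noteq> q'"
      then obtain p p' where p: "p \<in> gen n" "q \<in> stop p" "p' \<in> gen n" "q' \<in> stop p'" by (auto simp: genS)
      show "?C q \<inter> ?C q' = {}"
      proof (cases "p = p'")
        case True
        then show ?thesis using stop(2)[of p] p ne by (auto simp: disjoint_family_on_def)
      next
        case False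
        then have "?C p \<inter> ?C p' = {}" using Suc p by (auto simp: disjoint_family_on_def)
        then show ?thesis using stop(1)[OF p(2)] stop(1)[OF p(4)] by blast
      qed
    qed
  qed
  have \<Omega>half: "?e (\<Omega> (Suc n)) \<le> ennreal (1/2) * ?e (\<Omega> n)" for n
  proof -
    have "\<Omega> (Suc n) = (\<Union>p\<in>gen n. \<Union>q\<in>stop p. ?C q)" by (auto simp: \<Omega>_def genS)
    moreover have "?e (\<Union>p\<in>gen n. \<Union>q\<in>stop p. ?C q) \<le> ennreal (1/2) * ?e (\<Union>p\<in>gen n. ?C p)"
    proof (rule UN_emeasure_le[OF _ gdisj])
      show "?e (\<Union>q\<in>stop p. ?C q) \<le> ennreal (1/2) * ?e (?C p)" for p by (rule stop(3))
    qed (auto intro!: sets.countable_UN'')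
    ultimately show ?thesis by (simp add: \<Omega>_def)
  qed
  have \<Omega>pow: "?e (\<Omega> n) \<le> ennreal ((1/2) ^ n * measure lebesgue (?C p0))" for n
  proof (induction n)
    case 0
    then show ?case using emeasure_dilate_measure(1)[OF L, of 0 0 p0] by (simp add: \<Omega>_def gen0)
  next
    case (Suc n)
    have "?e (\<Omega> (Suc n)) \<le> ennreal (1/2) * ?e (\<Omega> n)" by (rule \<Omega>half)
    also have "\<dots> \<le> ennreal (1/2) * ennreal ((1/2) ^ n * measure lebesgue (?C p0))"
      by (intro mult_left_mono Suc) auto
    also have "\<dots> = ennreal (1/2 * ((1/2) ^ n * measure lebesgue (?C p0)))"
      by (intro ennreal_mult[symmetric]) auto
    finally show ?case by (simp add: mult.assoc)
  qed
  have null: "?e (\<Inter>n. \<Omega> n) = 0"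
  proof -
    have "(\<lambda>n. (1/2) ^ n * measure lebesgue (?C p0)) \<longlonglongrightarrow> 0 * measure lebesgue (?C p0)"
      by (intro tendsto_mult LIMSEQ_power_zero tendsto_const) auto
    then have "(\<lambda>n. ennreal ((1/2) ^ n * measure lebesgue (?C p0))) \<longlonglongrightarrow> ennreal 0"
      by (intro tendsto_ennrealI) simp
    moreover have "?e (\<Inter>n. \<Omega> n) \<le> ennreal ((1/2) ^ n * measure lebesgue (?C p0))" for n
      using \<Omega>pow[of n] emeasure_mono[of "\<Inter>n. \<Omega> n" "\<Omega> n" lebesgue] by (auto intro: order.trans)
    ultimately have "?e (\<Inter>n. \<Omega> n) \<le> ennreal 0" by (intro LIMSEQ_le_const) auto
    then show ?thesis by simp
  qed
  then have AEnull: "AE x in lebesgue. x \<notin> (\<Inter>n. \<Omega> n)"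
    by (intro AE_not_in) (auto simp: null_sets_def)
  \<comment> \<open>The generation is part of the index. Distinctness along a branch and between the
    sets \<open>E\<close> is then visible from the first component, without comparing cubes of
    different generations.\<close>
  define S where "S = {s. snd s \<in> gen (fst s)}"
  define E where "E s = ?C (snd s) - \<Omega> (Suc (fst s))" for s
  have Em: "E s \<in> sets lebesgue" for s unfolding E_def using Cm \<Omega>m by blast
  have E2: "?e (?C (snd s)) \<le> 2 * ?e (E s)" if s: "s \<in> S" for s
  proof -
    have p: "snd s \<in> gen (fst s)" using s by (simp add: S_def)
    have "?C (snd s) \<inter> \<Omega> (Suc (fst s)) \<subseteq> (\<Union>q\<in>stop (snd s). ?C q)"
    proof
      fix x assume x: "x \<in> ?C (snd s) \<inter> \<Omega> (Suc (fst s))"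
      then obtain p' q where q: "p' \<in> gen (fst s)" "q \<in> stop p'" "x \<in> ?C q" by (auto simp: \<Omega>_def genS)
      then have "x \<in> ?C p'" using stop(1) by blast
      then have "p' = snd s" using gdisj[of "fst s"] p q(1) x by (auto simp: disjoint_family_on_def)
      then show "x \<in> (\<Union>q\<in>stop (snd s). ?C q)" using q by blast
    qed
    then have "?e (?C (snd s) \<inter> \<Omega> (Suc (fst s))) \<le> ?e (\<Union>q\<in>stop (snd s). ?C q)"
      by (intro emeasure_mono sets.countable_UN'') auto
    also have "\<dots> \<le> ennreal (1/2) * ?e (?C (snd s))" by (rule stop(3))
    finally have h: "?e (?C (snd s) \<inter> \<Omega> (Suc (fst s))) \<le> ennreal (1/2) * ?e (?C (snd s))" .
    define m where "m = measure lebesgue (?C (snd s))"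
    have m: "?e (?C (snd s)) = ennreal m" "0 < m" using emeasure_dilate_measure[OF L, of 0 0 "snd s"] by (auto simp: m_def)
    have "?e (E s) \<le> ?e (?C (snd s))" unfolding E_def by (intro emeasure_mono) auto
    then have "?e (E s) < \<infinity>" unfolding m by (auto intro: le_less_trans)
    then obtain r where r: "?e (E s) = ennreal r" "0 \<le> r" by (cases "?e (E s)") auto
    have "?e (?C (snd s)) = ?e (E s \<union> (?C (snd s) \<inter> \<Omega> (Suc (fst s))))"
      by (intro arg_cong[where f = ?e]) (auto simp: E_def)
    also have "\<dots> \<le> ?e (E s) + ?e (?C (snd s) \<inter> \<Omega> (Suc (fst s)))"
      using Em by (intro emeasure_subadditive) auto
    also have "\<dots> \<le> ennreal r + ennreal (1/2) * ennreal m" using h unfolding m r(1) by (rule add_left_mono)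
    also have "\<dots> = ennreal (r + 1/2 * m)"
      using r(2) m(2) by (subst ennreal_mult[symmetric]) (auto simp: ennreal_plus[symmetric] simp del: ennreal_plus)
    finally have "m \<le> r + 1/2 * m" unfolding m using r m(2) by (subst (asm) ennreal_le_iff) auto
    then have "ennreal m \<le> ennreal (2 * r)" by (intro ennreal_leI) auto
    also have "\<dots> = 2 * ?e (E s)" using r by (simp add: ennreal_mult)
    finally show ?thesis unfolding m .
  qed
  have Edisj: "disjoint_family_on E S"
    unfolding disjoint_family_on_def
  proof (intro ballI impI)
    fix s s' assume s: "s \<in> S" "s' \<in> S" "s \<noteq> s'"
    have key: "E u \<inter> E u' = {}" if "u \<in> S" "u' \<in> S" "fst u < fst u'" for u u'
    proof -
      have "E u' \<subseteq> \<Omega> (fst u')" using that by (auto simp: E_def \<Omega>_def S_def)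
      also have "\<dots> \<subseteq> \<Omega> (Suc (fst u))" using that by (intro \<Omega>mono) auto
      finally show ?thesis by (auto simp: E_def)
    qed
    consider "fst s < fst s'" | "fst s' < fst s" | "fst s = fst s'" by linarith
    then show "E s \<inter> E s' = {}"
    proof cases
      case 3
      then have "snd s \<noteq> snd s'" using s by (simp add: prod_eq_iff)
      then have "?C (snd s) \<inter> ?C (snd s') = {}"
        using gdisj[of "fst s"] s 3 by (auto simp: disjoint_family_on_def S_def)
      then show ?thesis by (auto simp: E_def)
    qed (use key s in blast)+
  qed
  have "AE x in lebesgue. \<forall>p\<in>(UNIV :: 'n dyadic_index set). (x \<in> ?C p - (\<Union>q\<in>stop p. ?C q) \<longrightarrow> cmod (T (restrict_to (?D p) f) x) \<le> c * avg f L a p) \<and>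
       (\<forall>q\<in>stop p. x \<in> ?C q \<longrightarrow> cmod (T (restrict_to (?D p) f) x) \<le> c * avg f L a p + cmod (T (restrict_to (?D q) f) x))"
    using stop(4) by (subst AE_ball_countable) auto
  with AEnull have "AE x in lebesgue. x \<in> ?C p0 \<longrightarrow> ennreal (cmod (T (restrict_to (?D p0) f) x)) \<le>
       (\<integral>\<^sup>+s. ennreal (c * avg f L a (snd s)) * indicator (?C (snd s)) x \<partial>count_space S)"
  proof eventually_elim
    case (elim x)
    show ?case
    proof
      assume x: "x \<in> ?C p0"
      have st1: "cmod (T (restrict_to (?D p) f) x) \<le> c * avg f L a p" if "x \<in> ?C p" "x \<notin> (\<Union>q\<in>stop p. ?C q)" for p
        using elim(2) that by blast
      have st2: "cmod (T (restrict_to (?D p) f) x) \<le> c * avg f L a p + cmod (T (restrict_to (?D q) f) x)" if "q \<in> stop p" "x \<in> ?C q" for p q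
        using elim(2) that by blast
      define \<phi> where "\<phi> s = c * avg f L a (snd s)" for s :: "nat \<times> 'n dyadic_index"
      have \<phi>0: "0 \<le> \<phi> s" for s unfolding \<phi>_def using c0 by simp
      define X where "X = {s \<in> S. x \<in> ?C (snd s)}"
      have step: "\<exists>J. finite J \<and> J \<subseteq> X \<and> (\<forall>s\<in>J. fst s < n) \<and>
          cmod (T (restrict_to (?D p0) f) x) \<le> (\<Sum>s\<in>J. \<phi> s) + cmod (T (restrict_to (?D p) f) x)"
        if "p \<in> gen n" "x \<in> ?C p" for n p
        using that
      proof (induction n arbitrary: p)
        case 0
        then show ?case by (intro exI[of _ "{}"]) (auto simp: gen0)
      next
        case (Suc n)
        then obtain p' where p': "p' \<in> gen n" "p \<in> stop p'" by (auto simp: genS)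
        have xp': "x \<in> ?C p'" using stop(1)[OF p'(2)] Suc.prems(2) by blast
        obtain J where J: "finite J" "J \<subseteq> X" "\<forall>s\<in>J. fst s < n"
          "cmod (T (restrict_to (?D p0) f) x) \<le> (\<Sum>s\<in>J. \<phi> s) + cmod (T (restrict_to (?D p') f) x)"
          using Suc.IH[OF p'(1) xp'] by blast
        have new: "(n, p') \<notin> J" using J(3) by auto
        have "cmod (T (restrict_to (?D p') f) x) \<le> \<phi> (n, p') + cmod (T (restrict_to (?D p) f) x)"
          unfolding \<phi>_def snd_conv by (rule st2[OF p'(2) Suc.prems(2)])
        then have "cmod (T (restrict_to (?D p0) f) x) \<le> (\<Sum>s\<in>insert (n, p') J. \<phi> s) + cmod (T (restrict_to (?D p) f) x)"
          using J(1,4) new by simp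
        then show ?case using J p' xp'
          by (intro exI[of _ "insert (n, p') J"]) (auto simp: X_def S_def less_SucI)
      qed
      obtain n where n: "x \<notin> \<Omega> n" using elim(1) by auto
      \<comment> \<open>The first generation that misses \<open>x\<close>. The cube through
        \<open>x\<close> one generation earlier ends the branch: there the average alone bounds the
        operator.\<close>
      define k where "k = (LEAST n. x \<notin> \<Omega> n)"
      have k: "x \<notin> \<Omega> k" unfolding k_def using n by (rule LeastI)
      have "k \<noteq> 0" using k x by (cases k) (auto simp: \<Omega>_def gen0)
      then obtain i where i: "k = Suc i" by (cases k) auto
      have "x \<in> \<Omega> i" using not_less_Least[of i "\<lambda>n. x \<notin> \<Omega> n"] i by (auto simp: k_def)
      then obtain p where p: "p \<in> gen i" "x \<in> ?C p" by (auto simp: \<Omega>_def)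
      have "x \<notin> (\<Union>q\<in>stop p. ?C q)" using k p unfolding i \<Omega>_def genS by blast
      then have last: "cmod (T (restrict_to (?D p) f) x) \<le> \<phi> (i, p)" using st1[OF p(2)] by (simp add: \<phi>_def)
      obtain J where J: "finite J" "J \<subseteq> X" "\<forall>s\<in>J. fst s < i"
          "cmod (T (restrict_to (?D p0) f) x) \<le> (\<Sum>s\<in>J. \<phi> s) + cmod (T (restrict_to (?D p) f) x)"
        using step[OF p] by blast
      have new: "(i, p) \<notin> J" using J(3) by auto
      define J' where "J' = insert (i, p) J"
      have J': "finite J'" "J' \<subseteq> X" using J p by (auto simp: J'_def X_def S_def)
      have "cmod (T (restrict_to (?D p0) f) x) \<le> (\<Sum>s\<in>J'. \<phi> s)"
        using J(1,4) new last by (simp add: J'_def)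
      then have "ennreal (cmod (T (restrict_to (?D p0) f) x)) \<le> ennreal (\<Sum>s\<in>J'. \<phi> s)" by (rule ennreal_leI)
      also have "\<dots> = (\<Sum>s\<in>J'. ennreal (\<phi> s) * indicator (?C (snd s)) x)"
      proof -
        have "ennreal (\<Sum>s\<in>J'. \<phi> s) = (\<Sum>s\<in>J'. ennreal (\<phi> s))"
          using \<phi>0 by (intro sum_ennreal[symmetric]) auto
        also have "\<dots> = (\<Sum>s\<in>J'. ennreal (\<phi> s) * indicator (?C (snd s)) x)"
          using J'(2) by (intro sum.cong) (auto simp: X_def)
        finally show ?thesis .
      qed
      also have "\<dots> \<le> (\<integral>\<^sup>+s. ennreal (\<phi> s) * indicator (?C (snd s)) x \<partial>count_space S)"
        using J' by (intro sum_le_nn_integral_count_space) (auto simp: X_def)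
      finally show "ennreal (cmod (T (restrict_to (?D p0) f) x)) \<le>
       (\<integral>\<^sup>+s. ennreal (c * avg f L a (snd s)) * indicator (?C (snd s)) x \<partial>count_space S)"
        by (simp add: \<phi>_def)
    qed
  qed
  moreover have "\<forall>s\<in>S. E s \<in> sets lebesgue \<and> E s \<subseteq> ?C (snd s) \<and> ?e (?C (snd s)) \<le> 2 * ?e (E s)"
    using Em E2 by (auto simp: E_def)
  ultimately show ?thesis using Edisj unfolding a_def c_def by blast
qed

end

section \<open>Maximal functions and shifted grids\<close>

text \<open>The next lower value, with 0 below the least one. For a function with finitely many
  values this makes the layer-cake formula a telescoping sum: the increments of
  \<open>\<phi>\<close> along \<open>V\<close>, each on the set where the function is at least
  \<open>v\<close>.\<close>

definition pred_in :: "real set \<Rightarrow> real \<Rightarrow> real" where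
  "pred_in V v = Max (insert 0 {u \<in> V. u < v})"

lemma pred_in_bounds:
  assumes "finite V" "0 < v" shows "0 \<le> pred_in V v" "pred_in V v < v"
  using assms unfolding pred_in_def by (auto intro: Max_ge)

lemma sum_pred_in_telescope:
  assumes "finite V" "\<And>v. v \<in> V \<Longrightarrow> 0 < v" "u \<in> insert 0 V" "\<phi> 0 = 0"
  shows "(\<Sum>v\<in>{v \<in> V. v \<le> u}. \<phi> v - \<phi> (pred_in V v)) = (\<phi> u :: real)"
  using assms
proof (induction V arbitrary: u rule: finite_linorder_max_induct)
  case empty
  then show ?case by simp
next
  case (insert b V)
  have pr: "pred_in (insert b V) v = pred_in V v" if "v \<in> V" for v
  proof -
    have "{u \<in> insert b V. u < v} = {u \<in> V. u < v}" using insert.hyps that by auto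
    then show ?thesis by (simp add: pred_in_def)
  qed
  have prb: "pred_in (insert b V) b = Max (insert 0 V)"
  proof -
    have "{u \<in> insert b V. u < b} = V" using insert.hyps by auto
    then show ?thesis by (simp add: pred_in_def)
  qed
  have b0: "0 < b" using insert.prems by auto
  have IH: "(\<Sum>v\<in>{v \<in> V. v \<le> u}. \<phi> v - \<phi> (pred_in V v)) = \<phi> u" if "u \<in> insert 0 V" for u
    using insert.IH insert.prems that by auto
  show ?case
  proof (cases "u = b")
    case False
    then have u: "u \<in> insert 0 V" "u < b" using insert.prems insert.hyps b0 by auto
    then have "{v \<in> insert b V. v \<le> u} = {v \<in> V. v \<le> u}" by auto
    then show ?thesis using IH[OF u(1)] pr by simp
  next
    case True
    define t where "t = Max (insert 0 V)"
    have t: "t \<in> insert 0 V" unfolding t_def using insert.hyps by (intro Max_in) auto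
    have "{v \<in> V. v \<le> t} = V" unfolding t_def using insert.hyps by auto
    then have 1: "(\<Sum>v\<in>V. \<phi> v - \<phi> (pred_in V v)) = \<phi> t" using IH[OF t] by simp
    have "{v \<in> insert b V. v \<le> u} = insert b V" using insert.hyps True by auto
    then have "(\<Sum>v\<in>{v \<in> insert b V. v \<le> u}. \<phi> v - \<phi> (pred_in (insert b V) v)) =
        (\<phi> b - \<phi> t) + (\<Sum>v\<in>V. \<phi> v - \<phi> (pred_in V v))"
      using insert.hyps pr prb by (simp add: t_def) (subst sum.insert; force)
    then show ?thesis using 1 True by simp
  qed
qed

text \<open>With \<open>c i\<close> an average over \<open>R i\<close>, the maximal function of the
  family; 0 is its value at points that no set contains.\<close>

definition maxfun :: "'i set \<Rightarrow> ('i \<Rightarrow> 'a set) \<Rightarrow> ('i \<Rightarrow> real) \<Rightarrow> 'a \<Rightarrow> real" where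
  "maxfun I R c x = Max (insert 0 (c ` {i \<in> I. x \<in> R i}))"

lemma maxfun_nonneg: "finite I \<Longrightarrow> 0 \<le> maxfun I R c x"
  by (simp add: maxfun_def)

lemma maxfun_ge: "finite I \<Longrightarrow> i \<in> I \<Longrightarrow> x \<in> R i \<Longrightarrow> c i \<le> maxfun I R c x"
  unfolding maxfun_def by (intro Max_ge) auto

lemma maxfun_ge_iff:
  assumes "finite I" "0 < v"
  shows "v \<le> maxfun I R c x \<longleftrightarrow> (\<exists>i\<in>I. x \<in> R i \<and> v \<le> c i)"
  using assms unfolding maxfun_def by (subst Max_ge_iff) auto

lemma maxfun_in:
  assumes "finite I" "\<And>i. i \<in> I \<Longrightarrow> 0 \<le> c i"
  shows "maxfun I R c x \<in> insert 0 (c ` I - {0})"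
proof -
  have "maxfun I R c x \<in> insert 0 (c ` {i \<in> I. x \<in> R i})"
    unfolding maxfun_def using assms by (intro Max_in) auto
  then show ?thesis by auto
qed

text \<open>The set over which the maximum is taken depends on the point. Writing it as the maximum
  over all of \<open>I\<close> of \<open>c i\<close> times an indicator removes this
  dependence.\<close>

lemma measurable_maxfun [measurable]:
  assumes "finite I" "\<And>i. i \<in> I \<Longrightarrow> R i \<in> sets M"
  shows "maxfun I R c \<in> borel_measurable M"
proof -
  have "maxfun I R c x = (if I = {} then 0 else Max ((\<lambda>i. max 0 (c i * indicator (R i) x)) ` I))" for x
  proof (cases "I = {}")
    case False
    have "maxfun I R c x = Max (insert 0 ((\<lambda>i. max 0 (c i * indicator (R i) x)) ` I))"
    proof (rule antisym)
      show "maxfun I R c x \<le> Max (insert 0 ((\<lambda>i. max 0 (c i * indicator (R i) x)) ` I))"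
        unfolding maxfun_def
      proof (rule Max.boundedI)
        fix u assume "u \<in> insert 0 (c ` {i \<in> I. x \<in> R i})"
        then consider "u = 0" | i where "i \<in> I" "x \<in> R i" "u = c i" by auto
        then show "u \<le> Max (insert 0 ((\<lambda>i. max 0 (c i * indicator (R i) x)) ` I))"
        proof cases
          case 1
          then show ?thesis using assms by (intro Max_ge) auto
        next
          case 2
          then have "u \<le> max 0 (c i * indicator (R i) x)" by simp
          also have "\<dots> \<le> Max (insert 0 ((\<lambda>i. max 0 (c i * indicator (R i) x)) ` I))"
            using assms(1) \<open>i \<in> I\<close> by (intro Max_ge insertI2 imageI) auto
          finally show ?thesis .
        qed
      qed (use assms in auto)
      show "Max (insert 0 ((\<lambda>i. max 0 (c i * indicator (R i) x)) ` I)) \<le> maxfun I R c x"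
        using assms maxfun_nonneg[OF assms(1)] maxfun_ge[OF assms(1), of _ x R c]
        by (intro Max.boundedI) (auto simp: indicator_def)
    qed
    also have "\<dots> = Max ((\<lambda>i. max 0 (c i * indicator (R i) x)) ` I)"
    proof -
      obtain i where "i \<in> I" using False by blast
      have "0 \<le> max 0 (c i * indicator (R i) x)" by simp
      also have "\<dots> \<le> Max ((\<lambda>i. max 0 (c i * indicator (R i) x)) ` I)"
        using assms \<open>i \<in> I\<close> by (intro Max_ge) auto
      finally show ?thesis using assms False by (subst Max_insert) (auto simp: max_def)
    qed
    finally show ?thesis using False by simp
  qed (simp add: maxfun_def)
  moreover have "(\<lambda>x. if I = {} then 0 else Max ((\<lambda>i. max 0 (c i * indicator (R i) x)) ` I)) \<in> borel_measurable M"
  proof -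
    have [measurable]: "(\<lambda>x. max 0 (c i * indicator (R i) x)) \<in> borel_measurable M" if "i \<in> I" for i
      using assms(2)[OF that] by measurable
    then show ?thesis using assms(1) by (auto intro!: borel_measurable_Max)
  qed
  ultimately show ?thesis by (subst measurable_cong) auto
qed

text \<open>The maximal sets with \<open>v \<le> c i\<close> are disjoint and exhaust the level set.
  So the constant is 1 for any measure, and the integral on the right extends over the level set
  alone, which the square estimate relies on.\<close>

lemma weak_maximal_bound:
  assumes I: "finite I" and R: "\<And>i. i \<in> I \<Longrightarrow> R i \<in> sets M"
    and lam: "\<And>i j. i \<in> I \<Longrightarrow> j \<in> I \<Longrightarrow> R i \<inter> R j = {} \<or> R i \<subseteq> R j \<or> R j \<subseteq> R i"
    and h: "h \<in> borel_measurable M"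
    and c: "\<And>i. i \<in> I \<Longrightarrow> ennreal (c i) * emeasure M (R i) \<le> (\<integral>\<^sup>+x. h x * indicator (R i) x \<partial>M)"
    and v: "0 < v"
  shows "ennreal v * emeasure M {x \<in> space M. v \<le> maxfun I R c x} \<le>
    (\<integral>\<^sup>+x. h x * indicator {x \<in> space M. v \<le> maxfun I R c x} x \<partial>M)"
proof -
  \<comment> \<open>A family of sets instead of indices, because distinct indices may carry the same
    set.\<close>
  define \<C> where "\<C> = R ` {i \<in> I. v \<le> c i}"
  define \<D> where "\<D> = {A \<in> \<C>. \<forall>B\<in>\<C>. A \<subseteq> B \<longrightarrow> A = B}"
  have finC: "finite \<C>" using I by (simp add: \<C>_def)
  have fin: "finite \<D>" using finC by (simp add: \<D>_def)
  have sub: "A \<in> sets M" if "A \<in> \<C>" for A using that R by (auto simp: \<C>_def)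
  have "\<exists>B\<in>\<D>. A \<subseteq> B" if A: "A \<in> \<C>" for A
  proof -
    obtain B where B: "B \<in> \<C>" "A \<subseteq> B" "\<forall>b\<in>\<C>. B \<le> b \<longrightarrow> b = B"
      using finite_has_maximal2[OF finC A] by metis
    then show ?thesis by (auto simp: \<D>_def)
  qed
  moreover have "\<D> \<subseteq> \<C>" by (auto simp: \<D>_def)
  ultimately have "\<Union>\<C> = \<Union>\<D>" by blast
  moreover have "\<Union>\<C> = {x \<in> space M. v \<le> maxfun I R c x}"
    using maxfun_ge_iff[OF I v, of R c] R[THEN sets.sets_into_space] by (auto simp: \<C>_def)
  ultimately have eq: "{x \<in> space M. v \<le> maxfun I R c x} = (\<Union>A\<in>\<D>. A)" by auto
  have disj: "disjoint_family_on (\<lambda>A. A) \<D>"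
    unfolding disjoint_family_on_def
  proof (intro ballI impI)
    fix A B assume AB: "A \<in> \<D>" "B \<in> \<D>" "A \<noteq> B"
    then obtain i j where "i \<in> I" "j \<in> I" "A = R i" "B = R j" by (auto simp: \<D>_def \<C>_def)
    then show "A \<inter> B = {}" using lam[of i j] AB by (auto simp: \<D>_def)
  qed
  have ed: "emeasure (density M h) A = (\<integral>\<^sup>+x. h x * indicator A x \<partial>M)" if "A \<in> sets M" for A
    using h that by (rule emeasure_density)
  have Um: "(\<Union>A\<in>\<D>. A) \<in> sets M" using fin sub by (intro sets.finite_UN) (auto simp: \<D>_def)
  have "emeasure M (\<Union>A\<in>\<D>. A) \<le> ennreal (1 / v) * emeasure (density M h) (\<Union>A\<in>\<D>. A)"
  proof (rule disjoint_UN_emeasure_le[OF _ disj])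
    fix A assume A: "A \<in> \<D>"
    then obtain i where i: "i \<in> I" "v \<le> c i" "A = R i" by (auto simp: \<D>_def \<C>_def)
    have Am: "A \<in> sets M" using R i by simp
    have "ennreal v * emeasure M A \<le> ennreal (c i) * emeasure M A"
      using i by (intro mult_right_mono ennreal_leI) auto
    also have "\<dots> \<le> emeasure (density M h) A" using c[OF i(1)] ed[OF Am] by (simp add: i(3))
    finally have "ennreal (1 / v) * (ennreal v * emeasure M A) \<le> ennreal (1 / v) * emeasure (density M h) A"
      by (intro mult_left_mono) auto
    then show "emeasure M A \<le> ennreal (1 / v) * emeasure (density M h) A"
      using v by (simp add: mult.assoc[symmetric] ennreal_mult[symmetric])
  qed (use fin sub in \<open>auto simp: \<D>_def intro: countable_finite\<close>)
  then have "ennreal v * emeasure M (\<Union>A\<in>\<D>. A) \<le> ennreal v * (ennreal (1 / v) * emeasure (density M h) (\<Union>A\<in>\<D>. A))"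
    by (intro mult_left_mono) auto
  also have "\<dots> = emeasure (density M h) (\<Union>A\<in>\<D>. A)"
    using v by (simp add: mult.assoc[symmetric] ennreal_mult[symmetric])
  finally show ?thesis unfolding eq ed[OF Um] .
qed

text \<open>Doob's inequality for squares. Layers and the weak bound give
  \<open>X \<le> 2 * Y\<close>, Cauchy-Schwarz gives \<open>Y\<^sup>2 \<le> H * X\<close>, hence
  \<open>X \<le> 4 * H\<close> after division by \<open>X\<close>. The division is allowed because
  finitely many sets of finite measure make \<open>X\<close> finite.\<close>

lemma doob_maximal:
  assumes I: "finite I" and R: "\<And>i. i \<in> I \<Longrightarrow> R i \<in> sets M"
    and lam: "\<And>i j. i \<in> I \<Longrightarrow> j \<in> I \<Longrightarrow> R i \<inter> R j = {} \<or> R i \<subseteq> R j \<or> R j \<subseteq> R i"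
    and fin: "\<And>i. i \<in> I \<Longrightarrow> emeasure M (R i) < \<infinity>"
    and h [measurable]: "h \<in> borel_measurable M" and c0: "\<And>i. i \<in> I \<Longrightarrow> 0 \<le> c i"
    and c: "\<And>i. i \<in> I \<Longrightarrow> ennreal (c i) * emeasure M (R i) \<le> (\<integral>\<^sup>+x. h x * indicator (R i) x \<partial>M)"
  shows "(\<integral>\<^sup>+x. ennreal (maxfun I R c x) ^ 2 \<partial>M) \<le> 4 * (\<integral>\<^sup>+x. h x ^ 2 \<partial>M)"
proof -
  define V where "V = c ` I - {0}"
  have V: "finite V" "\<And>v. v \<in> V \<Longrightarrow> 0 < v" using I c0 by (auto simp: V_def less_le)
  let ?m = "maxfun I R c"
  define B where "B v = {x \<in> space M. v \<le> ?m x}" for v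
  have mm [measurable]: "?m \<in> borel_measurable M" by (rule measurable_maxfun[OF I R])
  have Bm [measurable]: "B v \<in> sets M" for v unfolding B_def by measurable
  have m_in: "?m x \<in> insert 0 V" for x unfolding V_def by (rule maxfun_in[OF I c0])
  have layer: "ennreal (\<phi> (?m x)) = (\<Sum>v\<in>V. ennreal (\<phi> v - \<phi> (pred_in V v)) * indicator (B v) x)"
    if "x \<in> space M" and \<phi>: "\<phi> 0 = 0" "\<And>u v. 0 \<le> u \<Longrightarrow> u \<le> v \<Longrightarrow> \<phi> u \<le> \<phi> v" for \<phi> :: "real \<Rightarrow> real" and x
  proof -
    have p: "0 \<le> \<phi> v - \<phi> (pred_in V v)" if "v \<in> V" for v
      using pred_in_bounds[OF V(1), of v] V(2)[OF that] \<phi>(2)[of "pred_in V v" v] by auto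
    have "\<phi> (?m x) = (\<Sum>v\<in>{v \<in> V. v \<le> ?m x}. \<phi> v - \<phi> (pred_in V v))"
      by (rule sum_pred_in_telescope[where \<phi> = \<phi>, OF V m_in \<phi>(1), symmetric])
    also have "ennreal \<dots> = (\<Sum>v\<in>{v \<in> V. v \<le> ?m x}. ennreal (\<phi> v - \<phi> (pred_in V v)))"
      using p by (intro sum_ennreal[symmetric]) auto
    also have "\<dots> = (\<Sum>v\<in>V. ennreal (\<phi> v - \<phi> (pred_in V v)) * indicator (B v) x)"
      using that(1) unfolding sum.inter_filter[OF V(1)] by (auto intro!: sum.cong simp: B_def indicator_def)
    finally show ?thesis .
  qed
  define X where "X = (\<integral>\<^sup>+x. ennreal (?m x) ^ 2 \<partial>M)"
  define Y where "Y = (\<integral>\<^sup>+x. h x * ennreal (?m x) \<partial>M)"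
  define H where "H = (\<integral>\<^sup>+x. h x ^ 2 \<partial>M)"
  have X_eq: "X = (\<Sum>v\<in>V. ennreal (v\<^sup>2 - (pred_in V v)\<^sup>2) * emeasure M (B v))"
  proof -
    have "X = (\<integral>\<^sup>+x. (\<Sum>v\<in>V. ennreal (v\<^sup>2 - (pred_in V v)\<^sup>2) * indicator (B v) x) \<partial>M)"
      unfolding X_def
    proof (intro nn_integral_cong)
      fix x assume x: "x \<in> space M"
      have "ennreal (?m x) ^ 2 = ennreal ((?m x)\<^sup>2)"
        using maxfun_nonneg[OF I, of R c x] by (simp add: ennreal_power)
      also have "\<dots> = (\<Sum>v\<in>V. ennreal (v\<^sup>2 - (pred_in V v)\<^sup>2) * indicator (B v) x)"
        by (rule layer[OF x, of "\<lambda>u. u\<^sup>2"]) (auto intro: power_mono)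
      finally show "ennreal (?m x) ^ 2 = (\<Sum>v\<in>V. ennreal (v\<^sup>2 - (pred_in V v)\<^sup>2) * indicator (B v) x)" .
    qed
    then show ?thesis by (simp add: nn_integral_sum nn_integral_cmult)
  qed
  have Y_eq: "Y = (\<Sum>v\<in>V. ennreal (v - pred_in V v) * (\<integral>\<^sup>+x. h x * indicator (B v) x \<partial>M))"
  proof -
    have "Y = (\<integral>\<^sup>+x. (\<Sum>v\<in>V. ennreal (v - pred_in V v) * (h x * indicator (B v) x)) \<partial>M)"
      unfolding Y_def
    proof (intro nn_integral_cong)
      fix x assume x: "x \<in> space M"
      have "ennreal (?m x) = (\<Sum>v\<in>V. ennreal (v - pred_in V v) * indicator (B v) x)"
        by (rule layer[OF x, of "\<lambda>u. u"]) auto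
      then show "h x * ennreal (?m x) = (\<Sum>v\<in>V. ennreal (v - pred_in V v) * (h x * indicator (B v) x))"
        by (simp add: sum_distrib_left mult.left_commute)
    qed
    then show ?thesis by (simp add: nn_integral_sum nn_integral_cmult)
  qed
  have Xfin: "X < \<infinity>"
    unfolding X_eq
  proof (subst infinity_ennreal_def, subst ennreal_sum_less_top, rule V(1), intro ballI)
    fix v assume v: "v \<in> V"
    have "emeasure M (B v) \<le> emeasure M (\<Union>i\<in>I. R i)"
      using maxfun_ge_iff[OF I V(2)[OF v], of R c] R I by (intro emeasure_mono) (auto simp: B_def)
    also have "\<dots> \<le> (\<Sum>i\<in>I. emeasure M (R i))" using I R by (intro emeasure_subadditive_finite) auto
    also have "\<dots> < \<infinity>" using I fin by (simp add: ennreal_sum_less_top)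
    finally show "ennreal (v\<^sup>2 - (pred_in V v)\<^sup>2) * emeasure M (B v) < top"
      by (simp add: ennreal_mult_less_top)
  qed
  have XY: "X \<le> 2 * Y"
    unfolding X_eq Y_eq sum_distrib_left
  proof (rule sum_mono)
    fix v assume v: "v \<in> V"
    define u where "u = pred_in V v"
    have u: "0 \<le> u" "u < v" "0 < v" using pred_in_bounds[OF V(1) V(2)[OF v]] V(2)[OF v] by (auto simp: u_def)
    \<comment> \<open>Each layer of the square is at most \<open>2 * v\<close> times the
      corresponding layer of the function itself, and \<open>v\<close> times the measure of the
      level set is what the weak bound estimates.\<close>
    have "v\<^sup>2 - u\<^sup>2 = (v - u) * (v + u)" by (simp add: power2_eq_square algebra_simps)
    also have "\<dots> \<le> (v - u) * (2 * v)" using u by (intro mult_left_mono) auto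
    finally have "ennreal (v\<^sup>2 - u\<^sup>2) \<le> ennreal (2 * (v - u) * v)" by (intro ennreal_leI) (simp add: algebra_simps)
    also have "ennreal (2 * (v - u) * v) = ennreal (2 * ((v - u) * v))" by (simp only: mult.assoc)
    also have "\<dots> = ennreal 2 * ennreal ((v - u) * v)" by (rule ennreal_mult') simp
    also have "ennreal ((v - u) * v) = ennreal (v - u) * ennreal v" using u by (intro ennreal_mult') auto
    also have "ennreal 2 = 2" by simp
    finally have "ennreal (v\<^sup>2 - u\<^sup>2) * emeasure M (B v) \<le> 2 * (ennreal (v - u) * ennreal v) * emeasure M (B v)"
      by (rule mult_right_mono) simp
    also have "\<dots> = 2 * (ennreal (v - u) * (ennreal v * emeasure M (B v)))" by (simp add: mult.assoc)
    also have "\<dots> \<le> 2 * (ennreal (v - u) * (\<integral>\<^sup>+x. h x * indicator (B v) x \<partial>M))"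
      unfolding B_def by (intro mult_left_mono weak_maximal_bound[OF I R lam h c u(3)]) auto
    finally show "ennreal (v\<^sup>2 - (pred_in V v)\<^sup>2) * emeasure M (B v) \<le>
      2 * (ennreal (v - pred_in V v) * (\<integral>\<^sup>+x. h x * indicator (B v) x \<partial>M))" by (simp add: u_def)
  qed
  have CS: "Y\<^sup>2 \<le> H * X"
    unfolding Y_def H_def X_def by (rule Cauchy_Schwarz_nn_integral) measurable
  have "X \<le> 4 * H"
  proof (cases "X = 0 \<or> H = \<infinity>")
    case False
    then obtain x y where x: "X = ennreal x" "0 < x" and y: "H = ennreal y" "0 \<le> y"
      using Xfin by (cases X; cases H) (auto simp: less_le)
    have "X\<^sup>2 \<le> (2 * Y)\<^sup>2" using XY by (intro power_mono) auto
    also have "\<dots> = 4 * Y\<^sup>2" by (simp add: power_mult_distrib)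
    also have "\<dots> \<le> 4 * (H * X)" by (intro mult_left_mono CS) auto
    finally have "ennreal (x * x) \<le> ennreal (4 * (y * x))"
      using x y by (simp add: power2_eq_square ennreal_mult)
    then have "x * x \<le> 4 * (y * x)" using x y by (subst (asm) ennreal_le_iff) auto
    then have "x \<le> 4 * y" using x(2) by (simp add: mult.assoc[symmetric])
    then have "ennreal x \<le> ennreal (4 * y)" by (rule ennreal_leI)
    then show ?thesis using x y by (simp add: ennreal_mult)
  qed (auto simp: ennreal_mult_eq_top_iff)
  then show ?thesis by (simp add: X_def H_def)
qed

text \<open>The one-third trick: at scale \<open>t\<close> the grid points \<open>t \<int>\<close> and \<open>t (\<int> + \<theta>)\<close> with
  \<open>\<theta> \<in> {1/3, 2/3}\<close> modulo 1 are \<open>t / 3\<close>-separated, so a short interval fits into a cell of one of the two grids.\<close>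

lemma one_third_interval:
  fixes lo t :: real
  assumes t: "0 < t" and len: "3 * len \<le> t"
  shows "\<exists>b m. of_int m * t \<le> lo - (if b then 2 ^ k * t / 3 else 0) \<and>
    lo + len - (if b then 2 ^ k * t / 3 else 0) \<le> (of_int m + 1) * t"
proof -
  define u where "u = lo / t"
  have lo: "lo = u * t" using t by (simp add: u_def)
  have len': "len \<le> t / 3" using len by simp
  \<comment> \<open>No power of 2 is divisible by 3, so \<open>2 ^ k / 3\<close> is 1/3 or 2/3
    modulo 1.\<close>
  define j where "j = (2 ^ k :: int) div 3"
  have "(2 ^ k :: int) mod 3 = 1 \<or> (2 ^ k :: int) mod 3 = 2"
  proof (induction k)
    case (Suc k)
    have "x mod 3 = 1 \<or> x mod 3 = 2 \<Longrightarrow> (2 * x) mod 3 = 1 \<or> (2 * x) mod 3 = 2" for x :: int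
      by presburger
    from this[OF Suc] show ?case by simp
  qed simp
  note mod3 = this
  have "x mod 3 = 1 \<or> x mod 3 = 2 \<Longrightarrow> x = 3 * (x div 3) + 1 \<or> x = 3 * (x div 3) + 2" for x :: int
    by presburger
  from this[OF mod3] have "(2 ^ k :: int) = 3 * j + 1 \<or> (2 ^ k :: int) = 3 * j + 2"
    unfolding j_def .
  then have "(2 ^ k :: real) = 3 * of_int j + 1 \<or> (2 ^ k :: real) = 3 * of_int j + 2"
  proof (elim disjE)
    assume "(2 ^ k :: int) = 3 * j + 1"
    from arg_cong[OF this, of real_of_int] show ?thesis by simp
  next
    assume "(2 ^ k :: int) = 3 * j + 2"
    from arg_cong[OF this, of real_of_int] show ?thesis by simp
  qed
  then have th: "2 ^ k / 3 = of_int j + (1/3 :: real) \<or> 2 ^ k / 3 = of_int j + (2/3 :: real)" by auto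
  \<comment> \<open>Here \<open>z\<close> is the shift in units of the mesh. An interval of length
    at most a third of the mesh fits into a cell if it starts in the first two thirds.\<close>
  have red: "of_int m * t \<le> lo - z * t \<and> lo + len - z * t \<le> (of_int m + 1) * t"
    if "of_int m \<le> u - z" "u - z \<le> of_int m + 2/3" for m :: int and z
  proof
    have "of_int m * t \<le> (u - z) * t" using that t by (intro mult_right_mono) auto
    then show "of_int m * t \<le> lo - z * t" by (simp add: lo algebra_simps)
    have "(u - z) * t \<le> (of_int m + 2/3) * t" using that t by (intro mult_right_mono) auto
    then show "lo + len - z * t \<le> (of_int m + 1) * t" using len' by (simp add: lo algebra_simps)
  qed
  define m where "m = \<lfloor>u\<rfloor>"
  have m: "of_int m \<le> u" "u < of_int m + 1" unfolding m_def by linarith+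
  show ?thesis
  proof (cases "u \<le> of_int m + 2/3")
    case True
    then show ?thesis using red[of m 0] m by (intro exI[of _ False] exI[of _ m]) auto
  next
    case False
    \<comment> \<open>From the last third of a cell of the unshifted grid, subtracting 1/3 or 2/3 of
      a cell leads into the first two thirds of a cell.\<close>
    define z where "z = (2 ^ k / 3 :: real)"
    have "of_int (m - j) \<le> u - z" "u - z \<le> of_int (m - j) + 2/3"
      using th[folded z_def] False m by auto
    then show ?thesis using red[of "m - j" z] unfolding z_def
      by (intro exI[of _ True] exI[of _ "m - j"]) auto
  qed
qed

text \<open>A third of the top mesh is \<open>2 ^ k / 3\<close> meshes of level \<open>k\<close>, so
  one shift serves all levels at once. Each coordinate chooses for itself, which gives
  \<open>2 ^ d\<close> grids.\<close>

definition shift :: "real \<Rightarrow> ('n \<Rightarrow> bool) \<Rightarrow> real^'n" where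
  "shift L b = (\<chi> i. if b i then L / 3 else 0)"

text \<open>The level is kept and the top side is multiplied by \<open>2 ^ j\<close> instead, so the
  enclosing cube has \<open>2 ^ j\<close> times the side of \<open>q\<close>: at least three times
  the side of the dilate, as the coordinatewise argument requires.\<close>

lemma one_third_cube:
  fixes q :: "'n::finite dyadic_index"
  assumes L: "0 < L" and j: "3 * (2 * real a + 1) \<le> 2 ^ j"
  shows "\<exists>b m. dilate 0 L a q \<subseteq> dcube (shift (2 ^ j * L) b :: real^'n) (2 ^ j * L) (fst q, m)"
proof -
  define s where "s = L / 2 ^ fst q"
  define t where "t = 2 ^ j * s"
  have s: "0 < s" using L by (simp add: s_def)
  have t: "0 < t" using s by (simp add: t_def)
  have tL: "2 ^ j * L / 2 ^ fst q = t" by (simp add: t_def s_def)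
  have tL3: "2 ^ fst q * t / 3 = 2 ^ j * L / 3" by (simp add: t_def s_def)
  have "3 * (2 * real a + 1) * s \<le> 2 ^ j * s" using j s by (intro mult_right_mono) auto
  then have len: "3 * ((2 * real a + 1) * s) \<le> t" by (simp only: t_def mult.assoc)
  have "\<forall>i. \<exists>b m. of_int m * t \<le> (of_int (snd q i) - real a) * s - (if b then 2 ^ fst q * t / 3 else 0) \<and>
    (of_int (snd q i) - real a) * s + (2 * real a + 1) * s - (if b then 2 ^ fst q * t / 3 else 0) \<le> (of_int m + 1) * t"
    using one_third_interval[OF t len] by blast
  then obtain b m where bm: "\<And>i. of_int (m i) * t \<le> (of_int (snd q i) - real a) * s - (if b i then 2 ^ j * L / 3 else 0)"
    "\<And>i. (of_int (snd q i) - real a) * s + (2 * real a + 1) * s - (if b i then 2 ^ j * L / 3 else 0) \<le> (of_int (m i) + 1) * t"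
    unfolding tL3 by metis
  have "dilate 0 L a q \<subseteq> dcube (shift (2 ^ j * L) b :: real^'n) (2 ^ j * L) (fst q, m)"
  proof
    fix x :: "real^'n" assume x: "x \<in> dilate 0 L a q"
    show "x \<in> dcube (shift (2 ^ j * L) b :: real^'n) (2 ^ j * L) (fst q, m)"
      unfolding mem_dilate fst_conv snd_conv tL
    proof
      fix i
      have "(of_int (snd q i) - real a) * s \<le> x $ i" "x $ i < (of_int (snd q i) + 1 + real a) * s"
        using x unfolding mem_dilate s_def[symmetric] by auto
      then show "(of_int (m i) - real 0) * t \<le> x $ i - (shift (2 ^ j * L) b :: real^'n) $ i \<and>
         x $ i - (shift (2 ^ j * L) b :: real^'n) $ i < (of_int (m i) + 1 + real 0) * t"
        using bm[of i] by (auto simp: shift_def algebra_simps)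
    qed
  qed
  then show ?thesis by blast
qed

section \<open>The weighted bilinear form\<close>

lemma ennreal_le_of_square_le:
  assumes "x\<^sup>2 \<le> ennreal (y\<^sup>2)" "0 \<le> y" shows "x \<le> ennreal y"
proof (cases x)
  case (real r)
  then have "ennreal (r\<^sup>2) \<le> ennreal (y\<^sup>2)" using assms by (simp add: ennreal_power)
  then have "r\<^sup>2 \<le> y\<^sup>2" using assms by (simp add: ennreal_le_iff)
  then show ?thesis using real assms by (auto intro: ennreal_leI simp: power2_le_iff_abs_le)
next
  case top
  then show ?thesis using assms by (simp add: power2_eq_square top_unique ennreal_mult_top)
qed

lemma nn_integral_fatou_le:
  fixes u :: "nat \<Rightarrow> 'a \<Rightarrow> ennreal"
  assumes [measurable]: "\<And>n. u n \<in> borel_measurable M"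
    and lim: "AE x in M. (\<lambda>n. u n x) \<longlonglongrightarrow> v x" and le: "\<And>n. (\<integral>\<^sup>+x. u n x \<partial>M) \<le> B"
  shows "(\<integral>\<^sup>+x. v x \<partial>M) \<le> B"
proof -
  have "(\<integral>\<^sup>+x. v x \<partial>M) = (\<integral>\<^sup>+x. liminf (\<lambda>n. u n x) \<partial>M)"
  proof (rule nn_integral_cong_AE)
    from lim show "AE x in M. v x = liminf (\<lambda>n. u n x)"
      by eventually_elim (simp add: lim_imp_Liminf)
  qed
  also have "\<dots> \<le> liminf (\<lambda>n. (\<integral>\<^sup>+x. u n x \<partial>M))"
    by (rule nn_integral_liminf) measurable
  also have "\<dots> \<le> limsup (\<lambda>n. (\<integral>\<^sup>+x. u n x \<partial>M))" by (rule Liminf_le_Limsup) simp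
  also have "\<dots> \<le> B" by (rule Limsup_bounded) (simp add: le)
  finally show ?thesis .
qed

lemma sets_weighted [simp, measurable_cong]: "sets (weighted u) = sets lebesgue"
  by (simp add: weighted_def)

lemma space_weighted [simp]: "space (weighted u) = UNIV"
  by (simp add: weighted_def)

definition A2_const :: "(real^'n \<Rightarrow> real) \<Rightarrow> real" where
  "A2_const w = enn2real (A2_characteristic w)"

lemma A2_const_nonneg [simp]: "0 \<le> A2_const w"
  by (simp add: A2_const_def)

context
  fixes w :: "real^'n \<Rightarrow> real"
  assumes A2: "A2_weight w"
begin

lemma weight_pos: "AE x in lebesgue. 0 < w x"
  using A2 by (simp add: A2_weight_def is_weight_def)

lemma weight_measurable [measurable]: "w \<in> borel_measurable lebesgue"
  using A2 by (simp add: A2_weight_def is_weight_def locally_integrable_def)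

lemma weight_integrable: "compact S \<Longrightarrow> set_integrable lebesgue S w"
  "compact S \<Longrightarrow> set_integrable lebesgue S (\<lambda>x. inverse (w x))"
  using A2 by (simp_all add: A2_weight_def is_weight_def locally_integrable_def)

lemma nn_integral_weighted:
  assumes "h \<in> borel_measurable lebesgue"
  shows "(\<integral>\<^sup>+x. h x \<partial>weighted w) = (\<integral>\<^sup>+x. ennreal (w x) * h x \<partial>lebesgue)"
    "(\<integral>\<^sup>+x. h x \<partial>weighted (\<lambda>x. inverse (w x))) = (\<integral>\<^sup>+x. ennreal (inverse (w x)) * h x \<partial>lebesgue)"
  unfolding weighted_def using assms by (auto intro!: nn_integral_density)

lemma AE_weighted: "AE x in lebesgue. P x \<Longrightarrow> AE x in weighted w. P x"
  unfolding weighted_def by (subst AE_density) auto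

lemma emeasure_weighted_compact:
  assumes S: "compact S" and B: "B \<in> sets lebesgue" "B \<subseteq> S"
  shows "emeasure (weighted w) B \<le> ennreal (LINT x:S|lebesgue. w x)" (is ?A)
    "emeasure (weighted (\<lambda>x. inverse (w x))) B \<le> ennreal (LINT x:S|lebesgue. inverse (w x))" (is ?B)
proof -
  have gen: "(\<integral>\<^sup>+x. ennreal (u x) * indicator B x \<partial>lebesgue) \<le> ennreal (LINT x:S|lebesgue. u x)"
    if "set_integrable lebesgue S u" "AE x in lebesgue. 0 < u x" for u :: "real^'n \<Rightarrow> real"
  proof -
    have "(\<integral>\<^sup>+x. ennreal (u x) * indicator B x \<partial>lebesgue) \<le> (\<integral>\<^sup>+x. ennreal (indicator S x *\<^sub>R u x) \<partial>lebesgue)"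
      using B(2) by (intro nn_integral_mono) (auto simp: indicator_def)
    also have "\<dots> = ennreal (LINT x|lebesgue. indicator S x *\<^sub>R u x)"
    proof (rule nn_integral_eq_integral)
      show "integrable lebesgue (\<lambda>x. indicat_real S x *\<^sub>R u x)" using that(1) by (simp add: set_integrable_def)
      show "AE x in lebesgue. 0 \<le> indicat_real S x *\<^sub>R u x"
        using that(2) by eventually_elim (simp add: indicator_def less_imp_le)
    qed
    finally show ?thesis by (simp add: set_lebesgue_integral_def)
  qed
  have "emeasure (weighted w) B = (\<integral>\<^sup>+x. ennreal (w x) * indicator B x \<partial>lebesgue)"
    unfolding weighted_def using B by (intro emeasure_density) auto
  then show ?A using gen[OF weight_integrable(1)[OF S] weight_pos] by simp
  have "emeasure (weighted (\<lambda>x. inverse (w x))) B = (\<integral>\<^sup>+x. ennreal (inverse (w x)) * indicator B x \<partial>lebesgue)"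
    unfolding weighted_def using B by (intro emeasure_density) auto
  moreover have "AE x in lebesgue. 0 < inverse (w x)" using weight_pos by eventually_elim simp
  ultimately show ?B using gen[OF weight_integrable(2)[OF S]] by simp
qed

lemma emeasure_weighted_bounded:
  assumes "bounded B" "B \<in> sets lebesgue"
  shows "emeasure (weighted w) B < \<infinity>"
proof -
  have "compact (closure B)" using assms by (simp add: compact_closure)
  from emeasure_weighted_compact(1)[OF this assms(2) closure_subset]
  show ?thesis by (auto intro: le_less_trans)
qed

text \<open>For averages with respect to the weights: one has to divide by these measures of
  cubes.\<close>

lemma emeasure_weighted_pos:
  assumes B: "B \<in> sets lebesgue" "emeasure lebesgue B \<noteq> 0"
  shows "emeasure (weighted w) B \<noteq> 0" "emeasure (weighted (\<lambda>x. inverse (w x))) B \<noteq> 0"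
proof -
  have gen: "emeasure (density lebesgue (\<lambda>x. ennreal (u x))) B \<noteq> 0"
    if "u \<in> borel_measurable lebesgue" "AE x in lebesgue. 0 < u x" for u :: "real^'n \<Rightarrow> real"
  proof
    assume "emeasure (density lebesgue (\<lambda>x. ennreal (u x))) B = 0"
    then have "(\<integral>\<^sup>+x. ennreal (u x) * indicator B x \<partial>lebesgue) = 0"
      using that(1) B(1) by (subst (asm) emeasure_density) auto
    then have "AE x in lebesgue. ennreal (u x) * indicator B x = 0"
      using that(1) B(1) by (subst (asm) nn_integral_0_iff_AE) auto
    with that(2) have "AE x in lebesgue. x \<notin> B"
    proof eventually_elim
      case (elim x)
      then show ?case by (cases "x \<in> B") auto
    qed
    then have "emeasure lebesgue {x \<in> space lebesgue. x \<in> B} = 0" by (intro emeasure_eq_0_AE) auto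
    then show False using B(2) by simp
  qed
  show "emeasure (weighted w) B \<noteq> 0" unfolding weighted_def by (rule gen[OF weight_measurable weight_pos])
  have "AE x in lebesgue. 0 < inverse (w x)" using weight_pos by eventually_elim simp
  then show "emeasure (weighted (\<lambda>x. inverse (w x))) B \<noteq> 0" unfolding weighted_def by (intro gen) auto
qed

text \<open>The characteristic is a supremum over closed cubes, so the half-open cube is compared
  with the closed one having the same corners.\<close>

lemma A2_dcube:
  assumes L: "0 < L"
  shows "emeasure (weighted w) (dcube v L p) < \<infinity>"
    "emeasure (weighted (\<lambda>x. inverse (w x))) (dcube v L p) < \<infinity>"
    "emeasure (weighted w) (dcube v L p) * emeasure (weighted (\<lambda>x. inverse (w x))) (dcube v L p) \<le>
      ennreal (A2_const w * (measure lebesgue (dcube v L p))\<^sup>2)"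
proof -
  define s where "s = L / 2 ^ fst p"
  have s: "0 < s" using L by (simp add: s_def)
  define c where "c = (\<chi> i. v $ i + of_int (snd p i) * s)"
  define Q where "Q = cbox c (\<chi> i. c $ i + s)"
  have Q: "Q \<in> cubes" unfolding cubes_def Q_def using s by blast
  have RQ: "dcube v L p \<subseteq> Q"
  proof
    fix x assume "x \<in> dcube v L p"
    then have "\<And>i. of_int (snd p i) * s \<le> x $ i - v $ i" "\<And>i. x $ i - v $ i < (of_int (snd p i) + 1) * s"
      unfolding mem_dilate s_def[symmetric] by auto
    then show "x \<in> Q" unfolding Q_def mem_box_cart c_def distrib_right
      by (simp add: algebra_simps less_imp_le)
  qed
  have cQ: "compact Q" by (simp add: Q_def)
  have Rm: "dcube v L p \<in> sets lebesgue" by measurable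
  define W1 where "W1 = (LINT x:Q|lebesgue. w x)"
  define W2 where "W2 = (LINT x:Q|lebesgue. inverse (w x))"
  note E = emeasure_weighted_compact[OF cQ Rm RQ, folded W1_def W2_def]
  show "emeasure (weighted w) (dcube v L p) < \<infinity>"
    "emeasure (weighted (\<lambda>x. inverse (w x))) (dcube v L p) < \<infinity>"
    using E by (auto intro: le_less_trans)
  have W: "0 \<le> W1" "0 \<le> W2"
  proof -
    show "0 \<le> W1" unfolding W1_def set_lebesgue_integral_def
    proof (rule integral_nonneg_AE)
      from weight_pos show "AE x in lebesgue. 0 \<le> indicat_real Q x *\<^sub>R w x"
        by eventually_elim (simp add: indicator_def less_imp_le)
    qed
    show "0 \<le> W2" unfolding W2_def set_lebesgue_integral_def
    proof (rule integral_nonneg_AE)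
      from weight_pos show "AE x in lebesgue. 0 \<le> indicat_real Q x *\<^sub>R inverse (w x)"
        by eventually_elim (simp add: indicator_def less_imp_le)
    qed
  qed
  have mQ: "measure lebesgue Q = s ^ CARD('n)"
  proof -
    have "c \<in> Q" unfolding Q_def mem_box_cart using s by simp
    then have "measure lborel Q = (\<Prod>i\<in>(UNIV :: 'n set). (\<chi> i. c $ i + s) $ i - c $ i)"
      unfolding Q_def by (intro content_cbox_cart) auto
    then show ?thesis by (simp add: Q_def measure_completion)
  qed
  have mR: "measure lebesgue (dcube v L p) = s ^ CARD('n)"
    using emeasure_dilate[OF L, of v 0 p] s by (simp add: measure_def s_def)
  have "ennreal (cube_average Q w * cube_average Q (\<lambda>x. inverse (w x))) \<le> A2_characteristic w"
    unfolding A2_characteristic_def by (rule SUP_upper[OF Q])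
  also have "\<dots> = ennreal (A2_const w)"
    using A2 by (simp add: A2_const_def A2_weight_def)
  finally have "cube_average Q w * cube_average Q (\<lambda>x. inverse (w x)) \<le> A2_const w"
    by (subst (asm) ennreal_le_iff) (auto simp: A2_const_nonneg)
  then have "W1 / s ^ CARD('n) * (W2 / s ^ CARD('n)) \<le> A2_const w"
    by (simp add: cube_average_def W1_def W2_def mQ)
  then have le: "W1 * W2 \<le> A2_const w * (s ^ CARD('n))\<^sup>2"
    using s by (simp add: power2_eq_square pos_divide_le_eq)
  have "emeasure (weighted w) (dcube v L p) * emeasure (weighted (\<lambda>x. inverse (w x))) (dcube v L p) \<le> ennreal W1 * ennreal W2"
    by (intro mult_mono E) auto
  also have "\<dots> = ennreal (W1 * W2)" using W by (simp add: ennreal_mult)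
  also have "\<dots> \<le> ennreal (A2_const w * (s ^ CARD('n))\<^sup>2)" by (rule ennreal_leI[OF le])
  finally show "emeasure (weighted w) (dcube v L p) * emeasure (weighted (\<lambda>x. inverse (w x))) (dcube v L p) \<le>
      ennreal (A2_const w * (measure lebesgue (dcube v L p))\<^sup>2)" by (simp add: mR)
qed

text \<open>Sparseness is used with respect to Lebesgue measure: once the weighted averages and the
  characteristic are split off, a factor \<open>|R j|\<close> is left and is exchanged for
  \<open>c * |E j|\<close>. Disjointness of the \<open>E j\<close> turns the sum into an integral of
  a product of two maximal functions. The 4 is the square root of the two constants 4 in
  \<open>doob_maximal\<close>.\<close>

lemma weighted_bilinear:
  fixes r :: "'i \<Rightarrow> 'n dyadic_index" and g :: "real^'n \<Rightarrow> real"
  assumes J: "finite J" and L: "0 < L" and c: "0 \<le> c"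
    and disj: "disjoint_family_on E J"
    and E: "\<And>j. j \<in> J \<Longrightarrow> E j \<in> sets lebesgue" "\<And>j. j \<in> J \<Longrightarrow> E j \<subseteq> dcube v L (r j)"
      "\<And>j. j \<in> J \<Longrightarrow> emeasure lebesgue (dcube v L (r j)) \<le> ennreal c * emeasure lebesgue (E j)"
    and f: "test_function f" and g [measurable]: "g \<in> borel_measurable lebesgue" and gb: "\<And>x. 0 \<le> g x" "\<And>x. g x \<le> Bg"
    and F: "0 \<le> F" "(\<integral>\<^sup>+x. ennreal ((cmod (f x))\<^sup>2) \<partial>weighted w) \<le> ennreal (F\<^sup>2)"
    and G: "0 \<le> G" "(\<integral>\<^sup>+x. ennreal ((g x)\<^sup>2) \<partial>weighted w) \<le> ennreal (G\<^sup>2)"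
  shows "(\<Sum>j\<in>J. ennreal (measure (modulus_measure f) (dcube v L (r j)) / measure lebesgue (dcube v L (r j))) *
      (\<integral>\<^sup>+x. ennreal (g x) * indicator (dcube v L (r j)) x \<partial>weighted w)) \<le> ennreal (4 * c * A2_const w * F * G)"
proof -
  define R where "R j = dcube v L (r j)" for j
  define \<mu>w where "\<mu>w = weighted w"
  define \<mu>s where "\<mu>s = weighted (\<lambda>x. inverse (w x))"
  have fm [measurable]: "f \<in> borel_measurable lebesgue" by (rule test_function_measurable[OF f])
  have Rm [measurable]: "R j \<in> sets lebesgue" for j unfolding R_def by measurable
  have sm: "sets \<mu>w = sets lebesgue" "sets \<mu>s = sets lebesgue" by (simp_all add: \<mu>w_def \<mu>s_def)
  have Rp: "emeasure lebesgue (R j) \<noteq> 0" for j using emeasure_dilate_pos[OF L, of v 0 "r j"] by (simp add: R_def)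
  define m where "m j = measure lebesgue (R j)" for j
  have m: "0 < m j" "emeasure lebesgue (R j) = ennreal (m j)" for j
    using emeasure_dilate_measure[OF L, of v 0 "r j"] by (auto simp: m_def R_def)
  define mw where "mw j = measure \<mu>w (R j)" for j
  define ms where "ms j = measure \<mu>s (R j)" for j
  have mw: "emeasure \<mu>w (R j) = ennreal (mw j)" "0 < mw j" for j
    using A2_dcube(1)[OF L, of v "r j"] emeasure_weighted_pos(1)[OF Rm Rp, of j]
    by (auto simp: mw_def \<mu>w_def R_def measure_def enn2real_positive_iff less_top[symmetric] zero_less_iff_neq_zero)
  have ms: "emeasure \<mu>s (R j) = ennreal (ms j)" "0 < ms j" for j
    using A2_dcube(2)[OF L, of v "r j"] emeasure_weighted_pos(2)[OF Rm Rp, of j]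
    by (auto simp: ms_def \<mu>s_def R_def measure_def enn2real_positive_iff less_top[symmetric] zero_less_iff_neq_zero)
  have mwms: "mw j * ms j \<le> A2_const w * (m j)\<^sup>2" for j
  proof -
    have "ennreal (mw j * ms j) \<le> ennreal (A2_const w * (m j)\<^sup>2)"
      using A2_dcube(3)[OF L, of v "r j"] mw[of j] ms[of j]
      by (simp add: R_def[symmetric] \<mu>w_def[symmetric] \<mu>s_def[symmetric] m_def ennreal_mult)
    then show ?thesis by (subst (asm) ennreal_le_iff) (auto simp: A2_const_nonneg)
  qed
  define mf where "mf j = measure (modulus_measure f) (R j)" for j
  have mf: "emeasure (modulus_measure f) (R j) = ennreal (mf j)" "0 \<le> mf j" for j
  proof -
    have "emeasure (modulus_measure f) (R j) < \<infinity>" using emeasure_modulus_measure_le[OF f, of "R j"] by (auto intro: le_less_trans)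
    then show "emeasure (modulus_measure f) (R j) = ennreal (mf j)" by (simp add: mf_def measure_def)
  qed (simp add: mf_def)
  define \<nu> where "\<nu> j = (\<integral>\<^sup>+x. ennreal (g x) * indicator (R j) x \<partial>\<mu>w)" for j
  have Bg: "0 \<le> Bg" using gb order.trans by blast
  have \<nu>fin: "\<nu> j < \<infinity>" for j
  proof -
    have "\<nu> j \<le> (\<integral>\<^sup>+x. ennreal Bg * indicator (R j) x \<partial>\<mu>w)"
      unfolding \<nu>_def using gb by (intro nn_integral_mono mult_right_mono ennreal_leI) auto
    also have "\<dots> = ennreal Bg * ennreal (mw j)"
      using Rm sm(1) by (subst nn_integral_cmult_indicator) (auto simp: mw)
    finally show ?thesis by (auto intro: le_less_trans simp: ennreal_mult_less_top)
  qed
  define n where "n j = enn2real (\<nu> j)" for j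
  have n: "\<nu> j = ennreal (n j)" "0 \<le> n j" for j using \<nu>fin[of j] by (auto simp: n_def)
  \<comment> \<open>The average of \<open>|f| w\<close> with respect to \<open>\<mu>s\<close>,
    because the mass of \<open>|f|\<close> is the integral of \<open>|f| w\<close> against the
    inverse weight. Likewise \<open>b j\<close> is the average of \<open>g\<close> with respect to
    \<open>\<mu>w\<close>.\<close>
  define a where "a j = mf j / ms j" for j
  define b where "b j = n j / mw j" for j
  have ab: "0 \<le> a j" "0 \<le> b j" for j
    using mf[of j] n[of j] mw[of j] ms[of j] by (auto simp: a_def b_def)
  have lam: "R i \<inter> R j = {} \<or> R i \<subseteq> R j \<or> R j \<subseteq> R i" for i j
    unfolding R_def by (rule dcube_laminar[OF L])
  have wpos: "AE x in lebesgue. 0 < w x" by (rule weight_pos)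
  define m1 where "m1 = maxfun J R a"
  define m2 where "m2 = maxfun J R b"
  have m1m [measurable]: "m1 \<in> borel_measurable lebesgue" unfolding m1_def by (rule measurable_maxfun[OF J Rm])
  have m2m [measurable]: "m2 \<in> borel_measurable lebesgue" unfolding m2_def by (rule measurable_maxfun[OF J Rm])
  have m1n: "0 \<le> m1 x" and m2n: "0 \<le> m2 x" for x unfolding m1_def m2_def by (rule maxfun_nonneg[OF J])+
  have D1: "(\<integral>\<^sup>+x. ennreal (m1 x) ^ 2 \<partial>\<mu>s) \<le> ennreal (4 * F\<^sup>2)"
  proof -
    define h where "h x = ennreal (cmod (f x) * w x)" for x
    have hm [measurable]: "h \<in> borel_measurable lebesgue" unfolding h_def by measurable
    have "(\<integral>\<^sup>+x. ennreal (m1 x) ^ 2 \<partial>\<mu>s) \<le> 4 * (\<integral>\<^sup>+x. h x ^ 2 \<partial>\<mu>s)"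
      unfolding m1_def
    proof (rule doob_maximal[OF J])
      fix j
      have "(\<integral>\<^sup>+x. h x * indicator (R j) x \<partial>\<mu>s) = (\<integral>\<^sup>+x. ennreal (inverse (w x)) * (h x * indicator (R j) x) \<partial>lebesgue)"
        unfolding \<mu>s_def by (rule nn_integral_weighted(2)) measurable
      also have "\<dots> = (\<integral>\<^sup>+x. ennreal (cmod (f x)) * indicator (R j) x \<partial>lebesgue)"
      proof (rule nn_integral_cong_AE)
        from wpos show "AE x in lebesgue. ennreal (inverse (w x)) * (h x * indicator (R j) x) = ennreal (cmod (f x)) * indicator (R j) x"
        proof eventually_elim
          case (elim x)
          have "ennreal (inverse (w x)) * h x = ennreal (inverse (w x) * (cmod (f x) * w x))"
            unfolding h_def using elim by (intro ennreal_mult[symmetric]) auto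
          also have "inverse (w x) * (cmod (f x) * w x) = cmod (f x)" using elim by simp
          finally show ?case by (simp add: mult.assoc[symmetric])
        qed
      qed
      also have "\<dots> = emeasure (modulus_measure f) (R j)" by (rule emeasure_modulus_measure[OF f Rm, symmetric])
      finally show "ennreal (a j) * emeasure \<mu>s (R j) \<le> (\<integral>\<^sup>+x. h x * indicator (R j) x \<partial>\<mu>s)"
        using ms[of j] mf[of j] ab[of j] by (simp add: ennreal_mult[symmetric] a_def)
      show "emeasure \<mu>s (R j) < \<infinity>" by (simp add: ms)
    qed (use sm lam ab Rm hm measurable_cong_sets[OF sm(2)] in auto)
    also have "(\<integral>\<^sup>+x. h x ^ 2 \<partial>\<mu>s) = (\<integral>\<^sup>+x. ennreal (inverse (w x)) * h x ^ 2 \<partial>lebesgue)"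
      unfolding \<mu>s_def by (rule nn_integral_weighted(2)) measurable
    also have "\<dots> = (\<integral>\<^sup>+x. ennreal (w x) * ennreal ((cmod (f x))\<^sup>2) \<partial>lebesgue)"
    proof (rule nn_integral_cong_AE)
      from wpos show "AE x in lebesgue. ennreal (inverse (w x)) * h x ^ 2 = ennreal (w x) * ennreal ((cmod (f x))\<^sup>2)"
      proof eventually_elim
        case (elim x)
        have "ennreal (inverse (w x)) * h x ^ 2 = ennreal (inverse (w x) * (cmod (f x) * w x)\<^sup>2)"
        proof -
          have "h x ^ 2 = ennreal ((cmod (f x) * w x)\<^sup>2)"
            unfolding h_def using elim by (intro ennreal_power) auto
          then show ?thesis using elim by (simp only:) (intro ennreal_mult[symmetric]; simp)
        qed
        also have "inverse (w x) * (cmod (f x) * w x)\<^sup>2 = w x * (cmod (f x))\<^sup>2"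
          using elim by (simp add: power2_eq_square field_simps)
        finally show ?case using elim by (simp add: ennreal_mult)
      qed
    qed
    also have "\<dots> = (\<integral>\<^sup>+x. ennreal ((cmod (f x))\<^sup>2) \<partial>weighted w)"
      by (rule nn_integral_weighted(1)[symmetric]) measurable
    also have "4 * \<dots> \<le> 4 * ennreal (F\<^sup>2)" by (intro mult_left_mono F) auto
    also have "4 * ennreal (F\<^sup>2) = ennreal (4 * F\<^sup>2)" by (simp add: ennreal_mult)
    finally show ?thesis .
  qed
  have D2: "(\<integral>\<^sup>+x. ennreal (m2 x) ^ 2 \<partial>\<mu>w) \<le> ennreal (4 * G\<^sup>2)"
  proof -
    have "(\<integral>\<^sup>+x. ennreal (m2 x) ^ 2 \<partial>\<mu>w) \<le> 4 * (\<integral>\<^sup>+x. ennreal (g x) ^ 2 \<partial>\<mu>w)"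
      unfolding m2_def
    proof (rule doob_maximal[OF J])
      fix j
      show "ennreal (b j) * emeasure \<mu>w (R j) \<le> (\<integral>\<^sup>+x. ennreal (g x) * indicator (R j) x \<partial>\<mu>w)"
        using mw[of j] n[of j] ab[of j] unfolding \<nu>_def[symmetric] by (simp add: ennreal_mult[symmetric] b_def)
      show "emeasure \<mu>w (R j) < \<infinity>" by (simp add: mw)
      show "(\<lambda>x. ennreal (g x)) \<in> borel_measurable \<mu>w" by (subst measurable_cong_sets[OF sm(1) refl]) measurable
    qed (use sm lam ab Rm in auto)
    also have "(\<integral>\<^sup>+x. ennreal (g x) ^ 2 \<partial>\<mu>w) = (\<integral>\<^sup>+x. ennreal ((g x)\<^sup>2) \<partial>weighted w)"
      unfolding \<mu>w_def using gb by (intro nn_integral_cong) (simp add: ennreal_power)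
    also have "4 * \<dots> \<le> 4 * ennreal (G\<^sup>2)" by (intro mult_left_mono G) auto
    also have "4 * ennreal (G\<^sup>2) = ennreal (4 * G\<^sup>2)" by (simp add: ennreal_mult)
    finally show ?thesis .
  qed
  have CS: "(\<integral>\<^sup>+x. ennreal (m1 x) * ennreal (m2 x) \<partial>lebesgue) \<le> ennreal (4 * F * G)"
  proof (rule ennreal_le_of_square_le)
    \<comment> \<open>Lebesgue measure is split evenly: the square roots of the weight and of its
      inverse cancel in the product, and each factor lands in the space of its own maximal
      function.\<close>
    define f1 where "f1 x = ennreal (m1 x * sqrt (inverse (w x)))" for x
    define f2 where "f2 x = ennreal (m2 x * sqrt (w x))" for x
    have [measurable]: "f1 \<in> borel_measurable lebesgue" "f2 \<in> borel_measurable lebesgue"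
      unfolding f1_def f2_def by measurable
    have "(\<integral>\<^sup>+x. ennreal (m1 x) * ennreal (m2 x) \<partial>lebesgue) = (\<integral>\<^sup>+x. f1 x * f2 x \<partial>lebesgue)"
    proof (rule nn_integral_cong_AE)
      from wpos show "AE x in lebesgue. ennreal (m1 x) * ennreal (m2 x) = f1 x * f2 x"
      proof eventually_elim
        case (elim x)
        have "f1 x * f2 x = ennreal ((m1 x * sqrt (inverse (w x))) * (m2 x * sqrt (w x)))"
          unfolding f1_def f2_def using elim m1n m2n by (intro ennreal_mult[symmetric]) auto
        also have "sqrt (inverse (w x)) * sqrt (w x) = 1"
          using elim by (simp add: real_sqrt_mult[symmetric])
        then have "(m1 x * sqrt (inverse (w x))) * (m2 x * sqrt (w x)) = m1 x * m2 x"
          by (simp add: mult.assoc mult.left_commute)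
        finally show ?case using m1n m2n by (simp add: ennreal_mult)
      qed
    qed
    then have "(\<integral>\<^sup>+x. ennreal (m1 x) * ennreal (m2 x) \<partial>lebesgue)\<^sup>2 \<le> (\<integral>\<^sup>+x. f1 x ^ 2 \<partial>lebesgue) * (\<integral>\<^sup>+x. f2 x ^ 2 \<partial>lebesgue)"
      by (simp add: Cauchy_Schwarz_nn_integral)
    also have "(\<integral>\<^sup>+x. f1 x ^ 2 \<partial>lebesgue) = (\<integral>\<^sup>+x. ennreal (m1 x) ^ 2 \<partial>\<mu>s)"
    proof -
      have "(\<integral>\<^sup>+x. ennreal (m1 x) ^ 2 \<partial>\<mu>s) = (\<integral>\<^sup>+x. ennreal (inverse (w x)) * ennreal (m1 x) ^ 2 \<partial>lebesgue)"
        unfolding \<mu>s_def by (rule nn_integral_weighted(2)) measurable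
      also have "\<dots> = (\<integral>\<^sup>+x. f1 x ^ 2 \<partial>lebesgue)"
      proof (rule nn_integral_cong_AE)
        from wpos show "AE x in lebesgue. ennreal (inverse (w x)) * ennreal (m1 x) ^ 2 = f1 x ^ 2"
        proof eventually_elim
          case (elim x)
          have "f1 x ^ 2 = ennreal ((m1 x * sqrt (inverse (w x)))\<^sup>2)"
            unfolding f1_def using elim m1n by (intro ennreal_power) auto
          also have "(m1 x * sqrt (inverse (w x)))\<^sup>2 = inverse (w x) * (m1 x)\<^sup>2"
            using elim by (simp add: power_mult_distrib)
          also have "ennreal \<dots> = ennreal (inverse (w x)) * ennreal (m1 x) ^ 2"
            using elim m1n by (simp add: ennreal_mult ennreal_power)
          finally show ?case by simp
        qed
      qed
      finally show ?thesis by simp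
    qed
    also have "(\<integral>\<^sup>+x. f2 x ^ 2 \<partial>lebesgue) = (\<integral>\<^sup>+x. ennreal (m2 x) ^ 2 \<partial>\<mu>w)"
    proof -
      have "(\<integral>\<^sup>+x. ennreal (m2 x) ^ 2 \<partial>\<mu>w) = (\<integral>\<^sup>+x. ennreal (w x) * ennreal (m2 x) ^ 2 \<partial>lebesgue)"
        unfolding \<mu>w_def by (rule nn_integral_weighted(1)) measurable
      also have "\<dots> = (\<integral>\<^sup>+x. f2 x ^ 2 \<partial>lebesgue)"
      proof (rule nn_integral_cong_AE)
        from wpos show "AE x in lebesgue. ennreal (w x) * ennreal (m2 x) ^ 2 = f2 x ^ 2"
        proof eventually_elim
          case (elim x)
          have "f2 x ^ 2 = ennreal ((m2 x * sqrt (w x))\<^sup>2)"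
            unfolding f2_def using elim m2n by (intro ennreal_power) auto
          also have "(m2 x * sqrt (w x))\<^sup>2 = w x * (m2 x)\<^sup>2"
            using elim by (simp add: power_mult_distrib)
          also have "ennreal \<dots> = ennreal (w x) * ennreal (m2 x) ^ 2"
            using elim m2n by (simp add: ennreal_mult ennreal_power)
          finally show ?case by simp
        qed
      qed
      finally show ?thesis by simp
    qed
    also have "(\<integral>\<^sup>+x. ennreal (m1 x) ^ 2 \<partial>\<mu>s) * (\<integral>\<^sup>+x. ennreal (m2 x) ^ 2 \<partial>\<mu>w) \<le> ennreal (4 * F\<^sup>2) * ennreal (4 * G\<^sup>2)"
      by (intro mult_mono D1 D2) auto
    also have "\<dots> = ennreal (4 * F\<^sup>2 * (4 * G\<^sup>2))" by (intro ennreal_mult[symmetric]) auto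
    also have "4 * F\<^sup>2 * (4 * G\<^sup>2) = (4 * F * G)\<^sup>2" by (simp add: power2_eq_square)
    finally show "(\<integral>\<^sup>+x. ennreal (m1 x) * ennreal (m2 x) \<partial>lebesgue)\<^sup>2 \<le> ennreal ((4 * F * G)\<^sup>2)" .
  qed (use F G in auto)
  have termwise: "ennreal (mf j / m j) * \<nu> j \<le> ennreal (A2_const w * c) * (ennreal (a j * b j) * emeasure lebesgue (E j))"
    if j: "j \<in> J" for j
  proof -
    have "mf j / m j * n j = a j * b j * (mw j * ms j) / m j"
      using ms(2)[of j] mw(2)[of j] by (simp add: a_def b_def)
    also have "\<dots> \<le> a j * b j * (A2_const w * (m j)\<^sup>2) / m j"
      using mwms[of j] ab[of j] m(1)[of j] by (intro divide_right_mono mult_left_mono) auto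
    also have "\<dots> = A2_const w * (a j * b j) * m j"
      using m(1)[of j] by (simp add: power2_eq_square)
    finally have "ennreal (mf j / m j * n j) \<le> ennreal (A2_const w * (a j * b j) * m j)" by (rule ennreal_leI)
    also have "\<dots> = ennreal (A2_const w * (a j * b j)) * emeasure lebesgue (R j)"
      unfolding m(2) using A2_const_nonneg ab[of j] m(1)[of j] by (intro ennreal_mult) auto
    also have "\<dots> \<le> ennreal (A2_const w * (a j * b j)) * (ennreal c * emeasure lebesgue (E j))"
      using E(3)[OF j] by (intro mult_left_mono) (auto simp: R_def)
    also have "\<dots> = ennreal (A2_const w * (a j * b j) * c) * emeasure lebesgue (E j)"
      using A2_const_nonneg ab[of j] c by (subst ennreal_mult) (auto simp: mult.assoc)
    also have "A2_const w * (a j * b j) * c = A2_const w * c * (a j * b j)" by simp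
    also have "ennreal (A2_const w * c * (a j * b j)) = ennreal (A2_const w * c) * ennreal (a j * b j)"
      using A2_const_nonneg ab[of j] c by (intro ennreal_mult) auto
    finally show ?thesis
      using mf(2)[of j] m(1)[of j] n[of j] by (simp add: ennreal_mult[symmetric] mult.assoc)
  qed
  have "(\<Sum>j\<in>J. ennreal (mf j / m j) * \<nu> j) \<le> (\<Sum>j\<in>J. ennreal (A2_const w * c) * (ennreal (a j * b j) * emeasure lebesgue (E j)))"
    by (intro sum_mono termwise)
  also have "\<dots> = ennreal (A2_const w * c) * (\<Sum>j\<in>J. (\<integral>\<^sup>+x. ennreal (a j * b j) * indicator (E j) x \<partial>lebesgue))"
    using E(1) by (simp add: sum_distrib_left nn_integral_cmult_indicator)
  also have "(\<Sum>j\<in>J. (\<integral>\<^sup>+x. ennreal (a j * b j) * indicator (E j) x \<partial>lebesgue)) = (\<integral>\<^sup>+x. (\<Sum>j\<in>J. ennreal (a j * b j) * indicator (E j) x) \<partial>lebesgue)"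
    using E(1) by (intro nn_integral_sum[symmetric]) auto
  also have "ennreal (A2_const w * c) * \<dots> \<le> ennreal (A2_const w * c) * (\<integral>\<^sup>+x. ennreal (m1 x) * ennreal (m2 x) \<partial>lebesgue)"
  proof (intro mult_left_mono nn_integral_mono)
    fix x
    show "(\<Sum>j\<in>J. ennreal (a j * b j) * indicator (E j) x) \<le> ennreal (m1 x) * ennreal (m2 x)"
    proof (cases "\<exists>j\<in>J. x \<in> E j")
      case True
      then obtain j where j: "j \<in> J" "x \<in> E j" by blast
      have "x \<notin> E i" if "i \<in> J - {j}" for i
        using disj j that by (auto simp: disjoint_family_on_def)
      then have "(\<Sum>j\<in>J. ennreal (a j * b j) * indicator (E j) x) = ennreal (a j * b j)"
        using J j by (subst sum.remove[of J j]) auto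
      also have "\<dots> \<le> ennreal (m1 x * m2 x)"
      proof (intro ennreal_leI mult_mono)
        have "x \<in> R j" using E(2)[OF j(1)] j(2) by (auto simp: R_def)
        then show "a j \<le> m1 x" "b j \<le> m2 x"
          unfolding m1_def m2_def using j(1) by (auto intro: maxfun_ge[OF J])
      qed (use ab m1n in auto)
      also have "\<dots> = ennreal (m1 x) * ennreal (m2 x)" using m1n m2n by (simp add: ennreal_mult)
      finally show ?thesis .
    next
      case False
      then have "(\<Sum>j\<in>J. ennreal (a j * b j) * indicator (E j) x) = 0" by (intro sum.neutral) auto
      then show ?thesis by simp
    qed
  qed simp
  also have "\<dots> \<le> ennreal (A2_const w * c) * ennreal (4 * F * G)" by (intro mult_left_mono CS) auto
  also have "\<dots> = ennreal (A2_const w * c * (4 * F * G))"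
    using A2_const_nonneg c F G by (intro ennreal_mult[symmetric]) auto
  also have "A2_const w * c * (4 * F * G) = 4 * c * A2_const w * F * G" by simp
  finally show ?thesis by (simp add: mf_def m_def \<nu>_def R_def \<mu>w_def)
qed

end

section \<open>The weighted bound for bounded functions of bounded support\<close>

text \<open>The volume of the enclosing shifted cube divided by that of the original cube. The
  exponent \<open>j = 3 * (4 * d + 1)\<close> is the crude choice, justified by
  \<open>j < 2 ^ j\<close>.\<close>

definition scale_const :: "nat \<Rightarrow> real" where
  "scale_const d = (2 ^ (3 * (2 * (2 * d) + 1))) ^ d"

text \<open>In order: the sparse domination, the change from averages over dilates to averages over
  enclosing cubes, the number of grids, and \<open>4 * c\<close> from the bilinear estimate with
  \<open>c = 2 * scale_const d\<close>.\<close>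

definition local_const :: "nat \<Rightarrow> real \<Rightarrow> real \<Rightarrow> real \<Rightarrow> real" where
  "local_const d Ccz \<alpha> B = stop_const d Ccz \<alpha> B * scale_const d * 2 ^ d * (8 * scale_const d)"

text \<open>One local bound for each of the \<open>2 ^ d\<close> top cubes that meet at the
  origin.\<close>

definition weighted_const :: "nat \<Rightarrow> real \<Rightarrow> real \<Rightarrow> real \<Rightarrow> real" where
  "weighted_const d Ccz \<alpha> B = 2 ^ d * local_const d Ccz \<alpha> B"

text \<open>No dyadic cube of the unshifted grids crosses a coordinate hyperplane, so a ball around
  the origin needs a top cube in each orthant.\<close>

definition orthant :: "('n \<Rightarrow> bool) \<Rightarrow> 'n \<Rightarrow> int" where
  "orthant b i = (if b i then - 1 else 0)"

lemma card_bool_fun: "card (UNIV :: ('n::finite \<Rightarrow> bool) set) = 2 ^ CARD('n)"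
  by (simp add: card_fun)

context
  fixes Ccz \<alpha> :: real and K :: "real^'n \<Rightarrow> real^'n \<Rightarrow> complex" and T and w :: "real^'n \<Rightarrow> real"
  assumes \<alpha>: "0 < \<alpha>" and K: "CZ_kernel Ccz \<alpha> K"
    and T: "L2_bounded_operator lebesgue T" and TK: "has_kernel T K"
    and A2: "A2_weight w"
begin

lemma local_bound:
  fixes g :: "real^'n \<Rightarrow> real"
  assumes L: "0 < L" and f: "test_function f" and g [measurable]: "g \<in> borel_measurable lebesgue"
    and gb: "\<And>x. 0 \<le> g x" "\<And>x. g x \<le> Bg"
    and F: "0 \<le> F" "(\<integral>\<^sup>+x. ennreal ((cmod (f x))\<^sup>2) \<partial>weighted w) \<le> ennreal (F\<^sup>2)"
    and G: "0 \<le> G" "(\<integral>\<^sup>+x. ennreal ((g x)\<^sup>2) \<partial>weighted w) \<le> ennreal (G\<^sup>2)"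
  shows "(\<integral>\<^sup>+x. ennreal (cmod (T (restrict_to (dilate 0 L (2 * CARD('n)) p0) f) x)) * ennreal (g x) * indicator (dcube 0 L p0) x \<partial>weighted w)
    \<le> ennreal (local_const CARD('n) Ccz \<alpha> (L2_opnorm lebesgue T) * A2_const w * F * G)"
proof -
  define a where "a = 2 * CARD('n)"
  define j where "j = 3 * (2 * a + 1)"
  define c where "c = stop_const CARD('n) Ccz \<alpha> (L2_opnorm lebesgue T)"
  define L' where "L' = 2 ^ j * L"
  let ?C = "dcube (0::real^'n) L" and ?D = "dilate (0::real^'n) L a"
  define K0 where "K0 = ((2::real) ^ j) ^ CARD('n)"
  have K0: "K0 = scale_const CARD('n)" by (simp add: K0_def scale_const_def j_def a_def)
  have K01: "1 \<le> K0" unfolding K0_def by (intro one_le_power) auto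
  have L': "0 < L'" using L by (simp add: L'_def)
  have c0: "0 \<le> c" unfolding c_def by (rule stop_const_nonneg[OF \<alpha> K T TK])
  have j3: "3 * (2 * real a + 1) \<le> 2 ^ j"
  proof -
    have "real j < 2 ^ j" by (rule of_nat_less_two_power)
    then show ?thesis by (simp add: j_def)
  qed
  \<comment> \<open>Each dilate receives a shifted grid, named by \<open>bb q\<close>, and a cube of
    that grid at the same level.\<close>
  have "\<forall>q. \<exists>b m. ?D q \<subseteq> dcube (shift L' b :: real^'n) L' (fst q, m)"
    unfolding L'_def using one_third_cube[OF L j3] by blast
  then obtain bb mm where bm: "\<And>q. ?D q \<subseteq> dcube (shift L' (bb q) :: real^'n) L' (fst q, mm q)" by metis
  define R where "R q = dcube (shift L' (bb q) :: real^'n) L' (fst q, mm q)" for q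
  obtain S :: "(nat \<times> 'n dyadic_index) set" and E where S: "disjoint_family_on E S"
    "\<And>s. s \<in> S \<Longrightarrow> E s \<in> sets lebesgue" "\<And>s. s \<in> S \<Longrightarrow> E s \<subseteq> ?C (snd s)"
    "\<And>s. s \<in> S \<Longrightarrow> emeasure lebesgue (?C (snd s)) \<le> 2 * emeasure lebesgue (E s)"
    "AE x in lebesgue. x \<in> ?C p0 \<longrightarrow> ennreal (cmod (T (restrict_to (?D p0) f) x)) \<le>
       (\<integral>\<^sup>+s. ennreal (c * avg f L a (snd s)) * indicator (?C (snd s)) x \<partial>count_space S)"
    using sparse_domination[OF \<alpha> K T TK f L, of p0] unfolding a_def c_def by blast
  have Rm: "R q \<in> sets lebesgue" for q unfolding R_def by measurable
  have CR: "?C q \<subseteq> R q" for q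
    using bm[of q] dcube_subset_dilate[OF L, of 0 a 0 q] by (auto simp: R_def)
  define \<nu> where "\<nu> B = (\<integral>\<^sup>+x. ennreal (g x) * indicator B x \<partial>weighted w)" for B
  have gw: "(\<lambda>x. ennreal (g x)) \<in> borel_measurable (weighted w)"
    by (subst measurable_cong_sets[OF sets_weighted refl]) measurable
  have Cw: "?C q \<in> sets (weighted w)" for q using sets_weighted[of w] by (simp add: dilate_lebesgue)
  have "(\<integral>\<^sup>+x. ennreal (cmod (T (restrict_to (?D p0) f) x)) * ennreal (g x) * indicator (?C p0) x \<partial>weighted w) \<le>
     (\<integral>\<^sup>+x. (\<integral>\<^sup>+s. ennreal (c * avg f L a (snd s)) * (ennreal (g x) * indicator (?C (snd s)) x) \<partial>count_space S) \<partial>weighted w)"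
  proof (rule nn_integral_mono_AE)
    from AE_weighted[OF A2 S(5)]
    show "AE x in weighted w. ennreal (cmod (T (restrict_to (?D p0) f) x)) * ennreal (g x) * indicator (?C p0) x \<le>
      (\<integral>\<^sup>+s. ennreal (c * avg f L a (snd s)) * (ennreal (g x) * indicator (?C (snd s)) x) \<partial>count_space S)"
    proof eventually_elim
      case (elim x)
      have "(\<integral>\<^sup>+s. ennreal (c * avg f L a (snd s)) * (ennreal (g x) * indicator (?C (snd s)) x) \<partial>count_space S) =
         (\<integral>\<^sup>+s. ennreal (g x) * (ennreal (c * avg f L a (snd s)) * indicator (?C (snd s)) x) \<partial>count_space S)"
        by (intro nn_integral_cong) (simp add: mult.left_commute)
      also have "\<dots> = ennreal (g x) * (\<integral>\<^sup>+s. ennreal (c * avg f L a (snd s)) * indicator (?C (snd s)) x \<partial>count_space S)"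
        by (intro nn_integral_cmult) auto
      finally have eq: "(\<integral>\<^sup>+s. ennreal (c * avg f L a (snd s)) * (ennreal (g x) * indicator (?C (snd s)) x) \<partial>count_space S) =
         ennreal (g x) * (\<integral>\<^sup>+s. ennreal (c * avg f L a (snd s)) * indicator (?C (snd s)) x \<partial>count_space S)" .
      show ?case
      proof (cases "x \<in> ?C p0")
        case True
        then have "ennreal (cmod (T (restrict_to (?D p0) f) x)) * ennreal (g x) \<le>
          (\<integral>\<^sup>+s. ennreal (c * avg f L a (snd s)) * indicator (?C (snd s)) x \<partial>count_space S) * ennreal (g x)"
          using elim by (intro mult_right_mono) auto
        then show ?thesis using True unfolding eq by (simp add: mult.commute)
      qed simp
    qed
  qed
  also have "\<dots> = (\<integral>\<^sup>+s. (\<integral>\<^sup>+x. ennreal (c * avg f L a (snd s)) * (ennreal (g x) * indicator (?C (snd s)) x) \<partial>weighted w) \<partial>count_space S)"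
    using gw Cw by (intro nn_integral_count_space_nn_integral) auto
  also have "\<dots> = (\<integral>\<^sup>+s. ennreal (c * avg f L a (snd s)) * \<nu> (?C (snd s)) \<partial>count_space S)"
    unfolding \<nu>_def using gw Cw by (intro nn_integral_cong nn_integral_cmult) auto
  also have "\<dots> \<le> ennreal (local_const CARD('n) Ccz \<alpha> (L2_opnorm lebesgue T) * A2_const w * F * G)"
  proof (rule nn_integral_count_space_le)
    fix J assume J: "finite J" "J \<subseteq> S"
    define X where "X q = ennreal (measure (modulus_measure f) (R q) / measure lebesgue (R q)) * \<nu> (R q)" for q
    have mC: "measure lebesgue (?C q) = (L / 2 ^ fst q) ^ CARD('n)" for q
      using emeasure_dilate[OF L, of 0 0 q] L by (simp add: measure_def)
    have mR: "measure lebesgue (R q) = K0 * measure lebesgue (?C q)" for q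
    proof -
      have "measure lebesgue (R q) = (2 ^ j * L / 2 ^ fst q) ^ CARD('n)"
        using emeasure_dilate[OF L', of "shift L' (bb q)" 0 "(fst q, mm q)"] L by (simp add: measure_def R_def L'_def)
      also have "2 ^ j * L / 2 ^ fst q = 2 ^ j * (L / 2 ^ fst q)" by simp
      finally show ?thesis by (simp only: power_mult_distrib mC K0_def)
    qed
    have mCpos: "0 < measure lebesgue (?C q)" for q by (rule emeasure_dilate_measure(2)[OF L])
    have termwise: "ennreal (c * avg f L a q) * \<nu> (?C q) \<le> ennreal (c * K0) * X q" for q
    proof -
      have "measure (modulus_measure f) (?D q) \<le> measure (modulus_measure f) (R q)"
        unfolding measure_def
      proof (rule enn2real_mono)
        show "emeasure (modulus_measure f) (?D q) \<le> emeasure (modulus_measure f) (R q)"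
          using bm[of q] Rm[of q] by (intro emeasure_mono) (auto simp: R_def)
        show "emeasure (modulus_measure f) (R q) < top" using emeasure_modulus_measure_le[OF f, of "R q"] by (auto intro: le_less_trans)
      qed
      moreover have "measure lebesgue (?C q) \<le> measure lebesgue (?D q)"
        unfolding measure_def
        using emeasure_dilate_finite[OF L, of 0 a q] dcube_subset_dilate[OF L, of 0 a 0 q]
        by (intro enn2real_mono emeasure_mono) auto
      \<comment> \<open>The mass over the dilate is increased to that over \<open>R q\<close> and
        its volume is decreased to that of the cube; the ratio of volumes \<open>K0\<close> then
        restores an average over \<open>R q\<close>.\<close>
      ultimately have "avg f L a q \<le> measure (modulus_measure f) (R q) / measure lebesgue (?C q)"
        unfolding avg_def using mCpos[of q] by (intro frac_le) auto
      also have "\<dots> = K0 * (measure (modulus_measure f) (R q) / measure lebesgue (R q))"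
        using K01 by (simp add: mR)
      finally have "c * avg f L a q \<le> c * K0 * (measure (modulus_measure f) (R q) / measure lebesgue (R q))"
        unfolding mult.assoc using c0 by (rule mult_left_mono)
      then have "ennreal (c * avg f L a q) \<le> ennreal (c * K0 * (measure (modulus_measure f) (R q) / measure lebesgue (R q)))"
        by (rule ennreal_leI)
      also have "\<dots> = ennreal (c * K0) * ennreal (measure (modulus_measure f) (R q) / measure lebesgue (R q))"
        using c0 K01 by (intro ennreal_mult) auto
      finally have 1: "ennreal (c * avg f L a q) \<le> ennreal (c * K0) * ennreal (measure (modulus_measure f) (R q) / measure lebesgue (R q))" .
      have "\<nu> (?C q) \<le> \<nu> (R q)"
        unfolding \<nu>_def using CR[of q] by (intro nn_integral_mono mult_left_mono) (auto simp: indicator_def)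
      with 1 have "ennreal (c * avg f L a q) * \<nu> (?C q) \<le>
        ennreal (c * K0) * ennreal (measure (modulus_measure f) (R q) / measure lebesgue (R q)) * \<nu> (R q)"
        by (intro mult_mono) auto
      then show ?thesis by (simp add: X_def mult.assoc)
    qed
    \<comment> \<open>Nestedness holds within one grid, so the bilinear estimate is applied to the
      cubes of each grid separately.\<close>
    have group: "(\<Sum>s\<in>{s\<in>J. bb (snd s) = b}. X (snd s)) \<le> ennreal (4 * (2 * K0) * A2_const w * F * G)" for b
    proof -
      define Jb where "Jb = {s\<in>J. bb (snd s) = b}"
      define r where "r s = (fst (snd s), mm (snd s))" for s :: "nat \<times> 'n dyadic_index"
      have Rb: "R (snd s) = dcube (shift L' b) L' (r s)" if "s \<in> Jb" for s
        using that by (simp add: R_def r_def Jb_def)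
      have "(\<Sum>s\<in>Jb. X (snd s)) = (\<Sum>s\<in>Jb. ennreal (measure (modulus_measure f) (dcube (shift L' b) L' (r s)) / measure lebesgue (dcube (shift L' b) L' (r s))) *
          (\<integral>\<^sup>+x. ennreal (g x) * indicator (dcube (shift L' b) L' (r s)) x \<partial>weighted w))"
        by (intro sum.cong refl) (simp add: X_def \<nu>_def Rb)
      also have "\<dots> \<le> ennreal (4 * (2 * K0) * A2_const w * F * G)"
      proof (rule weighted_bilinear[OF A2 _ L' _ _ _ _ _ f g gb F G])
        show "finite Jb" using J by (simp add: Jb_def)
        show "disjoint_family_on E Jb" using disjoint_family_on_mono[OF _ S(1), of Jb] J by (auto simp: Jb_def)
        fix s assume s: "s \<in> Jb"
        then have sS: "s \<in> S" using J by (auto simp: Jb_def)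
        show "E s \<in> sets lebesgue" by (rule S(2)[OF sS])
        show "E s \<subseteq> dcube (shift L' b) L' (r s)" using S(3)[OF sS] CR[of "snd s"] Rb[OF s] by auto
        \<comment> \<open>The sets \<open>E s\<close> stay as they are: they lie in the larger cubes
          \<open>R (snd s)\<close> and fill at least the fraction \<open>1 / (2 * K0)\<close> of
          them.\<close>
        have "emeasure lebesgue (R (snd s)) = ennreal K0 * emeasure lebesgue (?C (snd s))"
          using mR[of "snd s"] emeasure_dilate_measure(1)[OF L, of 0 0 "snd s"]
            emeasure_dilate_measure(1)[OF L', of "shift L' (bb (snd s))" 0 "(fst (snd s), mm (snd s))"] K01
          by (simp add: R_def[symmetric] ennreal_mult)
        also have "\<dots> \<le> ennreal K0 * (2 * emeasure lebesgue (E s))"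
          by (intro mult_left_mono S(4)[OF sS]) auto
        also have "\<dots> = ennreal (2 * K0) * emeasure lebesgue (E s)"
          using K01 by (simp add: ennreal_mult mult.assoc mult.left_commute)
        finally show "emeasure lebesgue (dcube (shift L' b) L' (r s)) \<le> ennreal (2 * K0) * emeasure lebesgue (E s)"
          by (simp add: Rb[OF s])
      qed (use K01 in auto)
      finally show ?thesis by (simp add: Jb_def)
    qed
    have A2n: "0 \<le> A2_const w" by (rule A2_const_nonneg)
    have "(\<Sum>s\<in>J. ennreal (c * avg f L a (snd s)) * \<nu> (?C (snd s))) \<le> (\<Sum>s\<in>J. ennreal (c * K0) * X (snd s))"
      by (intro sum_mono termwise)
    also have "\<dots> = ennreal (c * K0) * (\<Sum>b\<in>(UNIV :: ('n \<Rightarrow> bool) set). \<Sum>s\<in>{s\<in>J. bb (snd s) = b}. X (snd s))"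
      unfolding sum_distrib_left[symmetric]
      using J by (subst sum.group[where g = "\<lambda>s. bb (snd s)"]) auto
    also have "\<dots> \<le> ennreal (c * K0) * (\<Sum>b\<in>(UNIV :: ('n \<Rightarrow> bool) set). ennreal (4 * (2 * K0) * A2_const w * F * G))"
      by (intro mult_left_mono sum_mono group) auto
    also have "\<dots> = ennreal (c * K0) * (ennreal (2 ^ CARD('n)) * ennreal (4 * (2 * K0) * A2_const w * F * G))"
      by (simp add: card_bool_fun ennreal_power[symmetric])
    also have "\<dots> = ennreal (c * K0 * (2 ^ CARD('n) * (4 * (2 * K0) * A2_const w * F * G)))"
    proof -
      have "0 \<le> c * K0" "0 \<le> 4 * (2 * K0) * A2_const w * F * G" using c0 K01 A2n F G by auto
      then show ?thesis by (simp only: ennreal_mult mult_nonneg_nonneg zero_le_power zero_le_numeral)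
    qed
    also have "c * K0 * (2 ^ CARD('n) * (4 * (2 * K0) * A2_const w * F * G)) = local_const CARD('n) Ccz \<alpha> (L2_opnorm lebesgue T) * A2_const w * F * G"
      by (simp add: local_const_def K0 c_def)
    finally show "(\<Sum>s\<in>J. ennreal (c * avg f L a (snd s)) * \<nu> (?C (snd s))) \<le> ennreal (local_const CARD('n) Ccz \<alpha> (L2_opnorm lebesgue T) * A2_const w * F * G)" .
  qed
  finally show ?thesis by (simp add: a_def)
qed

lemma local_const_nonneg: "0 \<le> local_const CARD('n) Ccz \<alpha> (L2_opnorm lebesgue T)"
  unfolding local_const_def scale_const_def using stop_const_nonneg[OF \<alpha> K T TK] by simp

lemma weighted_const_nonneg: "0 \<le> weighted_const CARD('n) Ccz \<alpha> (L2_opnorm lebesgue T)"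
  unfolding weighted_const_def using local_const_nonneg by simp

text \<open>With top cubes this large, the dilate of each contains the support of \<open>f\<close>,
  so restricting \<open>f\<close> to it changes nothing, and together the top cubes cover the
  support of \<open>g\<close>.\<close>

lemma bilinear_bound:
  fixes g :: "real^'n \<Rightarrow> real"
  assumes f: "test_function f" and g [measurable]: "g \<in> borel_measurable lebesgue"
    and gb: "\<And>x. 0 \<le> g x" "\<And>x. g x \<le> Bg" and gs: "\<And>x. g x \<noteq> 0 \<Longrightarrow> norm x \<le> Rg"
    and F: "0 \<le> F" "(\<integral>\<^sup>+x. ennreal ((cmod (f x))\<^sup>2) \<partial>weighted w) \<le> ennreal (F\<^sup>2)"
    and G: "0 \<le> G" "(\<integral>\<^sup>+x. ennreal ((g x)\<^sup>2) \<partial>weighted w) \<le> ennreal (G\<^sup>2)"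
  shows "(\<integral>\<^sup>+x. ennreal (cmod (T f x)) * ennreal (g x) \<partial>weighted w) \<le> ennreal (weighted_const CARD('n) Ccz \<alpha> (L2_opnorm lebesgue T) * A2_const w * F * G)"
proof -
  obtain Rf where Rf: "0 < Rf" "\<And>x. f x \<noteq> 0 \<Longrightarrow> norm x \<le> Rf" using test_function_radius[OF f] by metis
  define L where "L = max Rf Rg + 1"
  have L: "0 < L" using Rf by (simp add: L_def)
  define a where "a = 2 * CARD('n)"
  have a1: "1 \<le> a" by (simp add: a_def Suc_le_eq)
  have rf: "restrict_to (dilate 0 L a (0, orthant b)) f = f" for b
  proof
    fix x
    show "restrict_to (dilate 0 L a (0, orthant b)) f x = f x"
    proof (cases "f x = 0")
      case False
      have "x \<in> dilate 0 L a (0, orthant b)"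
        unfolding mem_dilate
      proof
        fix i
        have "\<bar>x $ i\<bar> < L" using component_le_norm_cart[of x i] Rf(2)[OF False] by (simp add: L_def)
        moreover have "orthant b i = -1 \<or> orthant b i = 0" by (simp add: orthant_def)
        then have mi: "of_int (orthant b i) - real a \<le> -1" "1 \<le> of_int (orthant b i) + 1 + real a"
          using a1 by auto
        then have "(of_int (orthant b i) - real a) * L \<le> -1 * L" "1 * L \<le> (of_int (orthant b i) + 1 + real a) * L"
          using L by (intro mult_right_mono; simp)+
        then have "(of_int (orthant b i) - real a) * L \<le> - L" "L \<le> (of_int (orthant b i) + 1 + real a) * L" by simp_all
        ultimately have "(of_int (orthant b i) - real a) * L \<le> x $ i" "x $ i < (of_int (orthant b i) + 1 + real a) * L"
          unfolding abs_less_iff by linarith+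
        then show "(of_int (snd (0, orthant b) i) - real a) * (L / 2 ^ fst (0::nat, orthant b)) \<le> x $ i - 0 $ i \<and>
           x $ i - 0 $ i < (of_int (snd (0, orthant b) i) + 1 + real a) * (L / 2 ^ fst (0::nat, orthant b))"
          by simp
      qed
      then show ?thesis by (simp add: restrict_to_def)
    qed (simp add: restrict_to_def)
  qed
  have cover: "\<exists>b. x \<in> dcube 0 L (0, orthant b)" if "g x \<noteq> 0" for x
  proof -
    have xi: "\<bar>x $ i\<bar> < L" for i using component_le_norm_cart[of x i] gs[OF that] by (simp add: L_def)
    define b where "b i \<longleftrightarrow> x $ i < 0" for i
    have "x \<in> dcube 0 L (0, orthant b)"
      unfolding mem_dilate
    proof
      fix i
      show "(of_int (snd (0, orthant b) i) - real 0) * (L / 2 ^ fst (0::nat, orthant b)) \<le> x $ i - 0 $ i \<and>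
           x $ i - 0 $ i < (of_int (snd (0, orthant b) i) + 1 + real 0) * (L / 2 ^ fst (0::nat, orthant b))"
        using xi[of i] by (auto simp: orthant_def b_def abs_less_iff)
    qed
    then show ?thesis by blast
  qed
  have Tm: "T f \<in> borel_measurable lebesgue"
    by (rule L2_space_measurable[OF op_L2[OF T test_function_L2[OF f]]])
  have meas: "(\<lambda>x. ennreal (cmod (T f x)) * ennreal (g x) * indicator (dcube 0 L (0, orthant b)) x) \<in> borel_measurable (weighted w)" for b
    unfolding measurable_cong_sets[OF sets_weighted refl] using Tm by measurable
  have "(\<integral>\<^sup>+x. ennreal (cmod (T f x)) * ennreal (g x) \<partial>weighted w) \<le>
    (\<integral>\<^sup>+x. (\<Sum>b\<in>(UNIV :: ('n \<Rightarrow> bool) set). ennreal (cmod (T f x)) * ennreal (g x) * indicator (dcube 0 L (0, orthant b)) x) \<partial>weighted w)"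
  proof (rule nn_integral_mono)
    fix x
    show "ennreal (cmod (T f x)) * ennreal (g x) \<le> (\<Sum>b\<in>(UNIV :: ('n \<Rightarrow> bool) set). ennreal (cmod (T f x)) * ennreal (g x) * indicator (dcube 0 L (0, orthant b)) x)"
    proof (cases "g x = 0")
      case False
      then obtain b where b: "x \<in> dcube 0 L (0, orthant b)" using cover by blast
      have "ennreal (cmod (T f x)) * ennreal (g x) = ennreal (cmod (T f x)) * ennreal (g x) * indicator (dcube 0 L (0, orthant b)) x"
        using b by simp
      also have "\<dots> \<le> (\<Sum>b\<in>(UNIV :: ('n \<Rightarrow> bool) set). ennreal (cmod (T f x)) * ennreal (g x) * indicator (dcube 0 L (0, orthant b)) x)"
        by (intro member_le_sum) auto
      finally show ?thesis .
    qed simp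
  qed
  also have "\<dots> = (\<Sum>b\<in>(UNIV :: ('n \<Rightarrow> bool) set). (\<integral>\<^sup>+x. ennreal (cmod (T f x)) * ennreal (g x) * indicator (dcube 0 L (0, orthant b)) x \<partial>weighted w))"
    by (rule nn_integral_sum) (rule meas)
  also have "\<dots> \<le> (\<Sum>b\<in>(UNIV :: ('n \<Rightarrow> bool) set). ennreal (local_const CARD('n) Ccz \<alpha> (L2_opnorm lebesgue T) * A2_const w * F * G))"
  proof (rule sum_mono)
    fix b :: "'n \<Rightarrow> bool"
    show "(\<integral>\<^sup>+x. ennreal (cmod (T f x)) * ennreal (g x) * indicator (dcube 0 L (0, orthant b)) x \<partial>weighted w) \<le> ennreal (local_const CARD('n) Ccz \<alpha> (L2_opnorm lebesgue T) * A2_const w * F * G)"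
      using local_bound[OF L f g gb F G, of "(0, orthant b)"] rf[of b] by (simp add: a_def)
  qed
  also have "\<dots> = ennreal (2 ^ CARD('n)) * ennreal (local_const CARD('n) Ccz \<alpha> (L2_opnorm lebesgue T) * A2_const w * F * G)"
    by (simp add: card_bool_fun ennreal_power[symmetric])
  also have "\<dots> = ennreal (2 ^ CARD('n) * (local_const CARD('n) Ccz \<alpha> (L2_opnorm lebesgue T) * A2_const w * F * G))"
    by (intro ennreal_mult'[symmetric]) auto
  also have "2 ^ CARD('n) * (local_const CARD('n) Ccz \<alpha> (L2_opnorm lebesgue T) * A2_const w * F * G) = weighted_const CARD('n) Ccz \<alpha> (L2_opnorm lebesgue T) * A2_const w * F * G"
    by (simp add: weighted_const_def)
  finally show ?thesis .
qed

text \<open>Testing with truncations \<open>g\<close> of \<open>|T f|\<close> itself: \<open>g\<^sup>2 \<le> |T f| g\<close> turns the bilinear bound into a norm bound.\<close>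

lemma test_function_weighted_bound:
  assumes f: "test_function f" and F: "0 \<le> F" "(\<integral>\<^sup>+x. ennreal ((cmod (f x))\<^sup>2) \<partial>weighted w) \<le> ennreal (F\<^sup>2)"
  shows "(\<integral>\<^sup>+x. ennreal ((cmod (T f x))\<^sup>2) \<partial>weighted w) \<le> ennreal ((weighted_const CARD('n) Ccz \<alpha> (L2_opnorm lebesgue T) * A2_const w * F)\<^sup>2)"
proof -
  define X where "X = weighted_const CARD('n) Ccz \<alpha> (L2_opnorm lebesgue T) * A2_const w * F"
  have X: "0 \<le> X" unfolding X_def using weighted_const_nonneg A2_const_nonneg F by auto
  have Tm [measurable]: "T f \<in> borel_measurable lebesgue"
    by (rule L2_space_measurable[OF op_L2[OF T test_function_L2[OF f]]])
  \<comment> \<open>Cut off in space and in height so that the weighted norm \<open>G\<close> is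
    finite: the bound \<open>G\<^sup>2 \<le> X * G\<close> is divided by \<open>G\<close>.\<close>
  define g where "g n x = (if norm x \<le> real n then min (cmod (T f x)) (real n) else 0)" for n and x :: "real^'n"
  have "(\<lambda>x::real^'n. norm x) \<in> borel_measurable lebesgue" by (intro measurable_completion) simp
  then have gm [measurable]: "g n \<in> borel_measurable lebesgue" for n unfolding g_def by measurable
  have gb: "0 \<le> g n x" "g n x \<le> real n" "g n x \<le> cmod (T f x)" for n x by (auto simp: g_def)
  have gs: "norm x \<le> real n" if "g n x \<noteq> 0" for n x using that by (auto simp: g_def split: if_splits)
  have gle: "(\<integral>\<^sup>+x. ennreal ((g n x)\<^sup>2) \<partial>weighted w) \<le> ennreal (X\<^sup>2)" for n
  proof -
    define Y where "Y = (\<integral>\<^sup>+x. ennreal ((g n x)\<^sup>2) \<partial>weighted w)"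
    have "Y \<le> (\<integral>\<^sup>+x. ennreal ((real n)\<^sup>2) * indicator (cball 0 (real n)) x \<partial>weighted w)"
      unfolding Y_def using gb by (intro nn_integral_mono) (auto simp: indicator_def g_def intro!: ennreal_leI power_mono)
    also have "\<dots> = ennreal ((real n)\<^sup>2) * emeasure (weighted w) (cball 0 (real n))"
      using sets_weighted[of w] by (intro nn_integral_cmult_indicator) auto
    also have "\<dots> < \<infinity>"
      using emeasure_weighted_bounded[OF A2, of "cball 0 (real n)"] by (auto simp: ennreal_mult_less_top)
    finally obtain y where y: "Y = ennreal y" "0 \<le> y" by (cases Y) auto
    define G where "G = sqrt y"
    have G: "0 \<le> G" "y = G\<^sup>2" using y by (auto simp: G_def)
    have "Y \<le> (\<integral>\<^sup>+x. ennreal (cmod (T f x)) * ennreal (g n x) \<partial>weighted w)"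
      unfolding Y_def
    proof (intro nn_integral_mono)
      fix x
      have "ennreal ((g n x)\<^sup>2) \<le> ennreal (cmod (T f x) * g n x)"
        using gb[of n x] by (intro ennreal_leI) (auto simp: power2_eq_square intro!: mult_right_mono)
      then show "ennreal ((g n x)\<^sup>2) \<le> ennreal (cmod (T f x)) * ennreal (g n x)"
        using gb by (simp add: ennreal_mult)
    qed
    also have "\<dots> \<le> ennreal (weighted_const CARD('n) Ccz \<alpha> (L2_opnorm lebesgue T) * A2_const w * F * G)"
      using G y by (intro bilinear_bound[OF f gm gb(1,2) gs F]) (auto simp: Y_def)
    finally have "G\<^sup>2 \<le> X * G"
      using X G unfolding y(1) X_def by (subst (asm) ennreal_le_iff) auto
    then have "G \<le> X" using G X by (cases "G = 0") (auto simp: power2_eq_square)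
    then have "ennreal (G\<^sup>2) \<le> ennreal (X\<^sup>2)" using G by (intro ennreal_leI power_mono) auto
    then show ?thesis using y G by (simp add: Y_def)
  qed
  show ?thesis
    unfolding X_def[symmetric]
  proof (rule nn_integral_fatou_le[where u = "\<lambda>n x. ennreal ((g n x)\<^sup>2)"])
    show "(\<lambda>x. ennreal ((g n x)\<^sup>2)) \<in> borel_measurable (weighted w)" for n
      unfolding measurable_cong_sets[OF sets_weighted refl] by measurable
    show "AE x in weighted w. (\<lambda>n. ennreal ((g n x)\<^sup>2)) \<longlonglongrightarrow> ennreal ((cmod (T f x))\<^sup>2)"
    proof (intro always_eventually allI)
      fix x
      have "\<forall>\<^sub>F n in sequentially. max (norm x) (cmod (T f x)) \<le> real n"
        using filterlim_real_sequentially by (rule filterlim_at_top[THEN iffD1, rule_format])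
      then have "\<forall>\<^sub>F n in sequentially. ennreal ((g n x)\<^sup>2) = ennreal ((cmod (T f x))\<^sup>2)"
        by eventually_elim (simp add: g_def)
      then show "(\<lambda>n. ennreal ((g n x)\<^sup>2)) \<longlonglongrightarrow> ennreal ((cmod (T f x))\<^sup>2)"
        by (rule tendsto_eventually)
    qed
  qed (rule gle)
qed

end

section \<open>Extension to the weighted space\<close>

text \<open>
  Convergence in \<open>L\<^sup>2\<close> is expressed by the squared distance, for which the triangle inequality with an
  additional factor 2 suffices.
\<close>

definition sq_dist :: "'a measure \<Rightarrow> ('a \<Rightarrow> complex) \<Rightarrow> ('a \<Rightarrow> complex) \<Rightarrow> ennreal" where
  "sq_dist M f g = (\<integral>\<^sup>+x. ennreal ((cmod (f x - g x))\<^sup>2) \<partial>M)"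

lemma sq_dist_commute: "sq_dist M f g = sq_dist M g f"
  by (simp add: sq_dist_def norm_minus_commute)

lemma sq_dist_triangle:
  assumes [measurable]: "f \<in> borel_measurable M" "g \<in> borel_measurable M" "h \<in> borel_measurable M"
  shows "sq_dist M f h \<le> ennreal 2 * sq_dist M f g + ennreal 2 * sq_dist M g h"
proof -
  have "sq_dist M f h = (\<integral>\<^sup>+x. ennreal ((cmod ((f x - g x) + (g x - h x)))\<^sup>2) \<partial>M)" by (simp add: sq_dist_def)
  also have "\<dots> \<le> 2 * (\<integral>\<^sup>+x. ennreal ((cmod (f x - g x))\<^sup>2) \<partial>M) + 2 * (\<integral>\<^sup>+x. ennreal ((cmod (g x - h x))\<^sup>2) \<partial>M)"
    by (rule nn_integral_add_squared_le) measurable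
  finally show ?thesis by (simp add: sq_dist_def)
qed

lemma sq_dist_cong_AE:
  assumes "AE x in M. f x = f' x" "AE x in M. g x = g' x"
  shows "sq_dist M f g = sq_dist M f' g'"
  unfolding sq_dist_def
  by (rule nn_integral_cong_AE) (use assms in \<open>eventually_elim, simp\<close>)

lemma sq_dist_eq_0_iff:
  assumes "f \<in> borel_measurable M" "g \<in> borel_measurable M"
  shows "sq_dist M f g = 0 \<longleftrightarrow> (AE x in M. f x = g x)"
  unfolding sq_dist_def using assms by (subst nn_integral_0_iff_AE) auto

lemma tendsto_0_bound2:
  fixes x u v :: "nat \<Rightarrow> ennreal"
  assumes "\<And>n. x n \<le> ennreal c * u n + ennreal d * v n" "u \<longlonglongrightarrow> 0" "v \<longlonglongrightarrow> 0"
  shows "x \<longlonglongrightarrow> 0"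
proof (rule tendsto_sandwich[OF always_eventually always_eventually tendsto_const])
  have "(\<lambda>n. ennreal c * u n + ennreal d * v n) \<longlonglongrightarrow> ennreal c * 0 + ennreal d * 0"
    by (intro tendsto_add ennreal_tendsto_cmult assms) auto
  then show "(\<lambda>n. ennreal c * u n + ennreal d * v n) \<longlonglongrightarrow> 0" by simp
qed (use assms in auto)

lemma sq_dist_limit_unique:
  assumes m: "\<And>n. u n \<in> borel_measurable M" "f \<in> borel_measurable M" "g \<in> borel_measurable M"
    and "(\<lambda>n. sq_dist M (u n) f) \<longlonglongrightarrow> 0" "(\<lambda>n. sq_dist M (u n) g) \<longlonglongrightarrow> 0"
  shows "AE x in M. f x = g x"
proof -
  have "(\<lambda>n::nat. sq_dist M f g) \<longlonglongrightarrow> 0"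
  proof (rule tendsto_0_bound2)
    show "sq_dist M f g \<le> ennreal 2 * sq_dist M (u n) f + ennreal 2 * sq_dist M (u n) g" for n
      using sq_dist_triangle[OF m(2) m(1)[of n] m(3)] by (simp add: sq_dist_commute[of M f])
  qed (use assms in auto)
  then have "sq_dist M f g = 0" using LIMSEQ_unique[OF tendsto_const] by blast
  then show ?thesis using m by (simp add: sq_dist_eq_0_iff)
qed

section \<open>Limits and completeness\<close>

lemma sq_dist_AE_subseq:
  assumes u: "\<And>n. u n \<in> L2_space M" and h: "h \<in> L2_space M" and lim: "(\<lambda>n. sq_dist M (u n) h) \<longlonglongrightarrow> 0"
  shows "\<exists>r. strict_mono (r :: nat \<Rightarrow> nat) \<and> (AE x in M. (\<lambda>n. u (r n) x) \<longlonglongrightarrow> h x)"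
proof -
  define D where "D = (\<lambda>n x. (cmod (u n x - h x))\<^sup>2)"
  have int: "integrable M (D n)" for n
    using L2_space_diff[OF u h, of n] by (simp add: D_def L2_space_def)
  have "(LINT x|M. norm (D n x)) = enn2real (sq_dist M (u n) h)" for n
  proof -
    have "sq_dist M (u n) h = ennreal (LINT x|M. D n x)"
      unfolding sq_dist_def using int[of n] by (subst nn_integral_eq_integral[symmetric]) (auto simp: D_def)
    moreover have "0 \<le> (LINT x|M. D n x)" by (simp add: D_def)
    moreover have "norm (D n x) = D n x" for x by (simp add: D_def)
    ultimately show ?thesis by simp
  qed
  moreover have "(\<lambda>n. enn2real (sq_dist M (u n) h)) \<longlonglongrightarrow> 0"
    by (rule tendsto_enn2real[where l = 0]) (use lim in simp_all)
  ultimately have "(\<lambda>n. (LINT x|M. norm (D n x))) \<longlonglongrightarrow> 0" by simp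
  from tendsto_L1_AE_subseq[OF int this] obtain r :: "nat \<Rightarrow> nat" where r: "strict_mono r"
    "AE x in M. (\<lambda>n. D (r n) x) \<longlonglongrightarrow> 0" by blast
  from r(2) have "AE x in M. (\<lambda>n. u (r n) x) \<longlonglongrightarrow> h x"
  proof eventually_elim
    case (elim x)
    then have "(\<lambda>n. sqrt (D (r n) x)) \<longlonglongrightarrow> sqrt 0" by (intro tendsto_real_sqrt)
    then have "(\<lambda>n. cmod (u (r n) x - h x)) \<longlonglongrightarrow> 0" by (simp add: D_def)
    then have "(\<lambda>n. u (r n) x - h x) \<longlonglongrightarrow> 0" by (rule tendsto_norm_zero_cancel)
    then show ?case by (rule LIM_zero_cancel)
  qed
  with r(1) show ?thesis by blast
qed

text \<open>The limit is taken in one measure and the bound holds in another one with at least as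
  many null sets. An almost everywhere convergent subsequence and Fatou's lemma connect
  them.\<close>

lemma sq_dist_limit_bound:
  assumes u: "\<And>n. u n \<in> L2_space M" and h: "h \<in> L2_space M" and lim: "(\<lambda>n. sq_dist M (u n) h) \<longlonglongrightarrow> 0"
    and N: "\<And>P. AE x in M. P x \<Longrightarrow> AE x in N. P x" "sets N = sets M"
    and le: "\<And>n. (\<integral>\<^sup>+x. ennreal ((cmod (u n x))\<^sup>2) \<partial>N) \<le> X"
  shows "(\<integral>\<^sup>+x. ennreal ((cmod (h x))\<^sup>2) \<partial>N) \<le> X"
proof -
  obtain r :: "nat \<Rightarrow> nat" where r: "strict_mono r" "AE x in M. (\<lambda>n. u (r n) x) \<longlonglongrightarrow> h x"
    using sq_dist_AE_subseq[OF u h lim] by blast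
  show ?thesis
  proof (rule nn_integral_fatou_le[where u = "\<lambda>n x. ennreal ((cmod (u (r n) x))\<^sup>2)"])
    have "u n \<in> borel_measurable N" for n
      using L2_space_measurable[OF u] measurable_cong_sets[OF N(2) refl] by blast
    then show "(\<lambda>x. ennreal ((cmod (u (r n) x))\<^sup>2)) \<in> borel_measurable N" for n by measurable
    show "AE x in N. (\<lambda>n. ennreal ((cmod (u (r n) x))\<^sup>2)) \<longlonglongrightarrow> ennreal ((cmod (h x))\<^sup>2)"
      using N(1)[OF r(2)] by eventually_elim (intro tendsto_ennrealI tendsto_power tendsto_norm)
  qed (rule le)
qed

text \<open>Riesz-Fischer: a rapidly convergent subsequence converges almost everywhere, and Fatou's
  lemma shows that its limit is the limit of the whole sequence in the mean.\<close>

lemma L2_complete: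
  assumes u: "\<And>n. u n \<in> L2_space M"
    and cauchy: "\<And>e. 0 < e \<Longrightarrow> \<exists>N. \<forall>m\<ge>N. \<forall>n\<ge>N. sq_dist M (u m) (u n) \<le> ennreal e"
  shows "\<exists>h. h \<in> L2_space M \<and> (\<lambda>n. sq_dist M (u n) h) \<longlonglongrightarrow> 0"
proof -
  have um [measurable]: "u n \<in> borel_measurable M" for n by (rule L2_space_measurable[OF u])
  have "\<exists>N. \<forall>m\<ge>N. \<forall>n\<ge>N. sq_dist M (u m) (u n) \<le> ennreal ((1/4) ^ k)" for k :: nat
    by (rule cauchy) simp
  then obtain N where N: "\<And>k m n. N k \<le> m \<Longrightarrow> N k \<le> n \<Longrightarrow> sq_dist M (u m) (u n) \<le> ennreal ((1/4) ^ k)" by metis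
  \<comment> \<open>Summing the \<open>N i\<close> makes \<open>r\<close> nondecreasing and at least
    \<open>N k\<close>; the summand \<open>k\<close> makes it unbounded.\<close>
  define r where "r k = k + (\<Sum>i\<le>k. N i)" for k
  have rN: "N k \<le> r k" for k unfolding r_def by (intro trans_le_add2 member_le_sum) auto
  have rS: "r k \<le> r (Suc k)" and rk: "k \<le> r k" for k by (simp_all add: r_def)
  define v where "v k = u (r k)" for k
  have vm [measurable]: "v k \<in> borel_measurable M" for k by (simp add: v_def)
  have step: "sq_dist M (v (Suc k)) (v k) \<le> ennreal ((1/4) ^ k)" for k
    unfolding v_def using rN[of k] rS[of k] by (intro N) auto
  \<comment> \<open>The weight \<open>2 ^ k\<close> still leaves the integrals summable against
    \<open>(1/4) ^ k\<close>. Where \<open>G\<close> is finite, it forces the increments to decay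
    like \<open>sqrt (1/2) ^ k\<close>, so they can be summed.\<close>
  define G where "G x = (\<Sum>k. ennreal (2 ^ k * (cmod (v (Suc k) x - v k x))\<^sup>2))" for x
  have "(\<integral>\<^sup>+x. G x \<partial>M) = (\<Sum>k. (\<integral>\<^sup>+x. ennreal (2 ^ k * (cmod (v (Suc k) x - v k x))\<^sup>2) \<partial>M))"
    unfolding G_def by (intro nn_integral_suminf) measurable
  also have "\<dots> = (\<Sum>k. ennreal (2 ^ k) * sq_dist M (v (Suc k)) (v k))"
    by (simp add: sq_dist_def ennreal_mult nn_integral_cmult)
  also have "\<dots> \<le> (\<Sum>k. ennreal (1 * (1/2) ^ k))"
  proof (intro suminf_le summableI)
    fix k
    have "ennreal (2 ^ k) * sq_dist M (v (Suc k)) (v k) \<le> ennreal (2 ^ k) * ennreal ((1/4) ^ k)"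
      by (intro mult_left_mono step) auto
    also have "\<dots> = ennreal (2 ^ k * (1/4) ^ k)" by (intro ennreal_mult[symmetric]) auto
    also have "(2::real) ^ k * (1/4) ^ k = 1 * (1/2) ^ k" by (simp add: power_mult_distrib[symmetric])
    finally show "ennreal (2 ^ k) * sq_dist M (v (Suc k)) (v k) \<le> ennreal (1 * (1/2) ^ k)" .
  qed
  also have "\<dots> = ennreal (1 / (1 - 1/2))" by (rule geometric_ennreal) auto
  finally have "(\<integral>\<^sup>+x. G x \<partial>M) \<noteq> \<infinity>" by (auto simp: top_unique)
  then have "AE x in M. G x \<noteq> \<infinity>"
    by (intro nn_integral_PInf_AE) (auto simp: G_def)
  then have conv: "AE x in M. convergent (\<lambda>k. v k x)"
  proof eventually_elim
    case (elim x)
    then obtain y where y: "G x = ennreal y" "0 \<le> y" by (cases "G x") auto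
    have le: "cmod (v (Suc k) x - v k x) \<le> sqrt y * sqrt (1/2) ^ k" for k
    proof -
      have "ennreal (2 ^ k * (cmod (v (Suc k) x - v k x))\<^sup>2) \<le> ennreal y"
        unfolding y(1)[symmetric] G_def by (rule ennreal_le_suminf)
      then have "2 ^ k * (cmod (v (Suc k) x - v k x))\<^sup>2 \<le> y" using y by (simp add: ennreal_le_iff)
      then have "(cmod (v (Suc k) x - v k x))\<^sup>2 \<le> y * (1/2) ^ k"
        by (simp add: power_divide field_simps)
      then have "cmod (v (Suc k) x - v k x) \<le> sqrt (y * (1/2) ^ k)" by (rule real_le_rsqrt)
      then show ?thesis by (simp only: real_sqrt_mult real_sqrt_power)
    qed
    have "summable (\<lambda>k. sqrt y * sqrt (1/2) ^ k)"
      by (intro summable_mult summable_geometric) (simp add: real_sqrt_divide)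
    then have "summable (\<lambda>k. v (Suc k) x - v k x)"
      by (rule summable_comparison_test'[of _ 0]) (use le in auto)
    then have "convergent (\<lambda>n. \<Sum>k<n. v (Suc k) x - v k x)" by (simp add: summable_iff_convergent)
    then have "convergent (\<lambda>n. v n x - v 0 x)" using sum_lessThan_telescope[of "\<lambda>k. v k x"] by simp
    then have "convergent (\<lambda>n. (v n x - v 0 x) + v 0 x)" by (intro convergent_add convergent_const)
    then show ?case by simp
  qed
  define h where "h x = lim (\<lambda>k. v k x)" for x
  have hm [measurable]: "h \<in> borel_measurable M" unfolding h_def by measurable
  have lim: "AE x in M. (\<lambda>k. v k x) \<longlonglongrightarrow> h x"
    using conv by eventually_elim (simp add: h_def convergent_LIMSEQ_iff)
  have near: "\<exists>K. \<forall>n\<ge>K. sq_dist M (u n) h \<le> ennreal e" if e: "0 < e" for e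
  proof -
    obtain K where K: "\<And>m n. K \<le> m \<Longrightarrow> K \<le> n \<Longrightarrow> sq_dist M (u m) (u n) \<le> ennreal e" using cauchy[OF e] by blast
    have "sq_dist M (u n) h \<le> ennreal e" if n: "K \<le> n" for n
      unfolding sq_dist_def
    proof (rule nn_integral_fatou_le[where u = "\<lambda>k x. ennreal ((cmod (u n x - v (k + K) x))\<^sup>2)"])
      show "AE x in M. (\<lambda>k. ennreal ((cmod (u n x - v (k + K) x))\<^sup>2)) \<longlonglongrightarrow> ennreal ((cmod (u n x - h x))\<^sup>2)"
        using lim
      proof eventually_elim
        case (elim x)
        then have "(\<lambda>k. v (k + K) x) \<longlonglongrightarrow> h x" by (rule LIMSEQ_ignore_initial_segment)
        then show ?case by (intro tendsto_ennrealI tendsto_power tendsto_norm tendsto_diff tendsto_const)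
      qed
      show "(\<integral>\<^sup>+x. ennreal ((cmod (u n x - v (k + K) x))\<^sup>2) \<partial>M) \<le> ennreal e" for k
        using K[OF n, of "r (k + K)"] rk[of "k + K"] by (simp add: sq_dist_def v_def)
    qed measurable
    then show ?thesis by blast
  qed
  have hL: "h \<in> L2_space M"
  proof -
    obtain n where "sq_dist M (u n) h \<le> ennreal 1" using near[of 1] by auto
    then have "sq_dist M (u n) h < \<infinity>" by (auto intro: le_less_trans)
    then have "(\<lambda>x. u n x - h x) \<in> L2_space M" by (simp add: L2_space_iff sq_dist_def)
    from L2_space_diff[OF u[of n] this] show ?thesis by simp
  qed
  have "(\<lambda>n. sq_dist M (u n) h) \<longlonglongrightarrow> 0"
  proof (rule order_tendstoI)
    fix e :: ennreal assume "0 < e"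
    then obtain e' :: real where e': "0 < e'" "ennreal e' < e"
      by (metis ennreal_less_zero_iff dense ennreal_cases top.not_eq_extremum less_trans ennreal_less_top
          ennreal_0 zero_less_iff_neq_zero order_less_irrefl)
    obtain K where "\<forall>n\<ge>K. sq_dist M (u n) h \<le> ennreal e'" using near[OF e'(1)] by blast
    then show "eventually (\<lambda>n. sq_dist M (u n) h < e) sequentially"
      using e'(2) unfolding eventually_sequentially by (meson le_less_trans)
  qed simp
  with hL show ?thesis by blast
qed

lemma sq_dist_op_le:
  assumes T: "L2_bounded_operator M T" and f: "f \<in> L2_space M" "g \<in> L2_space M"
  shows "sq_dist M (T f) (T g) \<le> ennreal ((L2_opnorm M T)\<^sup>2) * sq_dist M f g"
proof -
  have "sq_dist M (T f) (T g) = (\<integral>\<^sup>+x. ennreal ((cmod (T (\<lambda>x. f x - g x) x))\<^sup>2) \<partial>M)"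
    unfolding sq_dist_def
    by (rule nn_integral_cong_AE) (use op_diff[OF T f] in \<open>eventually_elim, simp\<close>)
  also have "\<dots> \<le> ennreal ((L2_opnorm M T)\<^sup>2) * sq_dist M f g"
    unfolding sq_dist_def by (rule nn_integral_op_le[OF T L2_space_diff[OF f]])
  finally show ?thesis .
qed

section \<open>Truncation in space and height\<close>

definition trunc :: "nat \<Rightarrow> ('a::euclidean_space \<Rightarrow> complex) \<Rightarrow> 'a \<Rightarrow> complex" where
  "trunc n f = (\<lambda>x. if norm x \<le> real n \<and> cmod (f x) \<le> real n then f x else 0)"

lemma trunc_measurable:
  fixes f :: "'a::euclidean_space \<Rightarrow> complex"
  assumes [measurable]: "f \<in> borel_measurable lebesgue"
  shows "trunc n f \<in> borel_measurable lebesgue"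
  unfolding trunc_def
proof (rule measurable_If)
  have "{x \<in> space lebesgue. cmod (f x) \<le> real n} \<in> sets lebesgue" by measurable
  moreover have "(cball 0 (real n) :: 'a set) \<in> sets lebesgue" by (intro sets_borel_lebesgue) auto
  ultimately have "cball 0 (real n) \<inter> {x \<in> space lebesgue. cmod (f x) \<le> real n} \<in> sets lebesgue"
    by (rule sets.Int[rotated])
  also have "cball 0 (real n) \<inter> {x \<in> space lebesgue. cmod (f x) \<le> real n} =
      {x \<in> space lebesgue. norm x \<le> real n \<and> cmod (f x) \<le> real n}" by auto
  finally show "{x \<in> space lebesgue. norm x \<le> real n \<and> cmod (f x) \<le> real n} \<in> sets lebesgue" .
qed auto

lemma test_function_trunc:
  assumes "f \<in> borel_measurable lebesgue" shows "test_function (trunc n f)"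
  by (rule niceI[OF trunc_measurable[OF assms], of _ "real n" "real n"])
     (auto simp: trunc_def split: if_splits)

lemma cmod_trunc_le: "cmod (trunc n f x) \<le> cmod (f x)"
  by (simp add: trunc_def)

context
  fixes M :: "'a::euclidean_space measure"
  assumes M: "sets M = sets lebesgue"
begin

lemma trunc_L2:
  assumes f: "f \<in> L2_space M"
  shows "trunc n f \<in> L2_space M"
    "(\<integral>\<^sup>+x. ennreal ((cmod (trunc n f x))\<^sup>2) \<partial>M) \<le> (\<integral>\<^sup>+x. ennreal ((cmod (f x))\<^sup>2) \<partial>M)"
proof -
  show le: "(\<integral>\<^sup>+x. ennreal ((cmod (trunc n f x))\<^sup>2) \<partial>M) \<le> (\<integral>\<^sup>+x. ennreal ((cmod (f x))\<^sup>2) \<partial>M)"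
    by (intro nn_integral_mono ennreal_leI power_mono cmod_trunc_le) auto
  have "trunc n f \<in> borel_measurable M"
    using trunc_measurable[of f n] L2_space_measurable[OF f]
    unfolding measurable_cong_sets[OF M refl] by blast
  then show "trunc n f \<in> L2_space M" using le f by (auto simp: L2_space_iff intro: le_less_trans)
qed

lemma sq_dist_trunc:
  assumes f: "f \<in> L2_space M"
  shows "(\<lambda>n. sq_dist M (trunc n f) f) \<longlonglongrightarrow> 0"
proof -
  have [measurable]: "f \<in> borel_measurable M" "\<And>n. trunc n f \<in> borel_measurable M"
    using f trunc_L2(1)[OF f] by (auto dest: L2_space_measurable)
  have "(\<lambda>n. \<integral>\<^sup>+x. ennreal ((cmod (trunc n f x - f x))\<^sup>2) \<partial>M) \<longlonglongrightarrow> (\<integral>\<^sup>+x. 0 \<partial>M)"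
  proof (rule nn_integral_dominated_convergence[where w = "\<lambda>x. ennreal ((cmod (f x))\<^sup>2)"])
    show "AE x in M. ennreal ((cmod (trunc n f x - f x))\<^sup>2) \<le> ennreal ((cmod (f x))\<^sup>2)" for n
      by (intro always_eventually allI ennreal_leI power_mono) (auto simp: trunc_def)
    show "(\<integral>\<^sup>+x. ennreal ((cmod (f x))\<^sup>2) \<partial>M) < \<infinity>" using f by (simp add: L2_space_iff)
    show "AE x in M. (\<lambda>n. ennreal ((cmod (trunc n f x - f x))\<^sup>2)) \<longlonglongrightarrow> 0"
    proof (intro always_eventually allI)
      fix x
      have "\<forall>\<^sub>F n in sequentially. max (norm x) (cmod (f x)) \<le> real n"
        using filterlim_real_sequentially by (rule filterlim_at_top[THEN iffD1, rule_format])
      then have "\<forall>\<^sub>F n in sequentially. ennreal ((cmod (trunc n f x - f x))\<^sup>2) = 0"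
        by eventually_elim (simp add: trunc_def)
      then show "(\<lambda>n. ennreal ((cmod (trunc n f x - f x))\<^sup>2)) \<longlonglongrightarrow> 0" by (rule tendsto_eventually)
    qed
  qed measurable
  then show ?thesis by (simp add: sq_dist_def)
qed

end

section \<open>The bound on both spaces and the extended operator\<close>

context
  fixes Ccz \<alpha> :: real and K :: "real^'n \<Rightarrow> real^'n \<Rightarrow> complex" and T and w :: "real^'n \<Rightarrow> real"
  assumes \<alpha>: "0 < \<alpha>" and K: "CZ_kernel Ccz \<alpha> K"
    and T: "L2_bounded_operator lebesgue T" and TK: "has_kernel T K"
    and A2: "A2_weight w"
begin

abbreviation (input) "\<mu> \<equiv> weighted w"
abbreviation (input) "\<kappa> \<equiv> weighted_const CARD('n) Ccz \<alpha> (L2_opnorm lebesgue T) * A2_const w"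

lemma sets_\<mu>: "sets \<mu> = sets lebesgue" by (rule sets_weighted)

lemma \<kappa>_nonneg: "0 \<le> \<kappa>"
  using weighted_const_nonneg[OF \<alpha> K T TK A2] A2_const_nonneg by simp

lemma measurable_\<mu>: "borel_measurable \<mu> = borel_measurable lebesgue"
  by (rule measurable_cong_sets[OF sets_\<mu> refl])

text \<open>Truncations of \<open>f\<close> converge to it in the unweighted space, where
  \<open>T\<close> is bounded, while their weighted norms do not exceed that of \<open>f\<close>.
  The weighted bound survives the unweighted limit.\<close>

lemma weighted_bound:
  assumes f: "f \<in> L2_space lebesgue" "f \<in> L2_space \<mu>"
  shows "T f \<in> L2_space \<mu>" "L2_nrm \<mu> (T f) \<le> \<kappa> * L2_nrm \<mu> f"
proof -
  have fm: "f \<in> borel_measurable lebesgue" using f by (auto dest: L2_space_measurable)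
  have nt: "test_function (trunc n f)" for n by (rule test_function_trunc[OF fm])
  have tL: "trunc n f \<in> L2_space lebesgue" for n by (rule trunc_L2(1)[OF refl f(1)])
  have lim: "(\<lambda>n. sq_dist lebesgue (T (trunc n f)) (T f)) \<longlonglongrightarrow> 0"
  proof (rule tendsto_0_bound2)
    show "sq_dist lebesgue (T (trunc n f)) (T f) \<le> ennreal ((L2_opnorm lebesgue T)\<^sup>2) * sq_dist lebesgue (trunc n f) f + ennreal 0 * 0" for n
      using sq_dist_op_le[OF T tL f(1)] by simp
  qed (use sq_dist_trunc[OF refl f(1)] in auto)
  have "(\<integral>\<^sup>+x. ennreal ((cmod (T f x))\<^sup>2) \<partial>\<mu>) \<le> ennreal ((\<kappa> * L2_nrm \<mu> f)\<^sup>2)"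
  proof (rule sq_dist_limit_bound[OF _ _ lim])
    show "T (trunc n f) \<in> L2_space lebesgue" for n by (rule op_L2[OF T tL])
    show "T f \<in> L2_space lebesgue" by (rule op_L2[OF T f(1)])
    show "AE x in \<mu>. P x" if "AE x in lebesgue. P x" for P by (rule AE_weighted[OF A2 that])
    show "sets \<mu> = sets lebesgue" by (rule sets_\<mu>)
    show "(\<integral>\<^sup>+x. ennreal ((cmod (T (trunc n f) x))\<^sup>2) \<partial>\<mu>) \<le> ennreal ((\<kappa> * L2_nrm \<mu> f)\<^sup>2)" for n
      by (rule test_function_weighted_bound[OF \<alpha> K T TK A2 nt])
         (use trunc_L2(2)[OF sets_\<mu> f(2)] nn_integral_L2_nrm[OF f(2)] in auto)
  qed
  moreover have "T f \<in> borel_measurable \<mu>"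
    using L2_space_measurable[OF op_L2[OF T f(1)]] by (simp add: measurable_\<mu>)
  ultimately show "T f \<in> L2_space \<mu>" "L2_nrm \<mu> (T f) \<le> \<kappa> * L2_nrm \<mu> f"
    using L2_nrm_le[of "\<kappa> * L2_nrm \<mu> f" \<mu> "T f"] \<kappa>_nonneg by (auto simp: mult_nonneg_nonneg)
qed

lemma sq_dist_weighted_le:
  assumes f: "f \<in> L2_space lebesgue" "f \<in> L2_space \<mu>" and g: "g \<in> L2_space lebesgue" "g \<in> L2_space \<mu>"
  shows "sq_dist \<mu> (T f) (T g) \<le> ennreal (\<kappa>\<^sup>2) * sq_dist \<mu> f g"
proof -
  let ?d = "\<lambda>x. f x - g x"
  have d: "?d \<in> L2_space lebesgue" "?d \<in> L2_space \<mu>" using f g by (auto intro: L2_space_diff)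
  have "AE x in \<mu>. T ?d x = T f x - T g x" by (rule AE_weighted[OF A2 op_diff[OF T f(1) g(1)]])
  then have "sq_dist \<mu> (T f) (T g) = (\<integral>\<^sup>+x. ennreal ((cmod (T ?d x))\<^sup>2) \<partial>\<mu>)"
    unfolding sq_dist_def by (rule nn_integral_cong_AE[OF AE_mp[OF _ AE_I2]]) simp
  also have "\<dots> = ennreal ((L2_nrm \<mu> (T ?d))\<^sup>2)" by (rule nn_integral_L2_nrm[OF weighted_bound(1)[OF d]])
  also have "\<dots> \<le> ennreal ((\<kappa> * L2_nrm \<mu> ?d)\<^sup>2)"
    using weighted_bound(2)[OF d] by (intro ennreal_leI power_mono) auto
  also have "\<dots> = ennreal (\<kappa>\<^sup>2) * ennreal ((L2_nrm \<mu> ?d)\<^sup>2)"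
    by (subst power_mult_distrib) (rule ennreal_mult', simp)
  also have "ennreal ((L2_nrm \<mu> ?d)\<^sup>2) = sq_dist \<mu> f g"
    unfolding sq_dist_def by (rule nn_integral_L2_nrm[OF d(2), symmetric])
  finally show ?thesis .
qed

lemma trunc_both:
  assumes "f \<in> L2_space \<mu>"
  shows "trunc n f \<in> L2_space lebesgue" "trunc n f \<in> L2_space \<mu>"
  using test_function_L2[OF test_function_trunc, of f n] trunc_L2(1)[OF sets_\<mu> assms] L2_space_measurable[OF assms]
  by (auto simp: measurable_\<mu>)

text \<open>Truncations of a function of the weighted space lie in both spaces, so \<open>T\<close>
  applies to them, and the weighted bound makes their images a Cauchy sequence.\<close>

definition ext_op :: "(real^'n \<Rightarrow> complex) \<Rightarrow> real^'n \<Rightarrow> complex" where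
  "ext_op f = (SOME h. h \<in> L2_space \<mu> \<and> (\<lambda>n. sq_dist \<mu> (T (trunc n f)) h) \<longlonglongrightarrow> 0)"

lemma ext_op:
  assumes f: "f \<in> L2_space \<mu>"
  shows "ext_op f \<in> L2_space \<mu>" "(\<lambda>n. sq_dist \<mu> (T (trunc n f)) (ext_op f)) \<longlonglongrightarrow> 0"
proof -
  note tb = trunc_both[OF f]
  have Tt: "T (trunc n f) \<in> L2_space \<mu>" for n by (rule weighted_bound(1)[OF tb])
  have fm: "f \<in> borel_measurable \<mu>" "trunc n f \<in> borel_measurable \<mu>" for n
    using f tb(2) by (auto dest: L2_space_measurable)
  have "\<exists>h. h \<in> L2_space \<mu> \<and> (\<lambda>n. sq_dist \<mu> (T (trunc n f)) h) \<longlonglongrightarrow> 0"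
  proof (rule L2_complete[OF Tt])
    fix e :: real assume e: "0 < e"
    \<comment> \<open>Two uses of the triangle inequality with factor 2 give
      \<open>4 * \<delta>\<close>; the added 1 keeps the denominator positive when the bound is
      0.\<close>
    define \<delta> where "\<delta> = e / (4 * (\<kappa>\<^sup>2 + 1))"
    have k: "0 < \<kappa>\<^sup>2 + 1" by (simp add: add_nonneg_pos)
    then have \<delta>: "0 < \<delta>" using e by (simp add: \<delta>_def)
    have "eventually (\<lambda>n. sq_dist \<mu> (trunc n f) f < ennreal \<delta>) sequentially"
      using sq_dist_trunc[OF sets_\<mu> f] \<delta> by (intro order_tendstoD(2)) auto
    then obtain N where N: "\<And>n. N \<le> n \<Longrightarrow> sq_dist \<mu> (trunc n f) f < ennreal \<delta>" by (auto simp: eventually_sequentially)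
    have "sq_dist \<mu> (T (trunc m f)) (T (trunc n f)) \<le> ennreal e" if "N \<le> m" "N \<le> n" for m n
    proof -
      have "sq_dist \<mu> (trunc m f) (trunc n f) \<le> ennreal 2 * sq_dist \<mu> (trunc m f) f + ennreal 2 * sq_dist \<mu> f (trunc n f)"
        by (rule sq_dist_triangle[OF fm(2) fm(1) fm(2)])
      also have "\<dots> \<le> ennreal 2 * ennreal \<delta> + ennreal 2 * ennreal \<delta>"
        using N[OF that(1)] N[OF that(2)] by (intro add_mono mult_left_mono) (auto simp: sq_dist_commute[of \<mu> f])
      also have "\<dots> = ennreal (4 * \<delta>)"
      proof -
        have "ennreal 2 * ennreal \<delta> = ennreal (2 * \<delta>)" by (rule ennreal_mult'[symmetric]) simp
        then show ?thesis using \<delta> by (simp only: ennreal_plus[symmetric]) simp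
      qed
      finally have "sq_dist \<mu> (trunc m f) (trunc n f) \<le> ennreal (4 * \<delta>)" .
      then have "ennreal (\<kappa>\<^sup>2) * sq_dist \<mu> (trunc m f) (trunc n f) \<le> ennreal (\<kappa>\<^sup>2) * ennreal (4 * \<delta>)"
        by (rule mult_left_mono) simp
      also have "\<dots> = ennreal (\<kappa>\<^sup>2 * (4 * \<delta>))" by (rule ennreal_mult'[symmetric]) simp
      also have "\<dots> \<le> ennreal ((\<kappa>\<^sup>2 + 1) * (4 * \<delta>))" using \<delta> by (intro ennreal_leI mult_right_mono) auto
      also have "(\<kappa>\<^sup>2 + 1) * (4 * \<delta>) = e"
      proof -
        have "c * (4 * (e / (4 * c))) = e" if "0 < c" for c :: real using that by simp
        from this[OF k] show ?thesis unfolding \<delta>_def .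
      qed
      finally show ?thesis using sq_dist_weighted_le[OF tb tb, of m n] by (rule order.trans[rotated])
    qed
    then show "\<exists>N. \<forall>m\<ge>N. \<forall>n\<ge>N. sq_dist \<mu> (T (trunc m f)) (T (trunc n f)) \<le> ennreal e" by blast
  qed
  from someI_ex[OF this] show "ext_op f \<in> L2_space \<mu>" "(\<lambda>n. sq_dist \<mu> (T (trunc n f)) (ext_op f)) \<longlonglongrightarrow> 0"
    unfolding ext_op_def by auto
qed

text \<open>Truncation is not linear. To prove linearity and agreement with \<open>T\<close>, the
  limit has to be the same for all approximating sequences.\<close>

lemma ext_op_limit:
  assumes f: "f \<in> L2_space \<mu>" and \<phi>: "\<And>n. \<phi> n \<in> L2_space lebesgue" "\<And>n. \<phi> n \<in> L2_space \<mu>"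
    and lim: "(\<lambda>n. sq_dist \<mu> (\<phi> n) f) \<longlonglongrightarrow> 0"
  shows "(\<lambda>n. sq_dist \<mu> (T (\<phi> n)) (ext_op f)) \<longlonglongrightarrow> 0"
proof -
  note tb = trunc_both[OF f]
  have m: "f \<in> borel_measurable \<mu>" "trunc n f \<in> borel_measurable \<mu>" "\<phi> n \<in> borel_measurable \<mu>"
     "T (trunc n f) \<in> borel_measurable \<mu>" "T (\<phi> n) \<in> borel_measurable \<mu>" "ext_op f \<in> borel_measurable \<mu>" for n
    using f tb(2) \<phi> ext_op(1)[OF f] weighted_bound(1)[OF tb] weighted_bound(1)[OF \<phi>]
    by (auto intro: L2_space_measurable)
  have 1: "(\<lambda>n. sq_dist \<mu> (\<phi> n) (trunc n f)) \<longlonglongrightarrow> 0"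
  proof (rule tendsto_0_bound2[OF _ lim])
    show "sq_dist \<mu> (\<phi> n) (trunc n f) \<le> ennreal 2 * sq_dist \<mu> (\<phi> n) f + ennreal 2 * sq_dist \<mu> (trunc n f) f" for n
      using sq_dist_triangle[OF m(3,1,2)] by (simp add: sq_dist_commute[of \<mu> f])
  qed (rule sq_dist_trunc[OF sets_\<mu> f])
  have 2: "(\<lambda>n. sq_dist \<mu> (T (\<phi> n)) (T (trunc n f))) \<longlonglongrightarrow> 0"
  proof (rule tendsto_0_bound2[OF _ 1])
    show "sq_dist \<mu> (T (\<phi> n)) (T (trunc n f)) \<le> ennreal (\<kappa>\<^sup>2) * sq_dist \<mu> (\<phi> n) (trunc n f) + ennreal 0 * 0" for n
      using sq_dist_weighted_le[OF \<phi> tb] by simp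
  qed simp
  show ?thesis
    by (rule tendsto_0_bound2[OF _ 2 ext_op(2)[OF f]]) (rule sq_dist_triangle[OF m(5,4,6)])
qed

text \<open>\<open>f\<close> is approximated by the constant sequence. The equality obtained almost
  everywhere for the weighted measure passes to Lebesgue measure because the weight is positive
  almost everywhere.\<close>

lemma ext_op_eq:
  assumes f: "f \<in> L2_space lebesgue" "f \<in> L2_space \<mu>"
  shows "AE x in lebesgue. ext_op f x = T f x"
proof -
  have "sq_dist \<mu> f f = 0" by (simp add: sq_dist_def)
  then have "(\<lambda>n::nat. sq_dist \<mu> (T f) (ext_op f)) \<longlonglongrightarrow> 0"
    using ext_op_limit[OF f(2), of "\<lambda>_. f"] f by simp
  then have "sq_dist \<mu> (T f) (ext_op f) = 0" using LIMSEQ_unique[OF tendsto_const] by blast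
  then have "AE x in \<mu>. T f x = ext_op f x"
    using weighted_bound(1)[OF f] ext_op(1)[OF f(2)] by (subst (asm) sq_dist_eq_0_iff) (auto dest: L2_space_measurable)
  then have "AE x in lebesgue. 0 < ennreal (w x) \<longrightarrow> T f x = ext_op f x"
    unfolding weighted_def using weight_measurable[OF A2] by (subst (asm) AE_density) auto
  with weight_pos[OF A2] show ?thesis
    by eventually_elim simp
qed

lemma ext_op_linear:
  assumes f: "f \<in> L2_space \<mu>" and g: "g \<in> L2_space \<mu>"
  shows "AE x in \<mu>. ext_op (\<lambda>y. a * f y + b * g y) x = a * ext_op f x + b * ext_op g x"
proof -
  define \<phi> where "\<phi> n = (\<lambda>y. a * trunc n f y + b * trunc n g y)" for n
  have lc: "(\<lambda>y. a * p y + b * q y) \<in> L2_space M" if "p \<in> L2_space M" "q \<in> L2_space M" for p q and M :: "(real^'n) measure"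
    using that by (intro L2_space_add L2_space_cmult)
  note tf = trunc_both[OF f] and tg = trunc_both[OF g]
  have \<phi>: "\<phi> n \<in> L2_space lebesgue" "\<phi> n \<in> L2_space \<mu>" for n unfolding \<phi>_def using tf tg by (auto intro: lc)
  have comb: "sq_dist \<mu> (\<lambda>y. a * p y + b * q y) (\<lambda>y. a * p' y + b * q' y) \<le>
     ennreal (2 * (cmod a)\<^sup>2) * sq_dist \<mu> p p' + ennreal (2 * (cmod b)\<^sup>2) * sq_dist \<mu> q q'"
    if L: "p \<in> L2_space \<mu>" "q \<in> L2_space \<mu>" "p' \<in> L2_space \<mu>" "q' \<in> L2_space \<mu>" for p q p' q'
  proof -
    have [measurable]: "p \<in> borel_measurable \<mu>" "q \<in> borel_measurable \<mu>" "p' \<in> borel_measurable \<mu>" "q' \<in> borel_measurable \<mu>"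
      using L by (auto dest: L2_space_measurable)
    have "sq_dist \<mu> (\<lambda>y. a * p y + b * q y) (\<lambda>y. a * p' y + b * q' y) =
       (\<integral>\<^sup>+x. ennreal ((cmod (a * (p x - p' x) + b * (q x - q' x)))\<^sup>2) \<partial>\<mu>)"
      by (simp add: sq_dist_def algebra_simps)
    also have "\<dots> \<le> 2 * (\<integral>\<^sup>+x. ennreal ((cmod (a * (p x - p' x)))\<^sup>2) \<partial>\<mu>) + 2 * (\<integral>\<^sup>+x. ennreal ((cmod (b * (q x - q' x)))\<^sup>2) \<partial>\<mu>)"
      by (rule nn_integral_add_squared_le) measurable
    also have "(\<integral>\<^sup>+x. ennreal ((cmod (a * (p x - p' x)))\<^sup>2) \<partial>\<mu>) = ennreal ((cmod a)\<^sup>2) * sq_dist \<mu> p p'"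
      by (simp add: sq_dist_def norm_mult power_mult_distrib ennreal_mult nn_integral_cmult)
    also have "(\<integral>\<^sup>+x. ennreal ((cmod (b * (q x - q' x)))\<^sup>2) \<partial>\<mu>) = ennreal ((cmod b)\<^sup>2) * sq_dist \<mu> q q'"
      by (simp add: sq_dist_def norm_mult power_mult_distrib ennreal_mult nn_integral_cmult)
    finally show ?thesis by (simp add: ennreal_mult mult.assoc)
  qed
  have e: "ext_op f \<in> L2_space \<mu>" "ext_op g \<in> L2_space \<mu>" using ext_op(1) f g by auto
  have l1: "(\<lambda>n. sq_dist \<mu> (\<phi> n) (\<lambda>y. a * f y + b * g y)) \<longlonglongrightarrow> 0"
    unfolding \<phi>_def by (rule tendsto_0_bound2[OF comb[OF tf(2) tg(2) f g] sq_dist_trunc[OF sets_\<mu> f] sq_dist_trunc[OF sets_\<mu> g]])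
  have l2: "(\<lambda>n. sq_dist \<mu> (T (\<phi> n)) (ext_op (\<lambda>y. a * f y + b * g y))) \<longlonglongrightarrow> 0"
    by (rule ext_op_limit[OF lc[OF f g] \<phi> l1])
  have l3: "(\<lambda>n. sq_dist \<mu> (T (\<phi> n)) (\<lambda>y. a * ext_op f y + b * ext_op g y)) \<longlonglongrightarrow> 0"
  proof (rule tendsto_0_bound2[OF _ ext_op(2)[OF f] ext_op(2)[OF g]])
    fix n
    have "AE x in \<mu>. T (\<phi> n) x = a * T (trunc n f) x + b * T (trunc n g) x"
      unfolding \<phi>_def by (rule AE_weighted[OF A2 op_lincomb[OF T tf(1) tg(1)]])
    then have "sq_dist \<mu> (T (\<phi> n)) (\<lambda>y. a * ext_op f y + b * ext_op g y) =
      sq_dist \<mu> (\<lambda>y. a * T (trunc n f) y + b * T (trunc n g) y) (\<lambda>y. a * ext_op f y + b * ext_op g y)"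
      by (rule sq_dist_cong_AE) simp
    also have "\<dots> \<le> ennreal (2 * (cmod a)\<^sup>2) * sq_dist \<mu> (T (trunc n f)) (ext_op f) + ennreal (2 * (cmod b)\<^sup>2) * sq_dist \<mu> (T (trunc n g)) (ext_op g)"
      by (rule comb[OF weighted_bound(1)[OF tf] weighted_bound(1)[OF tg] e])
    finally show "sq_dist \<mu> (T (\<phi> n)) (\<lambda>y. a * ext_op f y + b * ext_op g y) \<le>
      ennreal (2 * (cmod a)\<^sup>2) * sq_dist \<mu> (T (trunc n f)) (ext_op f) + ennreal (2 * (cmod b)\<^sup>2) * sq_dist \<mu> (T (trunc n g)) (ext_op g)" .
  qed
  show ?thesis
    by (rule sq_dist_limit_unique[OF _ _ _ l2 l3])
       (use weighted_bound(1)[OF \<phi>] ext_op(1)[OF lc[OF f g]] lc[OF e] in \<open>auto dest: L2_space_measurable\<close>)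
qed

text \<open>The norm of \<open>S\<close> enters through the convergence of the images of truncations
  alone; on truncations \<open>S\<close> is \<open>T\<close>, and there the sharp bound is
  known.\<close>

lemma extension_bound:
  assumes S: "L2_bounded_operator \<mu> S"
    and eq: "\<And>f. f \<in> L2_space lebesgue \<Longrightarrow> f \<in> L2_space \<mu> \<Longrightarrow> AE x in lebesgue. S f x = T f x"
    and f: "f \<in> L2_space \<mu>"
  shows "L2_nrm \<mu> (S f) \<le> \<kappa> * L2_nrm \<mu> f"
proof -
  note tb = trunc_both[OF f]
  have lim: "(\<lambda>n. sq_dist \<mu> (S (trunc n f)) (S f)) \<longlonglongrightarrow> 0"
  proof (rule tendsto_0_bound2)
    show "sq_dist \<mu> (S (trunc n f)) (S f) \<le> ennreal ((L2_opnorm \<mu> S)\<^sup>2) * sq_dist \<mu> (trunc n f) f + ennreal 0 * 0" for n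
      using sq_dist_op_le[OF S tb(2) f] by simp
  qed (use sq_dist_trunc[OF sets_\<mu> f] in auto)
  have "(\<integral>\<^sup>+x. ennreal ((cmod (S f x))\<^sup>2) \<partial>\<mu>) \<le> ennreal ((\<kappa> * L2_nrm \<mu> f)\<^sup>2)"
  proof (rule sq_dist_limit_bound[OF _ _ lim])
    fix n
    have "AE x in \<mu>. S (trunc n f) x = T (trunc n f) x" by (rule AE_weighted[OF A2 eq[OF tb]])
    then have "(\<integral>\<^sup>+x. ennreal ((cmod (S (trunc n f) x))\<^sup>2) \<partial>\<mu>) = (\<integral>\<^sup>+x. ennreal ((cmod (T (trunc n f) x))\<^sup>2) \<partial>\<mu>)"
      by (rule nn_integral_cong_AE[OF AE_mp[OF _ AE_I2]]) simp
    also have "\<dots> \<le> ennreal ((\<kappa> * L2_nrm \<mu> f)\<^sup>2)"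
      by (rule test_function_weighted_bound[OF \<alpha> K T TK A2 test_function_trunc])
         (use trunc_L2(2)[OF sets_\<mu> f] nn_integral_L2_nrm[OF f] L2_space_measurable[OF f] in \<open>auto simp: measurable_\<mu>\<close>)
    finally show "(\<integral>\<^sup>+x. ennreal ((cmod (S (trunc n f) x))\<^sup>2) \<partial>\<mu>) \<le> ennreal ((\<kappa> * L2_nrm \<mu> f)\<^sup>2)" .
  qed (use op_L2[OF S] tb(2) f in auto)
  then show ?thesis
    using \<kappa>_nonneg L2_space_measurable[OF op_L2[OF S f]] by (intro L2_nrm_le(1)) (auto simp: mult_nonneg_nonneg)
qed

lemma ext_op_bound:
  assumes f: "f \<in> L2_space \<mu>"
  shows "L2_nrm \<mu> (ext_op f) \<le> \<kappa> * L2_nrm \<mu> f"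
proof -
  note tb = trunc_both[OF f]
  have "(\<integral>\<^sup>+x. ennreal ((cmod (ext_op f x))\<^sup>2) \<partial>\<mu>) \<le> ennreal ((\<kappa> * L2_nrm \<mu> f)\<^sup>2)"
  proof (rule sq_dist_limit_bound[OF _ ext_op(1)[OF f] ext_op(2)[OF f]])
    show "T (trunc n f) \<in> L2_space \<mu>" for n by (rule weighted_bound(1)[OF tb])
    show "(\<integral>\<^sup>+x. ennreal ((cmod (T (trunc n f) x))\<^sup>2) \<partial>\<mu>) \<le> ennreal ((\<kappa> * L2_nrm \<mu> f)\<^sup>2)" for n
      by (rule test_function_weighted_bound[OF \<alpha> K T TK A2 test_function_trunc])
         (use trunc_L2(2)[OF sets_\<mu> f] nn_integral_L2_nrm[OF f] L2_space_measurable[OF f] in \<open>auto simp: measurable_\<mu>\<close>)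
  qed auto
  then show ?thesis
    using \<kappa>_nonneg L2_space_measurable[OF ext_op(1)[OF f]] by (intro L2_nrm_le(1)) (auto simp: mult_nonneg_nonneg)
qed

lemma weighted_extension_ext_op: "weighted_extension T w ext_op"
  unfolding weighted_extension_def L2_bounded_operator_def
  using ext_op(1) ext_op_linear ext_op_bound ext_op_eq by blast

end

theorem theorem1p1:
  "\<exists>C :: real \<Rightarrow> real \<Rightarrow> real \<Rightarrow> real.
     \<forall>(Ccz :: real) (\<alpha> :: real)
      (T :: (real^'n::finite \<Rightarrow> complex) \<Rightarrow> (real^'n \<Rightarrow> complex)) (w :: real^'n \<Rightarrow> real).
       0 < \<alpha> \<longrightarrow> CZ_operator Ccz \<alpha> T \<longrightarrow> A2_weight w \<longrightarrow>
         (\<forall>f \<in> L2_space lebesgue \<inter> L2_space (weighted w).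
            T f \<in> L2_space (weighted w) \<and>
            L2_nrm (weighted w) (T f)
              \<le> C Ccz \<alpha> (L2_opnorm lebesgue T) * enn2real (A2_characteristic w)
                  * L2_nrm (weighted w) f) \<and>
         (\<exists>S. weighted_extension T w S) \<and>
         (\<forall>S. weighted_extension T w S \<longrightarrow>
            (\<forall>f \<in> L2_space (weighted w).
               L2_nrm (weighted w) (S f)
                 \<le> C Ccz \<alpha> (L2_opnorm lebesgue T) * enn2real (A2_characteristic w)
                     * L2_nrm (weighted w) f))"
proof (intro exI[of _ "weighted_const CARD('n)"] allI impI)
  fix Ccz \<alpha> :: real and T :: "(real^'n \<Rightarrow> complex) \<Rightarrow> (real^'n \<Rightarrow> complex)" and w :: "real^'n \<Rightarrow> real"
  assume \<alpha>: "0 < \<alpha>" and CZ: "CZ_operator Ccz \<alpha> T" and A2: "A2_weight w"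
  from CZ obtain K where T: "L2_bounded_operator lebesgue T" and K: "CZ_kernel Ccz \<alpha> K" and TK: "has_kernel T K"
    by (auto simp: CZ_operator_def)
  show "(\<forall>f \<in> L2_space lebesgue \<inter> L2_space (weighted w).
          T f \<in> L2_space (weighted w) \<and>
          L2_nrm (weighted w) (T f)
            \<le> weighted_const CARD('n) Ccz \<alpha> (L2_opnorm lebesgue T) * enn2real (A2_characteristic w)
                * L2_nrm (weighted w) f) \<and>
       (\<exists>S. weighted_extension T w S) \<and>
       (\<forall>S. weighted_extension T w S \<longrightarrow>
          (\<forall>f \<in> L2_space (weighted w).
             L2_nrm (weighted w) (S f)
               \<le> weighted_const CARD('n) Ccz \<alpha> (L2_opnorm lebesgue T) * enn2real (A2_characteristic w)
                   * L2_nrm (weighted w) f))"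
    unfolding A2_const_def[symmetric]
  proof (intro conjI ballI allI impI)
    fix f assume "f \<in> L2_space lebesgue \<inter> L2_space (weighted w)"
    then show "T f \<in> L2_space (weighted w)"
      "L2_nrm (weighted w) (T f) \<le> weighted_const CARD('n) Ccz \<alpha> (L2_opnorm lebesgue T) * A2_const w * L2_nrm (weighted w) f"
      using weighted_bound[OF \<alpha> K T TK A2] by auto
  next
    show "\<exists>S. weighted_extension T w S"
      using weighted_extension_ext_op[OF \<alpha> K T TK A2] by blast
  next
    fix S f assume "weighted_extension T w S" "f \<in> L2_space (weighted w)"
    then show "L2_nrm (weighted w) (S f) \<le> weighted_const CARD('n) Ccz \<alpha> (L2_opnorm lebesgue T) * A2_const w * L2_nrm (weighted w) f"
      unfolding weighted_extension_def by (intro extension_bound[OF \<alpha> K T TK A2]) auto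
  qed
qed

end
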